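(* Let $n\ge2$, let $L_{0,hom}=\sum_{j=1}^nM_j^0D_j$ be strongly propagative, let $s>\tfrac12$, and let $u(x,t)=e^{-itL_{0,hom}}u_0$ be the solution of $iu_t=L_{0,hom}u$, $t\in\mathbb{R}$, $u(x,0)=u_0$, where $u_0\in(I-\mathcal{P})L^2(\mathbb{R}^n,\mathbb{C}^K)$ and $\mathcal{P}$ is the orthogonal projection onto $\ker(L_{0,hom})$. Define $u_Z(x,t)=\mathcal{E}[(1+|x|^2)^{-s/2}u(\cdot,t)](x)$. Then there exists a constant $C=C_{s,n}>0$ such that $$\int_{\mathbb{R}}\int_{\mathbb{R}^n}|u_Z(x,t)|^2\,dx\,dt\le C\|u_0\|_{L^2}^2.$$
   Context: $M_j^0$ are constant Hermitian $K\times K$ matrices, $D_j=\frac1i\partial_{x_j}$, $L_{0,hom}$ is the self-adjoint operator in $L^2(\mathbb{R}^n,\mathbb{C}^K)$ with Fourier symbol $M_{0,hom}(\xi)=\sum_jM_j^0\xi_j$ (unitary Fourier transform $\hat u(\xi)=(2\pi)^{-n/2}\int u(x)e^{-i\langle\xi,x\rangle}dx$). Strongly propagative: $\ker M_{0,hom}(\xi)$ has fixed dimension $0\le d<K$ for all $\xi\ne0$. $Z$ = set of $\xi\ne0$ where the discriminant of the minimal polynomial of $M_{0,hom}(\xi)$ vanishes; $\bar Z=Z\cup\{0\}$. $L^{2,s}=\{u:\|u\|_{0,s}^2=\int(1+|x|^2)^s|u|^2dx<\infty\}$; $\mathcal H^s$ = Fourier transforms of $L^{2,s}$ with $\|\hat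 u\|_{\mathcal H^s}=\|u\|_{0,s}$. $\Upsilon^s_Z\subseteq L^{2,s}(\mathbb{R}^n,\mathbb{C}^K)$ = inverse Fourier transforms of the closure of $C_0^\infty(\mathbb{R}^n\setminus\bar Z,\mathbb{C}^K)$ in $\mathcal H^s$. $\Upsilon_Z=\{(1+|x|^2)^{s/2}h:\ h\in\Upsilon^s_Z\}$, a closed subspace of $L^2(\mathbb{R}^n,\mathbb{C}^K)$, and $\mathcal{E}$ is the orthogonal projection of $L^2(\mathbb{R}^n,\mathbb{C}^K)$ onto $\Upsilon_Z$.
   Formalization: The constant C may depend on the matrices M_j^0 as well as on s and n (replacing M_j^0 by cM_j^0 multiplies the left side by 1/c); Z is expressed as the set of ξ≠0 where M_{0,hom}(ξ) has fewer distinct eigenvalues than the maximum over all ξ. *)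

theory Defs
  imports "HOL-Analysis.Analysis"
begin

text \<open>Functions R^n -> C^K are modelled as maps real^'n => complex^'k; L^2 objects are
  represented by (Borel) representatives, all relations below are insensitive to a.e. changes.\<close>

definition nsq :: "(real^'n::finite \<Rightarrow> real) \<Rightarrow> (real^'n \<Rightarrow> complex^'k::finite) \<Rightarrow> ennreal" where
  "nsq w f = (\<integral>\<^sup>+ x. ennreal (w x * (norm (f x))\<^sup>2) \<partial>lborel)"

definition wt :: "real \<Rightarrow> real^'n::finite \<Rightarrow> real" where
  "wt s x = (1 + (norm x)\<^sup>2) powr s"

definition l2sq :: "(real^'n::finite \<Rightarrow> complex^'k::finite) \<Rightarrow> ennreal" where
  "l2sq f = nsq (\<lambda>_. 1) f"

definition l2ssq :: "real \<Rightarrow> (real^'n::finite \<Rightarrow> complex^'k::finite) \<Rightarrow> ennreal" where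
  "l2ssq s f = nsq (wt s) f"

definition L2 :: "(real^'n::finite \<Rightarrow> complex^'k::finite) \<Rightarrow> bool" where
  "L2 f \<longleftrightarrow> f \<in> borel_measurable lborel \<and> l2sq f < \<infinity>"

definition L2s :: "real \<Rightarrow> (real^'n::finite \<Rightarrow> complex^'k::finite) \<Rightarrow> bool" where
  "L2s s f \<longleftrightarrow> f \<in> borel_measurable lborel \<and> l2ssq s f < \<infinity>"

definition inner_L2 :: "(real^'n::finite \<Rightarrow> complex^'k::finite) \<Rightarrow> (real^'n \<Rightarrow> complex^'k) \<Rightarrow> complex" where
  "inner_L2 f g = (LINT x|lborel. (\<Sum>i\<in>UNIV. f x $ i * cnj (g x $ i)))"

definition FT1 :: "(real^'n::finite \<Rightarrow> complex^'k::finite) \<Rightarrow> real^'n \<Rightarrow> complex^'k" where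
  "FT1 f \<xi> = (\<chi> i. complex_of_real ((2 * pi) powr (- real CARD('n) / 2)) *
       (LINT x|lborel. exp (- \<i> * complex_of_real (\<xi> \<bullet> x)) * f x $ i))"

text \<open>Plancherel (L^2) Fourier transform: fourier_rel f g means g = \<hat>f in L^2,
  i.e. g is the L^2-limit of FT1 of L^1 \<inter> L^2 functions converging to f in L^2.\<close>
definition fourier_rel :: "(real^'n::finite \<Rightarrow> complex^'k::finite) \<Rightarrow> (real^'n \<Rightarrow> complex^'k) \<Rightarrow> bool" where
  "fourier_rel f g \<longleftrightarrow> L2 f \<and> L2 g \<and>
     (\<exists>\<phi>::nat \<Rightarrow> real^'n \<Rightarrow> complex^'k.
        (\<forall>k. integrable lborel (\<phi> k) \<and> L2 (\<phi> k)) \<and>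
        (\<lambda>k. l2sq (\<lambda>x. \<phi> k x - f x)) \<longlonglongrightarrow> 0 \<and>
        (\<lambda>k. l2sq (\<lambda>\<xi>. FT1 (\<phi> k) \<xi> - g \<xi>)) \<longlonglongrightarrow> 0)"

fun Ck :: "nat \<Rightarrow> ('a::real_normed_vector \<Rightarrow> 'b::real_normed_vector) \<Rightarrow> bool" where
  "Ck 0 f = continuous_on UNIV f"
| "Ck (Suc k) f = (f differentiable_on UNIV \<and> continuous_on UNIV f \<and>
                    (\<forall>v. Ck k (\<lambda>x. frechet_derivative f (at x) v)))"

definition smooth :: "('a::real_normed_vector \<Rightarrow> 'b::real_normed_vector) \<Rightarrow> bool" where
  "smooth f \<longleftrightarrow> (\<forall>k. Ck k f)"

definition Mhom :: "('n::finite \<Rightarrow> complex^'k^'k) \<Rightarrow> real^'n \<Rightarrow> complex^'k^'k::finite" where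
  "Mhom M \<xi> = (\<chi> a b. \<Sum>j\<in>UNIV. complex_of_real (\<xi> $ j) * (M j $ a $ b))"

definition hermitian_mat :: "complex^'k^'k::finite \<Rightarrow> bool" where
  "hermitian_mat A \<longleftrightarrow> (\<forall>a b. A $ a $ b = cnj (A $ b $ a))"

definition kerdim :: "complex^'k^'k::finite \<Rightarrow> nat" where
  "kerdim A = vec.dim {v::complex^'k. A *v v = 0}"

definition strongly_propagative :: "('n::finite \<Rightarrow> complex^'k^'k::finite) \<Rightarrow> bool" where
  "strongly_propagative M \<longleftrightarrow>
     (\<exists>d. d < CARD('k) \<and> (\<forall>\<xi>::real^'n. \<xi> \<noteq> 0 \<longrightarrow> kerdim (Mhom M \<xi>) = d))"

definition eigs :: "complex^'k^'k::finite \<Rightarrow> complex set" where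
  "eigs A = {c. \<exists>v. v \<noteq> 0 \<and> A *v v = c *s v}"

definition Zset :: "('n::finite \<Rightarrow> complex^'k^'k::finite) \<Rightarrow> (real^'n) set" where
  "Zset M = {\<xi>. \<xi> \<noteq> 0 \<and>
      card (eigs (Mhom M \<xi>)) < Max (range (\<lambda>\<eta>. card (eigs (Mhom M \<eta>))))}"

definition Zbar :: "('n::finite \<Rightarrow> complex^'k^'k::finite) \<Rightarrow> (real^'n) set" where
  "Zbar M = Zset M \<union> {0}"

text \<open>\<Upsilon>^s_Z: h \<in> L^{2,s} whose Fourier transform is an H^s-limit of C_0^\<infinity>(R^n \ Zbar) functions;
  ||\<phi>_k - \<hat>h||_{H^s} = ||\<psi>_k - h||_{0,s} where \<hat>\<psi>_k = \<phi>_k.\<close>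
definition UpsS :: "('n::finite \<Rightarrow> complex^'k^'k::finite) \<Rightarrow> real \<Rightarrow> (real^'n \<Rightarrow> complex^'k) set" where
  "UpsS M s = {h. L2s s h \<and>
     (\<exists>(\<phi>::nat \<Rightarrow> real^'n \<Rightarrow> complex^'k) \<psi>.
        (\<forall>k. smooth (\<phi> k) \<and> compact (closure {\<xi>. \<phi> k \<xi> \<noteq> 0}) \<and>
             closure {\<xi>. \<phi> k \<xi> \<noteq> 0} \<inter> Zbar M = {} \<and>
             L2s s (\<psi> k) \<and> fourier_rel (\<psi> k) (\<phi> k)) \<and>
        (\<lambda>k. l2ssq s (\<lambda>x. \<psi> k x - h x)) \<longlonglongrightarrow> 0)}"

definition Ups :: "('n::finite \<Rightarrow> complex^'k^'k::finite) \<Rightarrow> real \<Rightarrow> (real^'n \<Rightarrow> complex^'k) set" where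
  "Ups M s = {f. \<exists>h\<in>UpsS M s. f = (\<lambda>x. wt (s/2) x *\<^sub>R h x)}"

definition is_E_proj :: "('n::finite \<Rightarrow> complex^'k^'k::finite) \<Rightarrow> real \<Rightarrow>
     (real^'n \<Rightarrow> complex^'k) \<Rightarrow> (real^'n \<Rightarrow> complex^'k) \<Rightarrow> bool" where
  "is_E_proj M s f g \<longleftrightarrow> g \<in> Ups M s \<and> (\<forall>w\<in>Ups M s. inner_L2 (\<lambda>x. f x - g x) w = 0)"

definition expM :: "real \<Rightarrow> complex^'k^'k::finite \<Rightarrow> complex^'k \<Rightarrow> complex^'k" where
  "expM t A v = (\<Sum>m. ((- \<i> * complex_of_real t) ^ m / fact m) *s (((\<lambda>w. A *v w) ^^ m) v))"

definition kerL :: "('n::finite \<Rightarrow> complex^'k^'k::finite) \<Rightarrow> (real^'n \<Rightarrow> complex^'k) set" where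
  "kerL M = {v. L2 v \<and> (\<exists>vh. fourier_rel v vh \<and> (AE \<xi> in lborel. Mhom M \<xi> *v vh \<xi> = 0))}"

end

theory Submission
  imports Defs "HOL-Probability.Probability"
begin

text \<open>
  The projection onto \<open>Ups\<close> only decreases norms, so it suffices to bound the integral of
  \<open>(1 + |x|\<^sup>2) powr (-s) * |u(t,x)|\<^sup>2\<close> over space-time.
  This weight is dominated by a dyadic sum of Gaussians \<open>exp (- d\<^sup>2 |x|\<^sup>2)\<close>, and since \<open>s > 1/2\<close> it
  is enough to bound the integral with such a Gaussian weight by a multiple of \<open>\<parallel>u0\<parallel>\<^sup>2 / d\<close>.

  On the Fourier side a Gaussian weight is the convolution with a Gaussian of width \<open>d\<close>. Expanding the
  square, inserting a factor \<open>exp (- \<sigma>\<^sup>2 t\<^sup>2 / 2)\<close> and integrating in time produces a double integral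
  over \<open>(\<eta>, \<zeta>)\<close> whose kernel is, in terms of eigenvalues \<open>\<lambda>\<close> of the symbol at \<open>\<eta>\<close> and \<open>\<mu>\<close> at
  \<open>\<zeta>\<close>, a normal density of width \<open>\<sigma>\<close> in \<open>\<lambda> - \<mu>\<close>. Orthogonality to the kernel of the operator leaves only
  nonzero eigenvalues. By Schur's test one needs a bound, uniform in \<open>\<sigma>\<close>, for the integral of this density
  against the Gaussian of width \<open>d\<close>. In polar coordinates the eigenvalues are linear in the radius,
  with slope bounded away from zero because the kernel of the symbol has constant dimension, so the radial
  integral of the density is bounded.
\<close>

section \<open>Gaussians\<close>

text \<open>The powers of d come from transport. An eigenvalue is linear along rays, with slope at
  least \<open>c0\<close> in modulus on unit directions unless it vanishes there. A wave packet
  should thus spend time of order 1/(c0 d) in a ball of radius 1/d, the scale of the Gaussian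
  weight. At d = 2^-m the weight contributes 4^(-s m) and this time 2^m, so the dyadic series has
  ratio 2^(1 - 2 s). The obstacle is that eigenvalues may cross and that eigenbases come from a
  choice operator, without continuity or measurability in the frequency. Two things avoid this: a
  basis can be kept fixed along a ray, the only direction in which eigenvalues are compared; and the
  sums that must be measurable are rewritten as quadratic forms or traces of functions of the
  matrix. Inner products of eigenvectors at two frequencies are bounded by 1, so that only such sums
  remain in the majorant kernel. The damping in t makes the interchange of integrals absolutely
  convergent and turns the formal resonance condition \<lambda> = \<mu> into a normal density.
  Fatou's lemma removes it as \<sigma> tends to 0.\<close>

lemma nn_integral_lborel_affine:
  fixes t :: "'a::euclidean_space"
  assumes [measurable]: "f \<in> borel_measurable borel" and c: "c \<noteq> 0"
  shows "(\<integral>\<^sup>+x. f x \<partial>lborel) = ennreal (\<bar>c\<bar> ^ DIM('a)) * (\<integral>\<^sup>+x. f (t + c *\<^sub>R x) \<partial>lborel)"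
  by (subst lborel_affine[OF c, of t])
     (simp add: nn_integral_density nn_integral_distr nn_integral_cmult)

lemma integrable_lborel_affine:
  fixes f :: "'a::euclidean_space \<Rightarrow> 'b :: {banach, second_countable_topology}"
  assumes f: "integrable lborel f" and c: "c \<noteq> 0"
  shows "integrable lborel (\<lambda>x. f (t + c *\<^sub>R x))"
  using f f[THEN borel_measurable_integrable] c unfolding integrable_iff_bounded
  by (subst (asm) nn_integral_lborel_affine[where c=c and t=t]) (auto simp: ennreal_mult_less_top)

lemma integral_lborel_affine:
  fixes f :: "'a::euclidean_space \<Rightarrow> 'b :: {banach, second_countable_topology}"
  assumes [measurable]: "f \<in> borel_measurable borel" and c: "c \<noteq> 0"
  shows "(LINT x|lborel. f x) = (\<bar>c\<bar> ^ DIM('a)) *\<^sub>R (LINT x|lborel. f (t + c *\<^sub>R x))"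
  by (subst lborel_affine[OF c, of t])
     (simp add: integral_density integral_distr)

lemma nn_integral_lborel_diff:
  fixes y :: "'a::euclidean_space"
  assumes "f \<in> borel_measurable borel"
  shows "(\<integral>\<^sup>+x. f (x - y) \<partial>lborel) = (\<integral>\<^sup>+x. f x \<partial>lborel)"
    "(\<integral>\<^sup>+x. f (y - x) \<partial>lborel) = (\<integral>\<^sup>+x. f x \<partial>lborel)"
  using nn_integral_lborel_affine[OF assms, of 1 "-y"] nn_integral_lborel_affine[OF assms, of "-1" y]
  by simp_all

lemma integrable_lborel_diff:
  fixes f :: "'a::euclidean_space \<Rightarrow> 'b :: {banach, second_countable_topology}"
  assumes "integrable lborel f"
  shows "integrable lborel (\<lambda>x. f (x - y))" "integrable lborel (\<lambda>x. f (y - x))"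
  using integrable_lborel_affine[OF assms, of 1 "-y"] integrable_lborel_affine[OF assms, of "-1" y]
  by simp_all

lemma integral_lborel_diff:
  fixes f :: "'a::euclidean_space \<Rightarrow> 'b :: {banach, second_countable_topology}"
  assumes "f \<in> borel_measurable borel"
  shows "(LINT x|lborel. f (x - y)) = (LINT x|lborel. f x)"
    "(LINT x|lborel. f (y - x)) = (LINT x|lborel. f x)"
  using integral_lborel_affine[OF assms, of 1 "-y"] integral_lborel_affine[OF assms, of "-1" y]
  by simp_all

lemma integrable_mult_pair:
  fixes f :: "'a \<Rightarrow> complex"
  assumes "sigma_finite_measure M" "sigma_finite_measure N"
    and f: "integrable M f" and g: "integrable N g"
  shows "integrable (M \<Otimes>\<^sub>M N) (\<lambda>p. f (fst p) * g (snd p))"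
proof -
  interpret M: sigma_finite_measure M by fact
  interpret N: sigma_finite_measure N by fact
  interpret pair_sigma_finite M N ..
  have [measurable]: "f \<in> borel_measurable M" "g \<in> borel_measurable N" using f g by auto
  show ?thesis
    by (rule Fubini_integrable) (use f g in \<open>auto simp: norm_mult intro!: integrable_mult_left\<close>)
qed

text \<open>Lebesgue measure is the image of a product of copies of the line under the coordinate
  map, so a product of functions of single coordinates integrates factor by factor. This carries the
  one-dimensional characteristic function over to several variables.\<close>

lemma integrable_prod_lborel:
  fixes f :: "'a::euclidean_space \<Rightarrow> real \<Rightarrow> complex"
  assumes f: "\<And>b. b \<in> Basis \<Longrightarrow> integrable lborel (f b)"
  shows "integrable lborel (\<lambda>x. \<Prod>b\<in>Basis. f b (x \<bullet> b))"
    and "(LINT x|lborel. (\<Prod>b\<in>Basis. f b (x \<bullet> b))) = (\<Prod>b\<in>Basis. (LINT x|lborel. f b x))"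
proof -
  interpret P: product_sigma_finite "\<lambda>_::'a. lborel :: real measure" by standard
  have [measurable]: "\<And>b. b \<in> Basis \<Longrightarrow> f b \<in> borel_measurable borel" using f by (metis
      borel_measurable_integrable measurable_lborel2)
  have L: "(lborel :: 'a measure) = distr (\<Pi>\<^sub>M b\<in>Basis. lborel) borel (\<lambda>f. \<Sum>b\<in>Basis. f b *\<^sub>R b)"
    by (rule lborel_eq)
  have m: "(\<lambda>f. \<Sum>b\<in>Basis. f b *\<^sub>R b :: 'a) \<in> (\<Pi>\<^sub>M b\<in>Basis. lborel) \<rightarrow>\<^sub>M borel" by measurable
  have eq: "(\<Prod>b\<in>Basis. f b ((\<Sum>c\<in>Basis. x c *\<^sub>R c) \<bullet> b)) = (\<Prod>b\<in>Basis. f b (x b))" for x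
    by (rule prod.cong) auto
  have me: "(\<lambda>x. \<Prod>b\<in>Basis. f b (x \<bullet> b)) \<in> borel_measurable borel" by measurable
  show "integrable lborel (\<lambda>x. \<Prod>b\<in>Basis. f b (x \<bullet> b))"
    unfolding L by (subst integrable_distr_eq[OF m me]) (auto simp: eq f intro!: P.product_integrable_prod)
  show "(LINT x|lborel. (\<Prod>b\<in>Basis. f b (x \<bullet> b))) = (\<Prod>b\<in>Basis. (LINT x|lborel. f b x))"
    unfolding L by (subst integral_distr[OF m me]) (simp add: eq f P.product_integral_prod)
qed

text \<open>The product form gives total mass and Fourier transform from dimension one; the radial
  closed form is \<open>gauss_eq\<close>. The parameter is the standard deviation, so
  \<open>r\<close> is also the width of the approximate identity.\<close>

definition gauss :: "real \<Rightarrow> 'a::euclidean_space \<Rightarrow> real" where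
  "gauss r x = (\<Prod>b\<in>Basis. normal_density 0 r (x \<bullet> b))"

lemma gauss_eq:
  fixes x :: "'a::euclidean_space"
  shows "gauss r x = (1 / sqrt (2 * pi * r\<^sup>2)) ^ DIM('a) * exp (- (norm x)\<^sup>2 / (2 * r\<^sup>2))"
proof -
  have "(\<Prod>b\<in>Basis. exp (- (x \<bullet> b)\<^sup>2 / (2 * r\<^sup>2))) = exp (\<Sum>b\<in>Basis. - (x \<bullet> b)\<^sup>2 / (2 * r\<^sup>2))"
    by (simp add: exp_sum)
  also have "(\<Sum>b\<in>Basis. - (x \<bullet> b)\<^sup>2 / (2 * r\<^sup>2)) = - (norm x)\<^sup>2 / (2 * r\<^sup>2)"
    unfolding power2_norm_eq_inner euclidean_inner[of x x]
    by (simp add: sum_divide_distrib[symmetric] sum_negf power2_eq_square)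
  finally show ?thesis
    by (simp add: gauss_def normal_density_def prod.distrib prod_dividef power_divide)
qed

lemma borel_measurable_gauss[measurable]: "gauss r \<in> borel_measurable borel"
  unfolding gauss_def[abs_def] by measurable

lemma gauss_nonneg[simp]: "0 \<le> gauss r x"
  by (simp add: gauss_def prod_nonneg)

lemma gauss_minus[simp]: "gauss r (- x) = gauss r x"
  by (simp add: gauss_eq)

lemma gauss_commute: "gauss r (x - y) = gauss r (y - x)"
  by (simp add: gauss_eq norm_minus_commute)

lemma nn_integral_gauss:
  assumes "0 < r" shows "(\<integral>\<^sup>+x. gauss r (x::'a::euclidean_space) \<partial>lborel) = 1"
proof -
  have n: "(\<integral>\<^sup>+x. ennreal (normal_density 0 r x) \<partial>lborel) = 1"
    using assms by (subst nn_integral_eq_integral) (auto simp: integral_normal_density)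
  have "(\<integral>\<^sup>+x. gauss r (x::'a) \<partial>lborel) = (\<integral>\<^sup>+x. (\<Prod>b\<in>Basis. ennreal (normal_density 0 r ((x::'a) \<bullet> b)))
      \<partial>lborel)"
    by (simp add: gauss_def prod_ennreal)
  also have "\<dots> = 1" by (subst nn_integral_lborel_prod) (auto simp: n)
  finally show ?thesis .
qed

lemma nn_integral_gauss_diff:
  assumes "0 < r" shows "(\<integral>\<^sup>+x. gauss r (x - y::'a::euclidean_space) \<partial>lborel) = 1"
     "(\<integral>\<^sup>+x. gauss r (y - x::'a::euclidean_space) \<partial>lborel) = 1"
  using nn_integral_gauss[OF assms] nn_integral_lborel_diff[of "\<lambda>x. ennreal (gauss r x)" y] by simp_all

lemma integrable_gauss: "0 < r \<Longrightarrow> integrable lborel (gauss r :: 'a::euclidean_space \<Rightarrow> real)"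
  and integral_gauss: "0 < r \<Longrightarrow> (LINT x|lborel. gauss r (x::'a::euclidean_space)) = 1"
proof -
  assume r: "0 < r"
  have "has_bochner_integral lborel (gauss r :: 'a \<Rightarrow> real) 1"
    by (rule has_bochner_integral_nn_integral) (auto simp: nn_integral_gauss r)
  then show "integrable lborel (gauss r :: 'a \<Rightarrow> real)" "(LINT x|lborel. gauss r (x::'a)) = 1"
    by (auto simp: has_bochner_integral_iff)
qed

lemma integral_iexp_normal_density:
  assumes r: "0 < r"
  shows "integrable lborel (\<lambda>x. iexp (t * x) * complex_of_real (normal_density 0 r x))"
    and "(LINT x|lborel. iexp (t * x) * complex_of_real (normal_density 0 r x)) = exp (- (r * t)\<^sup>2 / 2)"
proof -
  have i: "integrable lborel (\<lambda>x. complex_of_real (normal_density 0 r x))"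
    using r by (simp add: integrable_normal_density)
  show "integrable lborel (\<lambda>x. iexp (t * x) * complex_of_real (normal_density 0 r x))"
    by (rule Bochner_Integration.integrable_bound[OF i]) (auto simp: norm_mult)
  have "(LINT x|lborel. iexp (t * x) * complex_of_real (normal_density 0 r x))
     = r *\<^sub>R (LINT x|lborel. iexp (t * (r * x)) * complex_of_real (normal_density 0 r (r * x)))"
    using r by (subst lborel_integral_real_affine[where c=r and t=0]) auto
  also have "\<dots> = (LINT x|lborel. normal_density 0 1 x *\<^sub>R iexp ((r * t) * x))"
  proof -
    have n: "r * normal_density 0 r (r * x) = normal_density 0 1 x" for x
      using r by (simp add: normal_density_def real_sqrt_mult power_mult_distrib)
    have "r *\<^sub>R (iexp (t * (r * x)) * complex_of_real (normal_density 0 r (r * x)))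
       = (r * normal_density 0 r (r * x)) *\<^sub>R iexp ((r * t) * x)" for x
      by (simp add: scaleR_conv_of_real mult_ac)
    then have "r *\<^sub>R (iexp (t * (r * x)) * complex_of_real (normal_density 0 r (r * x)))
       = normal_density 0 1 x *\<^sub>R iexp ((r * t) * x)" for x
      unfolding n .
    then show ?thesis
      unfolding integral_scaleR_right[symmetric] by simp
  qed
  also have "\<dots> = char std_normal_distribution (r * t)"
    unfolding char_def by (subst integral_density) auto
  finally show "(LINT x|lborel. iexp (t * x) * complex_of_real (normal_density 0 r x)) = exp (- (r * t)\<^sup>2
      / 2)"
    by (simp add: char_std_normal_distribution)
qed

lemma integral_iexp_gauss:
  fixes y :: "'a::euclidean_space"
  assumes r: "0 < r"
  shows "(LINT x|lborel. iexp (y \<bullet> x) * complex_of_real (gauss r x)) = exp (- (r * norm y)\<^sup>2 / 2)"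
proof -
  have "iexp (y \<bullet> x) * complex_of_real (gauss r x) =
     (\<Prod>b\<in>Basis. iexp ((y \<bullet> b) * (x \<bullet> b)) * complex_of_real (normal_density 0 r (x \<bullet> b)))" for x
  proof -
    have "iexp (y \<bullet> x) = (\<Prod>b\<in>Basis. iexp ((y \<bullet> b) * (x \<bullet> b)))"
      by (simp add: euclidean_inner[of y x] exp_sum[symmetric] sum_distrib_left)
    then show ?thesis by (simp add: gauss_def prod.distrib)
  qed
  then have "(LINT x|lborel. iexp (y \<bullet> x) * complex_of_real (gauss r x)) =
     (LINT x|lborel. (\<Prod>b\<in>Basis. iexp ((y \<bullet> b) * (x \<bullet> b)) * complex_of_real (normal_density 0 r (x \<bullet> b))))"
    by simp
  also have "\<dots> = (\<Prod>b\<in>Basis. complex_of_real (exp (- (r * (y \<bullet> b))\<^sup>2 / 2)))"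
    by (subst integrable_prod_lborel(2)) (auto simp: integral_iexp_normal_density r simp del: of_real_mult)
  also have "\<dots> = complex_of_real (exp (\<Sum>b\<in>Basis. - (r * (y \<bullet> b))\<^sup>2 / 2))"
    by (simp add: exp_sum)
  also have "(\<Sum>b\<in>Basis. - (r * (y \<bullet> b))\<^sup>2 / 2) = - (r * norm y)\<^sup>2 / 2"
    unfolding power_mult_distrib power2_norm_eq_inner euclidean_inner[of y y]
    by (simp add: sum_divide_distrib[symmetric] sum_negf power2_eq_square sum_distrib_left)
  finally show ?thesis .
qed

text \<open>The Gaussian weight is a multiple of the density of width 1/d. Hence its transform is a
  multiple of the density of width d, with the constant computed in
  \<open>integral_iexp_exp_norm\<close>.\<close>

lemma exp_norm_eq_gauss:
  fixes x :: "'a::euclidean_space"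
  assumes "0 < d"
  shows "exp (- (d * norm x)\<^sup>2 / 2) = (sqrt (2 * pi) / d) ^ DIM('a) * gauss (1 / d) x"
  using assms by (simp add: gauss_eq power_mult_distrib real_sqrt_mult real_sqrt_divide
    power_divide[symmetric] power_one_over field_simps)

lemma integrable_exp_norm:
  assumes "0 < d" shows "integrable lborel (\<lambda>x::'a::euclidean_space. exp (- (d * norm x)\<^sup>2 / 2))"
  unfolding exp_norm_eq_gauss[OF assms] using assms by (simp add: integrable_gauss)

lemma integral_iexp_exp_norm:
  fixes y :: "'a::euclidean_space"
  assumes d: "0 < d"
  shows "(LINT x|lborel. iexp (y \<bullet> x) * complex_of_real (exp (- (d * norm x)\<^sup>2 / 2)))
    = complex_of_real ((2 * pi) ^ DIM('a) * gauss d y)"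
proof -
  have "(LINT x|lborel. iexp (y \<bullet> x) * complex_of_real (exp (- (d * norm x)\<^sup>2 / 2)))
    = (LINT x|lborel. ((sqrt (2 * pi) / d) ^ DIM('a)) *\<^sub>R (iexp (y \<bullet> x) * complex_of_real (gauss (1/d) x)))"
    unfolding exp_norm_eq_gauss[OF d] by (simp add: scaleR_conv_of_real mult_ac)
  also have "\<dots> = ((sqrt (2 * pi) / d) ^ DIM('a)) *\<^sub>R complex_of_real (exp (- (1/d * norm y)\<^sup>2 / 2))"
    using d by (simp add: integral_iexp_gauss del: of_real_exp)
  also have "\<dots> = complex_of_real ((sqrt (2 * pi) / d) ^ DIM('a) * exp (- (norm y)\<^sup>2 / (2 * d\<^sup>2)))"
    by (simp add: scaleR_conv_of_real field_simps power_divide)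
  also have "(sqrt (2 * pi) / d) ^ DIM('a) = (2 * pi) ^ DIM('a) * (1 / sqrt (2 * pi * d\<^sup>2)) ^ DIM('a)"
  proof -
    define q where "q = sqrt (2 * pi)"
    have q: "q > 0" "2 * pi = q * q" unfolding q_def by simp_all
    have "sqrt (2 * pi * d\<^sup>2) = q * d" using d by (simp add: q_def real_sqrt_mult)
    then have "sqrt (2 * pi) / d = 2 * pi * (1 / sqrt (2 * pi * d\<^sup>2))"
      unfolding q_def[symmetric] using q d by (simp add: divide_simps)
    then show ?thesis unfolding power_mult_distrib[symmetric] by simp
  qed
  finally show ?thesis by (simp add: gauss_eq mult.assoc)
qed

section \<open>The Fourier transform of integrable functions\<close>

lemma integrable_cexp_mult:
  fixes f :: "'a::euclidean_space \<Rightarrow> complex"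
  assumes "integrable lborel f"
  shows "integrable lborel (\<lambda>x. exp (- \<i> * complex_of_real (y \<bullet> x)) * f x)"
  using assms by (rule Bochner_Integration.integrable_bound) (use assms in \<open>auto simp: norm_mult\<close>)

text \<open>Scalar and without the factor (2 pi)^(-n/2), which keeps the Fubini arguments free of
  constants; \<open>FT1_nth\<close> puts the factor back componentwise.\<close>

definition ft :: "('a::euclidean_space \<Rightarrow> complex) \<Rightarrow> 'a \<Rightarrow> complex" where
  "ft f y = (LINT x|lborel. exp (- \<i> * complex_of_real (y \<bullet> x)) * f x)"

lemma borel_measurable_ft[measurable]:
  assumes [measurable]: "f \<in> borel_measurable borel"
  shows "ft f \<in> borel_measurable borel"
  unfolding ft_def[abs_def] by measurable

lemma norm_ft_le:
  assumes f: "integrable lborel f"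
  shows "norm (ft f y) \<le> (LINT x|lborel. norm (f x))"
proof -
  have "norm (ft f y) \<le> (LINT x|lborel. norm (exp (- \<i> * complex_of_real (y \<bullet> x)) * f x))"
    unfolding ft_def by (rule integral_norm_bound)
  then show ?thesis by (simp add: norm_mult)
qed

lemma ft_diff:
  assumes "integrable lborel f" "integrable lborel g"
  shows "ft (\<lambda>x. f x - g x) y = ft f y - ft g y"
  unfolding ft_def using integrable_cexp_mult[OF assms(1), of y] integrable_cexp_mult[OF assms(2), of y]
  by (simp add: algebra_simps)

text \<open>The multiplication formula, by Fubini for the absolutely integrable f(x) g(y). Choosing
  a Gaussian for one factor yields Plancherel's identity, the convolution formula and
  inversion.\<close>

lemma integral_ft_mult:
  assumes f: "integrable lborel f" and g: "integrable lborel g"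
  shows "(LINT y|lborel. ft f y * g y) = (LINT x|lborel. f x * ft g x)"
proof -
  have [measurable]: "f \<in> borel_measurable borel" "g \<in> borel_measurable borel"
    using f g by auto
  have i: "integrable (lborel \<Otimes>\<^sub>M lborel) (\<lambda>(x,y). exp (- \<i> * complex_of_real (y \<bullet> x)) * f x * g y)"
    by (rule Bochner_Integration.integrable_bound[OF integrable_mult_pair[OF sigma_finite_lborel
        sigma_finite_lborel f g]])
       (auto simp: norm_mult)
  have "(LINT y|lborel. ft f y * g y) = (LINT y|lborel. LINT x|lborel. exp (- \<i> * complex_of_real (y \<bullet>
      x)) * f x * g y)"
    unfolding ft_def by simp
  also have "\<dots> = (LINT x|lborel. LINT y|lborel. exp (- \<i> * complex_of_real (y \<bullet> x)) * f x * g y)"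
    by (rule lborel_pair.Fubini_integral[OF i])
  also have "\<dots> = (LINT x|lborel. LINT y|lborel. f x * (exp (- \<i> * complex_of_real (x \<bullet> y)) * g y))"
    by (simp add: inner_commute mult_ac)
  also have "\<dots> = (LINT x|lborel. f x * ft g x)"
    unfolding ft_def by simp
  finally show ?thesis .
qed

lemma ft_exp_norm:
  fixes y :: "'a::euclidean_space"
  assumes d: "0 < d"
  shows "ft (\<lambda>x. complex_of_real (exp (- (d * norm x)\<^sup>2 / 2))) y = complex_of_real ((2 * pi) ^ DIM('a) *
      gauss d y)"
  using integral_iexp_exp_norm[OF d, of "-y"] by (simp add: ft_def)

section \<open>Square-integrable functions and their approximation\<close>

definition sq_int :: "('a::euclidean_space \<Rightarrow> 'b::euclidean_space) \<Rightarrow> bool" where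
  "sq_int f \<longleftrightarrow> f \<in> borel_measurable borel \<and> integrable lborel (\<lambda>x. (norm (f x))\<^sup>2)"

lemma sq_int_measurable: "sq_int f \<Longrightarrow> f \<in> borel_measurable borel"
  by (simp add: sq_int_def)

lemma power2_add_le: "(a + b)\<^sup>2 \<le> 2 * a\<^sup>2 + 2 * (b::real)\<^sup>2"
  using zero_le_power2[of "a - b"] by (simp add: power2_eq_square algebra_simps)

lemma mult_le_sum_squares: "a * b \<le> a\<^sup>2 + (b::real)\<^sup>2"
proof -
  have "2 * (a * b) \<le> a\<^sup>2 + b\<^sup>2" using sum_squares_bound[of a b] by simp
  moreover have "0 \<le> a\<^sup>2 + b\<^sup>2" by simp
  ultimately show ?thesis by linarith
qed

lemma sq_int_add: assumes f: "sq_int f" and g: "sq_int g" shows "sq_int (\<lambda>x. f x + g x)"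
proof -
  have [measurable]: "f \<in> borel_measurable borel" "g \<in> borel_measurable borel"
    using f g by (auto simp: sq_int_def)
  have "integrable lborel (\<lambda>x. 2 * (norm (f x))\<^sup>2 + 2 * (norm (g x))\<^sup>2)"
    using f g by (auto simp: sq_int_def)
  then have "integrable lborel (\<lambda>x. (norm (f x + g x))\<^sup>2)"
    by (rule Bochner_Integration.integrable_bound)
      (auto intro!: order_trans[OF power_mono[OF norm_triangle_ineq]] order_trans[OF power2_add_le])
  then show ?thesis by (simp add: sq_int_def)
qed

lemma sq_int_uminus: "sq_int f \<Longrightarrow> sq_int (\<lambda>x. - f x)"
  by (simp add: sq_int_def)

lemma sq_int_diff: "sq_int f \<Longrightarrow> sq_int g \<Longrightarrow> sq_int (\<lambda>x. f x - g x)"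
  using sq_int_add[of f "\<lambda>x. - g x"] sq_int_uminus[of g] by simp

lemma sq_int_bound:
  assumes f: "sq_int f" and [measurable]: "g \<in> borel_measurable borel" and "\<And>x. norm (g x) \<le> norm (f x)"
  shows "sq_int g"
  unfolding sq_int_def
proof
  show "integrable lborel (\<lambda>x. (norm (g x))\<^sup>2)"
    by (rule Bochner_Integration.integrable_bound[where f="\<lambda>x. (norm (f x))\<^sup>2"])
      (use assms in \<open>auto simp: sq_int_def power_mono\<close>)
qed simp

lemma sq_int_integrable_mult:
  assumes f: "sq_int f" and g: "sq_int g"
  shows "integrable lborel (\<lambda>x. norm (f x) * norm (g x))"
proof -
  have [measurable]: "f \<in> borel_measurable borel" "g \<in> borel_measurable borel"
    using f g by (auto simp: sq_int_def)
  have "integrable lborel (\<lambda>x. (norm (f x))\<^sup>2 + (norm (g x))\<^sup>2)"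
    using f g by (auto simp: sq_int_def)
  then show ?thesis
    by (rule Bochner_Integration.integrable_bound)
      (auto simp: abs_mult intro!: mult_le_sum_squares)
qed

text \<open>A pairing estimate with a free parameter \<open>e\<close>. It takes the place of the
  Cauchy-Schwarz inequality for integrals: if one factor tends to 0 in square mean, \<open>e\<close>
  is fixed small first and the last term is made small afterwards.\<close>

lemma sq_int_weighted_bound:
  assumes f: "sq_int f" and g: "sq_int g" and e: "0 < e"
  shows "(LINT x|lborel. norm (f x) * norm (g x)) \<le> e * (LINT x|lborel. (norm (f x))\<^sup>2) + (LINT x|lborel.
      (norm (g x))\<^sup>2) / e"
proof -
  have i: "integrable lborel (\<lambda>x. (norm (f x))\<^sup>2)" "integrable lborel (\<lambda>x. (norm (g x))\<^sup>2)"
    using f g by (auto simp: sq_int_def)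
  have "norm (f x) * norm (g x) \<le> e * (norm (f x))\<^sup>2 + (norm (g x))\<^sup>2 / e" for x
    using mult_le_sum_squares[of "sqrt e * norm (f x)" "norm (g x) / sqrt e"] e
    by (simp add: power_mult_distrib power_divide)
  then have "(LINT x|lborel. norm (f x) * norm (g x)) \<le> (LINT x|lborel. e * (norm (f x))\<^sup>2 + (norm (g
      x))\<^sup>2 / e)"
    using i by (intro integral_mono sq_int_integrable_mult f g) auto
  then show ?thesis using i by simp
qed

lemma sq_int_mult_tendsto_0:
  assumes f: "sq_int f" and g: "\<And>k. sq_int (g k)"
    and l: "(\<lambda>k. LINT x|lborel. (norm (g k x))\<^sup>2) \<longlonglongrightarrow> 0"
  shows "(\<lambda>k. LINT x|lborel. norm (f x) * norm (g k x)) \<longlonglongrightarrow> 0"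
proof (rule LIMSEQ_I, goal_cases)
  case (1 r)
  define A where "A = (LINT x|lborel. (norm (f x))\<^sup>2)"
  have A: "A \<ge> 0" unfolding A_def by simp
  \<comment> \<open>This makes e A at most r/2; the summand 1 covers the case A = 0.\<close>
  define e where "e = r / (2 * (A + 1))"
  have e: "e > 0" "e * A < r / 2 \<or> e * A = 0" "e * A \<le> r / 2" using A \<open>0 < r\<close> unfolding e_def
    by (auto simp: divide_simps)
  from LIMSEQ_D[OF l, of "e * r / 2"] e(1) \<open>0 < r\<close> obtain N where
    N: "\<And>k. k \<ge> N \<Longrightarrow> (LINT x|lborel. (norm (g k x))\<^sup>2) < e * r / 2" by auto
  have "norm ((LINT x|lborel. norm (f x) * norm (g k x)) - 0) < r" if k: "k \<ge> N" for k
  proof -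
    have "(LINT x|lborel. norm (f x) * norm (g k x)) \<le> e * A + (LINT x|lborel. (norm (g k x))\<^sup>2) / e"
      using sq_int_weighted_bound[OF f g e(1)] unfolding A_def .
    also have "\<dots> < r / 2 + (e * r / 2) / e"
      using N[OF k] e by (intro add_le_less_mono divide_strict_right_mono) auto
    finally show ?thesis using e(1) by simp
  qed
  then show ?case by blast
qed

lemma sq_int_approx_bounded:
  fixes f :: "'a::euclidean_space \<Rightarrow> 'b::euclidean_space"
  assumes f: "sq_int f"
  shows "\<exists>g. (\<forall>k. g k \<in> borel_measurable borel \<and> (\<forall>x. norm (g k x) \<le> real k) \<and> (\<forall>x. norm x > real k \<longrightarrow> g k
      x = 0)
           \<and> (\<forall>x. norm (g k x) \<le> norm (f x))) \<and> (\<lambda>k. LINT x|lborel. (norm (f x - g k x))\<^sup>2) \<longlonglongrightarrow> 0"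
proof -
  have [measurable]: "f \<in> borel_measurable borel" and i: "integrable lborel (\<lambda>x. (norm (f x))\<^sup>2)"
    using f by (auto simp: sq_int_def)
  define g where "g k x = (if norm x \<le> real k \<and> norm (f x) \<le> real k then f x else 0)" for k x
  have [measurable]: "g k \<in> borel_measurable borel" for k unfolding g_def[abs_def] by measurable
  have "(\<lambda>k. LINT x|lborel. (norm (f x - g k x))\<^sup>2) \<longlonglongrightarrow> (LINT x|(lborel::'a measure). 0)"
  proof (rule integral_dominated_convergence[where w="\<lambda>x. (norm (f x))\<^sup>2"])
    show "AE x in lborel. (\<lambda>k. (norm (f x - g k x))\<^sup>2) \<longlonglongrightarrow> 0"
    proof (rule AE_I2, rule tendsto_eventually)
      fix x
      obtain N where N: "real N \<ge> max (norm x) (norm (f x))" using real_arch_simple by blast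
      show "\<forall>\<^sub>F k in sequentially. (norm (f x - g k x))\<^sup>2 = 0"
        using eventually_ge_at_top[of N] by eventually_elim (use N in \<open>auto simp: g_def\<close>)
    qed
  qed (auto simp: g_def i)
  then show ?thesis
    by (intro exI[of _ g]) (auto simp: g_def[abs_def])
qed

text \<open>Measurability provides continuous functions that converge almost everywhere. Projecting
  their values to the ball of radius \<open>B\<close> and multiplying by a cutoff adds a common
  bound and a common bounded support, so dominated convergence gives convergence in square mean.
  Neither operation alters the limit, which already obeys both restrictions.\<close>

lemma bounded_approx_continuous:
  fixes f :: "'a::euclidean_space \<Rightarrow> 'b::euclidean_space"
  assumes [measurable]: "f \<in> borel_measurable borel" and b: "\<And>x. norm (f x) \<le> B" and s: "\<And>x. norm x > R \<Longrightarrow>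
      f x = 0"
  shows "\<exists>g. (\<forall>k. continuous_on UNIV (g k) \<and> (\<forall>x. norm (g k x) \<le> B) \<and> sq_int (g k)) \<and>
     (\<lambda>k. LINT x|lborel. (norm (f x - g k x))\<^sup>2) \<longlonglongrightarrow> 0"
proof -
  have B: "B \<ge> 0" using b[of 0] norm_ge_zero[of "f 0"] by linarith
  have "f measurable_on UNIV" by (rule lebesgue_measurable_imp_measurable_on) (auto intro:
      measurable_completion)
  then obtain N h where N: "negligible N" and h: "\<And>n. continuous_on UNIV (h n)"
    and lim: "\<And>x. x \<notin> N \<Longrightarrow> (\<lambda>n. h n x) \<longlonglongrightarrow> f x" unfolding measurable_on_def by auto
  define c where "c x = max 0 (min 1 (R + 1 - norm x))" for x :: 'a
  define clip where "clip z = closest_point (cball 0 B) z" for z :: 'b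
  have clip: "norm (clip z) \<le> B" "continuous_on UNIV clip" "norm z \<le> B \<Longrightarrow> clip z = z" for z
  proof -
    show "norm (clip z) \<le> B" using closest_point_in_set[of "cball (0::'b) B" z] B unfolding clip_def by auto
    show "continuous_on UNIV clip" unfolding clip_def using B by (intro continuous_on_closest_point) auto
    show "norm z \<le> B \<Longrightarrow> clip z = z" unfolding clip_def by (intro closest_point_self) auto
  qed
  define g where "g k x = c x *\<^sub>R clip (h k x)" for k x
  have c: "0 \<le> c x" "c x \<le> 1" "norm x \<le> R \<Longrightarrow> c x = 1" "norm x > R + 1 \<Longrightarrow> c x = 0" for x unfolding c_def by auto
  have cont: "continuous_on UNIV (g k)" for k
    unfolding g_def[abs_def] c_def
    by (intro continuous_intros continuous_on_compose2[OF clip(2) h]) auto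
  have [measurable]: "g k \<in> borel_measurable borel" for k using cont by (rule borel_measurable_continuous_onI)
  have gB: "norm (g k x) \<le> B" for k x
    using c[of x] clip(1)[of "h k x"] B unfolding g_def by (simp add: mult_left_le_one_le order_trans[OF
        mult_right_mono])
  have gB2: "norm (g k x) \<le> B * indicator (cball 0 (R+1)) x" for k x
    using gB[of k x] c(4)[of x] by (auto simp: indicator_def g_def)
  have fB2: "norm (f x) \<le> B * indicator (cball 0 (R+1)) x" for x
    using b[of x] s[of x] by (auto simp: indicator_def)
  have iI: "integrable lborel (\<lambda>x::'a. M * indicator (cball 0 (R+1)) x)" for M R :: real
    by (intro integrable_mult_right) (auto intro!: integrable_real_indicator emeasure_bounded_finite)
  have sg: "sq_int (g k)" for k
    unfolding sq_int_def
  proof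
    show "integrable lborel (\<lambda>x. (norm (g k x))\<^sup>2)"
    proof (rule Bochner_Integration.integrable_bound[OF iI[of "B\<^sup>2" R]])
      have "norm ((norm (g k x))\<^sup>2) \<le> norm (B\<^sup>2 * indicator (cball 0 (R + 1)) x)" for x
        using power_mono[OF gB2[of k x] norm_ge_zero, of 2] by (auto simp: indicator_def split: if_splits)
      then show "AE x in lborel. norm ((norm (g k x))\<^sup>2) \<le> norm (B\<^sup>2 * indicator (cball 0 (R + 1)) x)" by simp
    qed simp
  qed simp
  have "(\<lambda>k. LINT x|lborel. (norm (f x - g k x))\<^sup>2) \<longlonglongrightarrow> (LINT x|(lborel::'a measure). 0)"
  proof (rule integral_dominated_convergence[where w="\<lambda>x. (2*B)\<^sup>2 * indicator (cball 0 (R+1)) x"])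
    have "AE x in lborel. x \<notin> N"
      using N AE_not_in[of N lebesgue] by (simp add: negligible_iff_null_sets AE_completion_iff)
    then show "AE x in lborel. (\<lambda>k. (norm (f x - g k x))\<^sup>2) \<longlonglongrightarrow> 0"
    proof eventually_elim
      case (elim x)
      have "(\<lambda>k. g k x) \<longlonglongrightarrow> c x *\<^sub>R clip (f x)"
        unfolding g_def
        by (intro tendsto_intros continuous_on_tendsto_compose[OF clip(2) lim[OF elim]]) auto
      also have "c x *\<^sub>R clip (f x) = f x" using clip(3)[OF b[of x]] c(3)[of x] s[of x] by (cases "norm x
          \<le> R") auto
      finally show ?case by (auto intro!: tendsto_eq_intros)
    qed
    show "AE x in lborel. norm ((norm (f x - g k x))\<^sup>2) \<le> (2*B)\<^sup>2 * indicator (cball 0 (R+1)) x" for k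
    proof (rule AE_I2)
      fix x
      have "norm (f x - g k x) \<le> 2 * B * indicator (cball 0 (R+1)) x"
        using fB2[of x] gB2[of k x] norm_triangle_ineq4[of "f x" "g k x"] by linarith
      from power_mono[OF this norm_ge_zero, of 2] show "norm ((norm (f x - g k x))\<^sup>2) \<le> (2*B)\<^sup>2 *
          indicator (cball 0 (R+1)) x"
        by (auto simp: indicator_def split: if_splits)
    qed
  qed (use iI in auto)
  then show ?thesis using cont gB sg by (intro exI[of _ g]) auto
qed

lemma sq_int_approx_continuous:
  fixes f :: "'a::euclidean_space \<Rightarrow> 'b::euclidean_space"
  assumes f: "sq_int f" and e: "0 < e"
  shows "\<exists>g B. continuous_on UNIV g \<and> (\<forall>x. norm (g x) \<le> B) \<and> sq_int g \<and> (LINT x|lborel. (norm (f x - g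
      x))\<^sup>2) < e"
proof -
  obtain h where h: "\<And>k. h k \<in> borel_measurable borel" "\<And>k x. norm (h k x) \<le> real k" "\<And>k x. norm x > real
      k \<Longrightarrow> h k x = 0"
      "\<And>k x. norm (h k x) \<le> norm (f x)" "(\<lambda>k. LINT x|lborel. (norm (f x - h k x))\<^sup>2) \<longlonglongrightarrow> 0"
    using sq_int_approx_bounded[OF f] by blast
  \<comment> \<open>Truncation and continuous approximation each get squared error e/4, because (a +
    b)^2 \<le> 2 a^2 + 2 b^2 doubles both.\<close>
  obtain k where k: "(LINT x|lborel. (norm (f x - h k x))\<^sup>2) < e / 4"
    using LIMSEQ_D[OF h(5), of "e/4"] e by auto
  obtain g where g: "\<And>j. continuous_on UNIV (g j)" "\<And>j x. norm (g j x) \<le> real k" "\<And>j. sq_int (g j)"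
      "(\<lambda>j. LINT x|lborel. (norm (h k x - g j x))\<^sup>2) \<longlonglongrightarrow> 0"
    using bounded_approx_continuous[OF h(1,2,3), of k] by blast
  obtain j where j: "(LINT x|lborel. (norm (h k x - g j x))\<^sup>2) < e / 4"
    using LIMSEQ_D[OF g(4), of "e/4"] e by auto
  have sh: "sq_int (h k)" using sq_int_bound[OF f h(1,4)] .
  have i: "integrable lborel (\<lambda>x. (norm (f x - h k x))\<^sup>2)" "integrable lborel (\<lambda>x. (norm (h k x - g j x))\<^sup>2)"
    "integrable lborel (\<lambda>x. (norm (f x - g j x))\<^sup>2)"
    using sq_int_diff[OF f sh] sq_int_diff[OF sh g(3)[of j]] sq_int_diff[OF f g(3)[of j]] by (auto simp:
        sq_int_def)
  have "(norm (f x - g j x))\<^sup>2 \<le> 2 * (norm (f x - h k x))\<^sup>2 + 2 * (norm (h k x - g j x))\<^sup>2" for x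
    using norm_triangle_ineq[of "f x - h k x" "h k x - g j x"]
    by (intro order_trans[OF power_mono power2_add_le]) auto
  then have "(LINT x|lborel. (norm (f x - g j x))\<^sup>2) \<le> (LINT x|lborel. 2 * (norm (f x - h k x))\<^sup>2 + 2 *
      (norm (h k x - g j x))\<^sup>2)"
    using i by (intro integral_mono) auto
  also have "\<dots> < e" using i j k by simp
  finally show ?thesis using g by blast
qed

section \<open>Autocorrelation and Plancherel's identity\<close>

lemma borel_measurable_cnj[measurable]: "cnj \<in> borel_measurable borel"
  by (intro borel_measurable_continuous_onI continuous_intros)

text \<open>The convolution of f with its conjugate reflection: its transform is the squared modulus
  of \<open>ft f\<close>, and its value at 0 is the squared norm of f.\<close>

definition autocorr :: "('a::euclidean_space \<Rightarrow> complex) \<Rightarrow> 'a \<Rightarrow> complex" where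
  "autocorr f h = (LINT x|lborel. f x * cnj (f (x - h)))"

lemma integrable_autocorr_pair:
  assumes f: "integrable lborel f"
  shows "integrable (lborel \<Otimes>\<^sub>M lborel) (\<lambda>(x,h). f x * cnj (f (x - h)))"
proof (rule lborel_pair.Fubini_integrable)
  have [measurable]: "f \<in> borel_measurable borel" using f by auto
  show "(\<lambda>(x,h). f x * cnj (f (x - h))) \<in> borel_measurable (lborel \<Otimes>\<^sub>M lborel)" by measurable
  have "(LINT h|lborel. norm (f (x - h))) = (LINT h|lborel. norm (f h))" for x
    by (rule integral_lborel_diff) measurable
  then show "integrable lborel (\<lambda>x. LINT y|lborel. norm (case (x, y) of (x, h) \<Rightarrow> f x * cnj (f (x - h))))"
    using f by (simp add: norm_mult)
  show "AE x in lborel. integrable lborel (\<lambda>y. case (x, y) of (x, h) \<Rightarrow> f x * cnj (f (x - h)))"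
    using integrable_lborel_diff(2)[OF f] by simp
qed

lemma integrable_autocorr:
  assumes f: "integrable lborel f"
  shows "integrable lborel (autocorr f)"
  using lborel_pair.integrable_snd[OF integrable_autocorr_pair[OF f]] by (simp add: autocorr_def[abs_def])

lemma ft_autocorr:
  assumes f: "integrable lborel f"
  shows "ft (autocorr f) y = complex_of_real ((norm (ft f y))\<^sup>2)"
proof -
  have [measurable]: "f \<in> borel_measurable borel" using f by auto
  let ?e = "\<lambda>h. exp (- \<i> * complex_of_real (y \<bullet> h))"
  have i: "integrable (lborel \<Otimes>\<^sub>M lborel) (\<lambda>(x,h). ?e h * (f x * cnj (f (x - h))))"
    by (rule Bochner_Integration.integrable_bound[OF integrable_autocorr_pair[OF f]]) (auto simp: norm_mult)
  have "ft (autocorr f) y = (LINT h|lborel. LINT x|lborel. ?e h * (f x * cnj (f (x - h))))"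
    unfolding ft_def autocorr_def by simp
  also have "\<dots> = (LINT x|lborel. LINT h|lborel. ?e h * (f x * cnj (f (x - h))))"
    by (rule lborel_pair.Fubini_integral[OF i])
  also have "\<dots> = (LINT x|lborel. LINT h|lborel. (?e x * f x) * cnj (?e (x - h) * f (x - h)))"
  proof (intro Bochner_Integration.integral_cong refl)
    fix x h
    \<comment> \<open>The character splits over x and x - h, so the inner integral becomes a
      translate of the transform of f and no longer depends on x.\<close>
    have e: "?e x * cnj (?e (x - h)) = ?e h"
      by (simp add: exp_cnj inner_diff_right exp_add[symmetric] algebra_simps)
    show "?e h * (f x * cnj (f (x - h))) = (?e x * f x) * cnj (?e (x - h) * f (x - h))"
      unfolding complex_cnj_mult by (simp only: mult_ac flip: e)
  qed
  also have "\<dots> = (LINT x|lborel. (?e x * f x) * cnj (LINT h|lborel. ?e (x - h) * f (x - h)))"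
    by (simp only: integral_mult_right_zero Bochner_Integration.integral_cnj)
  also have "\<dots> = (LINT x|lborel. (?e x * f x) * cnj (ft f y))"
    unfolding ft_def
    by (intro Bochner_Integration.integral_cong refl arg_cong2[where f="(*)"] arg_cong[where f=cnj]
          integral_lborel_diff(2)) measurable
  also have "\<dots> = ft f y * cnj (ft f y)"
    unfolding ft_def[of f y] by simp
  finally show ?thesis unfolding complex_norm_square .
qed

lemma sq_int_lborel_diff:
  assumes "sq_int f" shows "sq_int (\<lambda>x. f (x - y))" "sq_int (\<lambda>x. f (y - x))"
proof -
  have [measurable]: "f \<in> borel_measurable borel" using assms by (auto simp: sq_int_def)
  show "sq_int (\<lambda>x. f (x - y))" "sq_int (\<lambda>x. f (y - x))"
    using assms integrable_lborel_diff[of "\<lambda>x. (norm (f x))\<^sup>2"] by (auto simp: sq_int_def)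
qed

lemma norm_autocorr_le:
  assumes f: "sq_int f"
  shows "norm (autocorr f h) \<le> (LINT x|lborel. (norm (f x))\<^sup>2)"
proof -
  have [measurable]: "f \<in> borel_measurable borel" using f by (auto simp: sq_int_def)
  have i: "integrable lborel (\<lambda>x. (norm (f x))\<^sup>2)" "integrable lborel (\<lambda>x. (norm (f (x - h)))\<^sup>2)"
    using f sq_int_lborel_diff[OF f] by (auto simp: sq_int_def)
  have "norm (autocorr f h) \<le> (LINT x|lborel. norm (f x * cnj (f (x - h))))"
    unfolding autocorr_def by (rule integral_norm_bound)
  also have "\<dots> \<le> (LINT x|lborel. ((norm (f x))\<^sup>2 + (norm (f (x - h)))\<^sup>2) / 2)"
  proof (rule integral_mono)
    show "integrable lborel (\<lambda>x. norm (f x * cnj (f (x - h))))"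
      using sq_int_integrable_mult[OF f sq_int_lborel_diff(1)[OF f]] by (simp add: norm_mult)
    show "norm (f x * cnj (f (x - h))) \<le> ((norm (f x))\<^sup>2 + (norm (f (x - h)))\<^sup>2) / 2" for x
      using zero_le_power2[of "norm (f x) - norm (f (x - h))"]
      by (simp add: norm_mult power2_eq_square algebra_simps)
  qed (use i in auto)
  also have "\<dots> = ((LINT x|lborel. (norm (f x))\<^sup>2) + (LINT x|lborel. (norm (f (x - h)))\<^sup>2)) / 2"
    using i by simp
  also have "(LINT x|lborel. (norm (f (x - h)))\<^sup>2) = (LINT x|lborel. (norm (f x))\<^sup>2)"
    by (rule integral_lborel_diff) measurable
  finally show ?thesis by simp
qed

lemma autocorr_0: "autocorr f 0 = complex_of_real (LINT x|lborel. (norm (f x))\<^sup>2)"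
  unfolding autocorr_def by (simp add: complex_norm_square[symmetric] flip: of_real_power)

text \<open>Replacing the second factor by a bounded continuous function reduces continuity at
  \<open>0\<close> to dominated convergence.\<close>
lemma autocorr_tendsto:
  assumes fi: "integrable lborel f" and f: "sq_int f" and h: "h \<longlonglongrightarrow> 0"
  shows "(\<lambda>k. autocorr f (h k)) \<longlonglongrightarrow> autocorr f 0"
proof (rule LIMSEQ_I, goal_cases)
  case (1 r)
  have [measurable]: "f \<in> borel_measurable borel" using f by (auto simp: sq_int_def)
  define A where "A = (LINT x|lborel. (norm (f x))\<^sup>2)"
  have A: "A \<ge> 0" unfolding A_def by simp
  define e where "e = r / (6 * (A + 1))"
  have e: "e > 0" "e * A \<le> r / 6" using A \<open>0 < r\<close> unfolding e_def by (auto simp: divide_simps)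
  obtain g B where gc: "continuous_on UNIV g" and gB: "\<And>x. norm (g x) \<le> B" and g: "sq_int g"
    and ge: "(LINT x|lborel. (norm (f x - g x))\<^sup>2) < e * r / 6"
    using sq_int_approx_continuous[OF f, of "e * r / 6"] e \<open>0 < r\<close> by auto
  have [measurable]: "g \<in> borel_measurable borel" using g by (auto simp: sq_int_def)
  define D where "D t = (LINT x|lborel. f x * cnj (g (x - t)))" for t
  have iD: "integrable lborel (\<lambda>x. f x * cnj (g (x - t)))" for t
    by (rule Bochner_Integration.integrable_bound[OF integrable_mult_right[OF fi, of "complex_of_real B"]])
       (auto simp: norm_mult mult.commute[of "norm (f _)"] intro!: AE_I2 mult_right_mono order_trans[OF gB])
  have iA: "integrable lborel (\<lambda>x. f x * cnj (f (x - t)))" for t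
    by (rule Bochner_Integration.integrable_bound[OF sq_int_integrable_mult[OF f sq_int_lborel_diff(1)[OF
        f, of t]]])
       (auto simp: norm_mult)
  have close: "norm (autocorr f t - D t) < r / 3" for t
  proof -
    have s: "sq_int (\<lambda>x. f (x - t) - g (x - t))" by (rule sq_int_lborel_diff(1)[OF sq_int_diff[OF f g]])
    have "autocorr f t - D t = (LINT x|lborel. f x * cnj (f (x - t) - g (x - t)))"
      unfolding autocorr_def D_def using iD iA by (simp add: algebra_simps)
    also have "norm \<dots> \<le> (LINT x|lborel. norm (f x * cnj (f (x - t) - g (x - t))))" by (rule
        integral_norm_bound)
    also have "\<dots> = (LINT x|lborel. norm (f x) * norm (f (x - t) - g (x - t)))"
      by (simp only: norm_mult complex_mod_cnj)
    also have "\<dots> \<le> e * A + (LINT x|lborel. (norm (f (x - t) - g (x - t)))\<^sup>2) / e"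
      unfolding A_def using sq_int_weighted_bound[OF f s e(1)] .
    also have "(LINT x|lborel. (norm (f (x - t) - g (x - t)))\<^sup>2) = (LINT x|lborel. (norm (f x - g x))\<^sup>2)"
      by (rule integral_lborel_diff) measurable
    also have "e * A + \<dots> / e < r / 6 + (e * r / 6) / e"
      using e ge by (intro add_le_less_mono divide_strict_right_mono) auto
    finally show ?thesis using e by simp
  qed
  have "(\<lambda>k. D (h k)) \<longlonglongrightarrow> D 0" unfolding D_def
  proof (rule integral_dominated_convergence[where w="\<lambda>x. norm (f x) * B"])
    have "(\<lambda>k. g (x - h k)) \<longlonglongrightarrow> g (x - 0)" for x
      using gc h by (intro continuous_on_tendsto_compose[OF gc]) (auto intro!: tendsto_eq_intros)
    then show "AE x in lborel. (\<lambda>k. f x * cnj (g (x - h k))) \<longlonglongrightarrow> f x * cnj (g (x - 0))"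
      by (intro AE_I2 tendsto_intros)
  qed (use fi gB in \<open>auto simp: norm_mult intro!: mult_left_mono\<close>)
  from LIMSEQ_D[OF this, of "r/3"] \<open>0 < r\<close> obtain N where N: "\<And>k. k \<ge> N \<Longrightarrow> norm (D (h k) - D 0) < r / 3"
      by auto
  have "norm (autocorr f (h k) - autocorr f 0) < r" if "k \<ge> N" for k
    using N[OF that] close[of "h k"] close[of 0]
      norm_triangle_ineq[of "autocorr f (h k) - D (h k)" "D (h k) - D 0 + (D 0 - autocorr f 0)"]
      norm_triangle_ineq[of "D (h k) - D 0" "D 0 - autocorr f 0"]
      norm_minus_commute[of "D 0" "autocorr f 0"]
    by simp
  then show ?case by blast
qed

text \<open>The multiplication formula applied to the autocorrelation and a Gaussian. The damped
  energy of \<open>ft f\<close> becomes an average of the autocorrelation against an approximate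
  identity, whose limit at 0 is known.\<close>

lemma integral_exp_norm_ft:
  fixes f :: "'a::euclidean_space \<Rightarrow> complex"
  assumes f: "integrable lborel f" and d: "0 < d"
  shows "complex_of_real (LINT y|lborel. exp (- (d * norm y)\<^sup>2 / 2) * (norm (ft f y))\<^sup>2) =
    (2 * pi) ^ DIM('a) * (LINT h|lborel. autocorr f h * gauss d h)"
proof -
  have [measurable]: "f \<in> borel_measurable borel" using f by auto
  have g: "integrable lborel (\<lambda>x::'a. complex_of_real (exp (- (d * norm x)\<^sup>2 / 2)))"
    using integrable_exp_norm[OF d, where 'a='a] by (rule integrable_of_real)
  have "complex_of_real (LINT y|lborel. exp (- (d * norm y)\<^sup>2 / 2) * (norm (ft f y))\<^sup>2) =
    (LINT y|lborel. ft (autocorr f) y * complex_of_real (exp (- (d * norm y)\<^sup>2 / 2)))"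
    unfolding ft_autocorr[OF f] integral_complex_of_real[symmetric] by (simp add: mult.commute)
  also have "\<dots> = (LINT h|lborel. autocorr f h * complex_of_real ((2 * pi) ^ DIM('a) * gauss d h))"
    unfolding integral_ft_mult[OF integrable_autocorr[OF f] g] ft_exp_norm[OF d] ..
  also have "\<dots> = (LINT h|lborel. complex_of_real ((2 * pi) ^ DIM('a)) * (autocorr f h * gauss d h))"
    by (simp add: mult_ac)
  also have "\<dots> = complex_of_real ((2 * pi) ^ DIM('a)) * (LINT h|lborel. autocorr f h * gauss d h)"
    by (rule integral_mult_right_zero)
  finally show ?thesis by simp
qed

lemma gauss_scale:
  fixes x :: "'a::euclidean_space"
  assumes "0 < d" shows "gauss d (d *\<^sub>R x) = gauss 1 x / d ^ DIM('a)"
  using assms by (simp add: gauss_eq power_mult_distrib real_sqrt_mult power_divide)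

text \<open>Rescaling by \<open>d k\<close> fixes the Gaussian and moves the parameter into the
  argument of the autocorrelation, which is bounded and continuous at 0. Dominated convergence then
  applies.\<close>

lemma autocorr_gauss_tendsto:
  fixes f :: "'a::euclidean_space \<Rightarrow> complex"
  assumes fi: "integrable lborel f" and f: "sq_int f"
    and d: "\<And>k. 0 < d k" "d \<longlonglongrightarrow> 0"
  shows "(\<lambda>k. LINT h|lborel. autocorr f h * gauss (d k) h) \<longlonglongrightarrow> autocorr f 0"
proof -
  have [measurable]: "autocorr f \<in> borel_measurable borel" using integrable_autocorr[OF fi] by auto
  have eq: "(LINT h|lborel. autocorr f h * gauss (d k) h) = (LINT h|lborel. autocorr f (d k *\<^sub>R h) *
      gauss 1 h)" for k
  proof -
    have "(LINT h|lborel. autocorr f h * gauss (d k) h) =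
      d k ^ DIM('a) *\<^sub>R (LINT h|lborel. autocorr f (d k *\<^sub>R h) * gauss (d k) (d k *\<^sub>R h))"
      using d(1)[of k] by (subst integral_lborel_affine[where c="d k" and t=0]) auto
    also have "\<dots> = (LINT h|lborel. d k ^ DIM('a) *\<^sub>R (autocorr f (d k *\<^sub>R h) * gauss (d k) (d k *\<^sub>R h)))"
        by simp
    also have "\<dots> = (LINT h|lborel. autocorr f (d k *\<^sub>R h) * gauss 1 h)"
      using d(1)[of k] by (simp add: gauss_scale scaleR_conv_of_real)
    finally show ?thesis .
  qed
  have "(\<lambda>k. LINT h|lborel. autocorr f (d k *\<^sub>R h) * gauss 1 h) \<longlonglongrightarrow> (LINT h|lborel. autocorr f 0 * gauss 1
      (h::'a))"
  proof (rule integral_dominated_convergence[where w="\<lambda>h. (LINT x|lborel. (norm (f x))\<^sup>2) * gauss 1 h"])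
    have "(\<lambda>k. autocorr f (d k *\<^sub>R h)) \<longlonglongrightarrow> autocorr f 0" for h
      using d(2) by (intro autocorr_tendsto[OF fi f]) (auto intro!: tendsto_eq_intros)
    then show "AE h in lborel. (\<lambda>k. autocorr f (d k *\<^sub>R h) * complex_of_real (gauss 1 h)) \<longlonglongrightarrow> autocorr f 0
        * complex_of_real (gauss 1 h)"
      by (intro AE_I2 tendsto_intros)
    show "AE h in lborel. norm (autocorr f (d k *\<^sub>R h) * complex_of_real (gauss 1 h)) \<le> (LINT x|lborel.
        (norm (f x))\<^sup>2) * gauss 1 h" for k
      using norm_autocorr_le[OF f] by (auto simp: norm_mult intro!: mult_right_mono)
  qed (auto simp: integrable_gauss)
  then show ?thesis
    unfolding eq by (simp add: integral_gauss)
qed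

text \<open>The damped energies \<open>J k\<close> converge to the right-hand side as the damping
  disappears. Fatou's lemma gives integrability and one inequality; the other holds because the
  damping factor is at most 1.\<close>

lemma plancherel_L1_L2:
  fixes f :: "'a::euclidean_space \<Rightarrow> complex"
  assumes fi: "integrable lborel f" and f: "sq_int f"
  shows "sq_int (ft f)"
    and "(LINT y|lborel. (norm (ft f y))\<^sup>2) = (2 * pi) ^ DIM('a) * (LINT x|lborel. (norm (f x))\<^sup>2)"
proof -
  have [measurable]: "f \<in> borel_measurable borel" using fi by auto
  define d where "d k = 1 / real (Suc k)" for k
  have d: "\<And>k. 0 < d k" "d \<longlonglongrightarrow> 0" unfolding d_def using LIMSEQ_inverse_real_of_nat by (auto simp:
      inverse_eq_divide)
  define J where "J k = (LINT y|lborel. exp (- (d k * norm y)\<^sup>2 / 2) * (norm (ft f y))\<^sup>2)" for k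
  let ?A = "(2 * pi) ^ DIM('a) * (LINT x|lborel. (norm (f x))\<^sup>2)"
  have "(\<lambda>k. complex_of_real (J k)) \<longlonglongrightarrow> complex_of_real ?A"
    unfolding J_def integral_exp_norm_ft[OF fi d(1)] of_real_mult autocorr_0[symmetric] of_real_power
    using tendsto_mult_left[OF autocorr_gauss_tendsto[OF fi f d]] by simp
  then have lim: "J \<longlonglongrightarrow> ?A" by (simp only: tendsto_of_real_iff)
  have bd: "norm (ft f y) \<le> (LINT x|lborel. norm (f x))" for y by (rule norm_ft_le[OF fi])
  have i: "integrable lborel (\<lambda>y. exp (- (d k * norm y)\<^sup>2 / 2) * (norm (ft f y))\<^sup>2)" for k
  proof (rule Bochner_Integration.integrable_bound)
    show "integrable lborel (\<lambda>y::'a. exp (- (d k * norm y)\<^sup>2 / 2) * (LINT x|lborel. norm (f x))\<^sup>2)"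
      using integrable_exp_norm[OF d(1)] by (intro integrable_mult_left) auto
  qed (use bd in \<open>auto intro!: mult_left_mono power_mono\<close>)
  have nn: "(\<integral>\<^sup>+y. exp (- (d k * norm y)\<^sup>2 / 2) * (norm (ft f y))\<^sup>2 \<partial>lborel) = ennreal (J k)" for k
    unfolding J_def by (rule nn_integral_eq_integral[OF i]) simp
  have "(\<integral>\<^sup>+y. (norm (ft f y))\<^sup>2 \<partial>lborel) = (\<integral>\<^sup>+y. liminf (\<lambda>k. ennreal (exp (- (d k * norm y)\<^sup>2 / 2) *
      (norm (ft f y))\<^sup>2)) \<partial>lborel)"
  proof (rule nn_integral_cong)
    fix y :: 'a
    have "(\<lambda>k. ennreal (exp (- (d k * norm y)\<^sup>2 / 2) * (norm (ft f y))\<^sup>2)) \<longlonglongrightarrow> ennreal (exp (- (0 * norm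
        y)\<^sup>2 / 2) * (norm (ft f y))\<^sup>2)"
      by (intro tendsto_intros d(2)) auto
    from lim_imp_Liminf[OF trivial_limit_sequentially this]
    show "ennreal ((norm (ft f y))\<^sup>2) = liminf (\<lambda>k. ennreal (exp (- (d k * norm y)\<^sup>2 / 2) * (norm (ft f
        y))\<^sup>2))"
      by simp
  qed
  also have "\<dots> \<le> liminf (\<lambda>k. \<integral>\<^sup>+y. exp (- (d k * norm y)\<^sup>2 / 2) * (norm (ft f y))\<^sup>2 \<partial>lborel)"
    by (rule nn_integral_liminf) measurable
  also have "\<dots> = ennreal ?A"
    unfolding nn using lim by (intro lim_imp_Liminf tendsto_ennrealI) auto
  finally have le: "(\<integral>\<^sup>+y. (norm (ft f y))\<^sup>2 \<partial>lborel) \<le> ennreal ?A" .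
  then have fin: "integrable lborel (\<lambda>y. (norm (ft f y))\<^sup>2)"
    by (intro integrableI_bounded) (auto intro: le_less_trans)
  then show "sq_int (ft f)" by (simp add: sq_int_def)
  have "(LINT y|lborel. (norm (ft f y))\<^sup>2) \<le> ?A"
    using le fin by (subst (asm) nn_integral_eq_integral) auto
  moreover have "?A \<le> (LINT y|lborel. (norm (ft f y))\<^sup>2)"
  proof (rule LIMSEQ_le_const2[OF lim], intro exI allI impI)
    fix k
    show "J k \<le> (LINT y|lborel. (norm (ft f y))\<^sup>2)"
      unfolding J_def by (rule integral_mono[OF i fin]) (auto intro!: mult_left_le_one_le)
  qed
  ultimately show "(LINT y|lborel. (norm (ft f y))\<^sup>2) = ?A" by simp
qed

section \<open>The Fourier transform on \<open>L\<^sup>2\<close>\<close>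

lemma norm_vec_square: "(norm (x :: 'a::real_normed_vector ^ 'k::finite))\<^sup>2 = (\<Sum>i\<in>UNIV. (norm (x $ i))\<^sup>2)"
  by (simp add: norm_vec_def L2_set_def sum_nonneg)

text \<open>The extended-valued definition cannot be expanded or subtracted freely. From here on the
  analysis uses Bochner integrals through \<open>sq_int\<close>.\<close>

lemma L2_iff_sq_int: "L2 f \<longleftrightarrow> sq_int f"
proof -
  have "l2sq f = (\<integral>\<^sup>+ x. ennreal (norm ((norm (f x))\<^sup>2)) \<partial>lborel)"
    by (simp add: l2sq_def nsq_def)
  then show ?thesis by (auto simp: L2_def sq_int_def integrable_iff_bounded)
qed

lemma l2sq_eq: "sq_int f \<Longrightarrow> l2sq f = ennreal (LINT x|lborel. (norm (f x))\<^sup>2)"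
  unfolding l2sq_def nsq_def by (subst nn_integral_eq_integral) (auto simp: sq_int_def)

text \<open>With g = f + (g - f), the square expands into the square of f, a cross term that
  vanishes in the limit, and the squared error.\<close>

lemma sq_int_norm_tendsto:
  assumes f: "sq_int f" and g: "\<And>k. sq_int (g k)"
    and l: "(\<lambda>k. LINT x|lborel. (norm (g k x - f x))\<^sup>2) \<longlonglongrightarrow> 0"
  shows "(\<lambda>k. LINT x|lborel. (norm (g k x))\<^sup>2) \<longlonglongrightarrow> (LINT x|lborel. (norm (f x))\<^sup>2)"
proof -
  have s: "sq_int (\<lambda>x. g k x - f x)" for k by (rule sq_int_diff[OF g f])
  have [measurable]: "f \<in> borel_measurable borel" "g k \<in> borel_measurable borel" for k
    using f g by (auto simp: sq_int_def)
  have l2: "(\<lambda>k. LINT x|lborel. norm (f x) * norm (g k x - f x)) \<longlonglongrightarrow> 0"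
    by (rule sq_int_mult_tendsto_0[OF f s l])
  have ii: "integrable lborel (\<lambda>x. f x \<bullet> (g k x - f x))" for k
    by (rule Bochner_Integration.integrable_bound[OF sq_int_integrable_mult[OF f s[of k]]])
       (auto simp: Cauchy_Schwarz_ineq2)
  have i: "integrable lborel (\<lambda>x. (norm (g k x - f x))\<^sup>2)" "integrable lborel (\<lambda>x. (norm (f x))\<^sup>2)" for k
    using s[of k] f by (auto simp: sq_int_def)
  have "(LINT x|lborel. (norm (g k x))\<^sup>2) = (LINT x|lborel. (norm (f x))\<^sup>2 + 2 * (f x \<bullet> (g k x - f x)) +
      (norm (g k x - f x))\<^sup>2)" for k
    by (intro Bochner_Integration.integral_cong refl) (simp add: power2_norm_eq_inner algebra_simps
        inner_commute)
  then have eq: "(LINT x|lborel. (norm (g k x))\<^sup>2) = (LINT x|lborel. (norm (f x))\<^sup>2) + 2 * (LINT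
      x|lborel. f x \<bullet> (g k x - f x))
      + (LINT x|lborel. (norm (g k x - f x))\<^sup>2)" for k
    using ii i by simp
  have "(\<lambda>k. LINT x|lborel. f x \<bullet> (g k x - f x)) \<longlonglongrightarrow> 0"
  proof (rule Lim_null_comparison[OF _ l2], rule always_eventually, rule allI)
    fix k
    have "norm (LINT x|lborel. f x \<bullet> (g k x - f x)) \<le> (LINT x|lborel. norm (f x \<bullet> (g k x - f x)))"
      by (rule integral_norm_bound)
    also have "\<dots> \<le> (LINT x|lborel. norm (f x) * norm (g k x - f x))"
      by (intro integral_mono integrable_norm ii sq_int_integrable_mult f s) (auto simp: Cauchy_Schwarz_ineq2)
    finally show "norm (LINT x|lborel. f x \<bullet> (g k x - f x)) \<le> (LINT x|lborel. norm (f x) * norm (g k x -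
        f x))" .
  qed
  then show ?thesis unfolding eq by (auto intro!: tendsto_eq_intros l)
qed

lemma FT1_nth: "FT1 (f :: real^'n::finite \<Rightarrow> complex^'k::finite) \<xi> $ i
    = complex_of_real ((2 * pi) powr (- real CARD('n) / 2)) * ft (\<lambda>x. f x $ i) \<xi>"
  by (simp add: FT1_def ft_def)

lemma borel_measurable_vec_nth'[measurable (raw)]:
  fixes f :: "'x \<Rightarrow> ('a::euclidean_space) ^ 'k::finite"
  assumes "f \<in> borel_measurable M" shows "(\<lambda>x. f x $ i) \<in> borel_measurable M"
  using assms by (rule borel_measurable_continuous_on[rotated]) (intro continuous_intros)

lemma borel_measurable_vec_iff:
  fixes f :: "'x \<Rightarrow> complex ^ 'k::finite"
  shows "f \<in> borel_measurable M \<longleftrightarrow> (\<forall>i. (\<lambda>x. f x $ i) \<in> borel_measurable M)"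
proof
  assume *: "\<forall>i. (\<lambda>x. f x $ i) \<in> borel_measurable M"
  then show "f \<in> borel_measurable M"
    by (subst borel_measurable_euclidean_space) (auto simp: Basis_vec_def inner_axis intro!:
        borel_measurable_inner)
qed simp

lemma integrable_vec_nth:
  fixes f :: "'x \<Rightarrow> complex ^ 'k::finite"
  shows "integrable M f \<Longrightarrow> integrable M (\<lambda>x. f x $ i)"
  by (rule integrable_bounded_linear[OF bounded_linear_vec_nth])

lemma integral_vec_nth:
  fixes f :: "'x \<Rightarrow> complex ^ 'k::finite"
  shows "integrable M f \<Longrightarrow> (LINT x|M. f x) $ i = (LINT x|M. f x $ i)"
  by (rule integral_bounded_linear[OF bounded_linear_vec_nth, symmetric])

lemma sq_int_vec_nth:
  fixes f :: "'a::euclidean_space \<Rightarrow> complex ^ 'k::finite"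
  assumes "sq_int f" shows "sq_int (\<lambda>x. f x $ i)"
  unfolding sq_int_def
proof
  have [measurable]: "f \<in> borel_measurable borel" and "integrable lborel (\<lambda>x. (norm (f x))\<^sup>2)"
    using assms by (auto simp: sq_int_def)
  then show "integrable lborel (\<lambda>x. (norm (f x $ i))\<^sup>2)"
    by (elim Bochner_Integration.integrable_bound) (auto intro!: power_mono
        Finite_Cartesian_Product.norm_nth_le)
  show "(\<lambda>x. f x $ i) \<in> borel_measurable borel" by measurable
qed

lemma borel_measurable_FT1[measurable]:
  fixes f :: "real^'n::finite \<Rightarrow> complex^'k::finite"
  assumes [measurable]: "f \<in> borel_measurable borel"
  shows "FT1 f \<in> borel_measurable borel"
  unfolding borel_measurable_vec_iff FT1_nth by measurable

lemma plancherel_FT1: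
  fixes f :: "real^'n::finite \<Rightarrow> complex^'k::finite"
  assumes fi: "integrable lborel f" and f: "sq_int f"
  shows "sq_int (FT1 f)" and "(LINT x|lborel. (norm (FT1 f x))\<^sup>2) = (LINT x|lborel. (norm (f x))\<^sup>2)"
proof -
  let ?c = "(2 * pi) powr (- real CARD('n) / 2)"
  have c: "?c\<^sup>2 * (2 * pi) ^ CARD('n) = 1"
    by (simp add: powr_power powr_minus field_simps powr_realpow)
  have [measurable]: "f \<in> borel_measurable borel" using f by (simp add: sq_int_def)
  have P: "sq_int (ft (\<lambda>x. f x $ i))" "(LINT y|lborel. (norm (ft (\<lambda>x. f x $ i) y))\<^sup>2) = (2 * pi) ^
      CARD('n) * (LINT x|lborel. (norm (f x $ i))\<^sup>2)" for i
    using plancherel_L1_L2[OF integrable_vec_nth[OF fi] sq_int_vec_nth[OF f], of i] by simp_all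
  have eq: "(norm (FT1 f \<xi>))\<^sup>2 = (\<Sum>i\<in>UNIV. ?c\<^sup>2 * (norm (ft (\<lambda>x. f x $ i) \<xi>))\<^sup>2)" for \<xi>
    unfolding norm_vec_square FT1_nth norm_mult power_mult_distrib by simp
  have i: "integrable lborel (\<lambda>\<xi>. ?c\<^sup>2 * (norm (ft (\<lambda>x. f x $ i) \<xi>))\<^sup>2)" for i
    using P(1)[of i] by (simp add: sq_int_def)
  show "sq_int (FT1 f)" unfolding sq_int_def eq using i by auto
  have "(LINT x|lborel. (norm (FT1 f x))\<^sup>2) = (\<Sum>i\<in>UNIV. ?c\<^sup>2 * (2 * pi) ^ CARD('n) * (LINT x|lborel.
      (norm (f x $ i))\<^sup>2))"
    unfolding eq using i by (simp add: P(2) mult.assoc)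
  also have "\<dots> = (\<Sum>i\<in>UNIV. LINT x|lborel. (norm (f x $ i))\<^sup>2)" unfolding c by simp
  also have "\<dots> = (LINT x|lborel. (norm (f x))\<^sup>2)"
    unfolding norm_vec_square using sq_int_vec_nth[OF f] by (simp add: sq_int_def)
  finally show "(LINT x|lborel. (norm (FT1 f x))\<^sup>2) = (LINT x|lborel. (norm (f x))\<^sup>2)" .
qed

lemma norm_FT1_le:
  fixes f :: "real^'n::finite \<Rightarrow> complex^'k::finite"
  assumes fi: "integrable lborel f"
  shows "norm (FT1 f \<xi>) \<le> real CARD('k) * ((2 * pi) powr (- real CARD('n) / 2) * (LINT x|lborel. norm (f x)))"
proof -
  let ?c = "(2 * pi) powr (- real CARD('n) / 2)"
  have "norm (FT1 f \<xi>) \<le> (\<Sum>i\<in>UNIV. norm (FT1 f \<xi> $ i))"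
    by (simp add: norm_vec_def L2_set_le_sum)
  also have "\<dots> \<le> (\<Sum>i\<in>(UNIV::'k set). ?c * (LINT x|lborel. norm (f x)))"
  proof (rule sum_mono)
    fix i :: 'k
    have "norm (ft (\<lambda>x. f x $ i) \<xi>) \<le> (LINT x|lborel. norm (f x $ i))"
      by (rule norm_ft_le[OF integrable_vec_nth[OF fi]])
    also have "\<dots> \<le> (LINT x|lborel. norm (f x))"
      by (intro integral_mono integrable_norm integrable_vec_nth fi Finite_Cartesian_Product.norm_nth_le)
    finally show "norm (FT1 f \<xi> $ i) \<le> ?c * (LINT x|lborel. norm (f x))"
      by (simp add: FT1_nth norm_mult)
  qed
  finally show ?thesis by simp
qed

lemma FT1_diff:
  fixes f :: "real^'n::finite \<Rightarrow> complex^'k::finite"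
  assumes "integrable lborel f" "integrable lborel g"
  shows "FT1 (\<lambda>x. f x - g x) \<xi> = FT1 f \<xi> - FT1 g \<xi>"
  unfolding vec_eq_iff
  by (simp add: FT1_nth ft_diff[OF integrable_vec_nth[OF assms(1)] integrable_vec_nth[OF assms(2)]]
      right_diff_distrib)

lemma fourier_relE:
  assumes "fourier_rel f g"
  obtains \<phi> where "sq_int f" "sq_int g" "\<And>k::nat. integrable lborel (\<phi> k)" "\<And>k. sq_int (\<phi> k)"
    "(\<lambda>k. LINT x|lborel. (norm (\<phi> k x - f x))\<^sup>2) \<longlonglongrightarrow> 0"
    "(\<lambda>k. LINT x|lborel. (norm (FT1 (\<phi> k) x - g x))\<^sup>2) \<longlonglongrightarrow> 0"
proof -
  from assms obtain \<phi> where *: "sq_int f" "sq_int g" "\<And>k::nat. integrable lborel (\<phi> k)" "\<And>k. sq_int (\<phi> k)"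
    "(\<lambda>k. l2sq (\<lambda>x. \<phi> k x - f x)) \<longlonglongrightarrow> 0" "(\<lambda>k. l2sq (\<lambda>x. FT1 (\<phi> k) x - g x)) \<longlonglongrightarrow> 0"
    unfolding fourier_rel_def L2_iff_sq_int by blast
  have s: "sq_int (\<lambda>x. \<phi> k x - f x)" "sq_int (\<lambda>x. FT1 (\<phi> k) x - g x)" for k
    using *(1-4) plancherel_FT1(1)[OF *(3,4)] by (auto intro!: sq_int_diff)
  show ?thesis
    by (rule that[OF *(1-4)])
      (use *(5,6) in \<open>simp_all add: l2sq_eq s ennreal_0[symmetric] del: ennreal_0\<close>)
qed

lemma fourier_rel_norm:
  assumes "fourier_rel f g"
  shows "l2sq f = l2sq g"
proof -
  obtain \<phi> where *: "sq_int f" "sq_int g" "\<And>k::nat. integrable lborel (\<phi> k)" "\<And>k. sq_int (\<phi> k)"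
    "(\<lambda>k. LINT x|lborel. (norm (\<phi> k x - f x))\<^sup>2) \<longlonglongrightarrow> 0"
    "(\<lambda>k. LINT x|lborel. (norm (FT1 (\<phi> k) x - g x))\<^sup>2) \<longlonglongrightarrow> 0"
    using fourier_relE[OF assms] by blast
  have "(\<lambda>k. LINT x|lborel. (norm (\<phi> k x))\<^sup>2) \<longlonglongrightarrow> (LINT x|lborel. (norm (f x))\<^sup>2)"
    by (rule sq_int_norm_tendsto[OF *(1,4,5)])
  moreover have "(\<lambda>k. LINT x|lborel. (norm (FT1 (\<phi> k) x))\<^sup>2) \<longlonglongrightarrow> (LINT x|lborel. (norm (g x))\<^sup>2)"
    by (rule sq_int_norm_tendsto[OF *(2) plancherel_FT1(1)[OF *(3,4)] *(6)])
  ultimately show ?thesis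
    unfolding plancherel_FT1(2)[OF *(3,4)] l2sq_eq[OF *(1)] l2sq_eq[OF *(2)] by (metis LIMSEQ_unique)
qed


section \<open>Gaussian weights as convolutions on the Fourier side\<close>

lemma ft_gauss_diff:
  fixes x :: "'a::euclidean_space"
  assumes d: "0 < d"
  shows "ft (\<lambda>y. complex_of_real (gauss d (y - z))) x = exp (- \<i> * complex_of_real (z \<bullet> x)) * exp (- (d *
      norm x)\<^sup>2 / 2)"
proof -
  let ?e = "\<lambda>y. exp (- \<i> * complex_of_real (x \<bullet> y))"
  have e: "?e z * ?e (y - z) = ?e y" for y
    unfolding exp_add[symmetric] by (simp add: inner_diff_right right_diff_distrib)
  have "ft (\<lambda>y. complex_of_real (gauss d (y - z))) x = (LINT y|lborel. ?e z * (?e (y - z) *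
      complex_of_real (gauss d (y - z))))"
    unfolding ft_def by (simp only: e mult.assoc[symmetric])
  also have "\<dots> = ?e z * (LINT y|lborel. ?e (y - z) * complex_of_real (gauss d (y - z)))" by simp
  also have "(LINT y|lborel. ?e (y - z) * complex_of_real (gauss d (y - z))) = (LINT y|lborel. ?e y *
      complex_of_real (gauss d y))"
    by (rule integral_lborel_diff) measurable
  also have "\<dots> = exp (- (d * norm x)\<^sup>2 / 2)"
    using integral_iexp_gauss[OF d, of "-x"] by simp
  finally show ?thesis by (simp add: inner_commute)
qed

lemma integrable_gauss_diff:
  assumes "0 < d" shows "integrable lborel (\<lambda>y. gauss d (y - z::'a::euclidean_space))"
    "integrable lborel (\<lambda>y. gauss d (z - y::'a::euclidean_space))"
  using integrable_lborel_diff[OF integrable_gauss[OF assms]] by auto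

lemma gauss_le: "gauss d (x::'a::euclidean_space) \<le> (1 / sqrt (2 * pi * d\<^sup>2)) ^ DIM('a)"
  unfolding gauss_eq by (intro mult_left_le) (auto intro!: divide_nonneg_nonneg)

lemma sq_int_gauss:
  assumes d: "0 < d" shows "sq_int (gauss d :: 'a::euclidean_space \<Rightarrow> real)"
  unfolding sq_int_def
proof
  show "integrable lborel (\<lambda>x::'a. (norm (gauss d x))\<^sup>2)"
    by (rule Bochner_Integration.integrable_bound[OF integrable_mult_right[OF integrable_gauss[OF d], of
        "(1 / sqrt (2 * pi * d\<^sup>2)) ^ DIM('a)"]])
     (auto simp: power2_eq_square abs_mult intro!: mult_right_mono order_trans[OF gauss_le])
qed simp

lemma sq_int_exp_norm:
  assumes d: "0 < d" shows "sq_int (\<lambda>x::'a::euclidean_space. exp (- (d * norm x)\<^sup>2 / 2))"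
  unfolding sq_int_def
proof
  show "integrable lborel (\<lambda>x::'a. (norm (exp (- (d * norm x)\<^sup>2 / 2)))\<^sup>2)"
    by (rule Bochner_Integration.integrable_bound[OF integrable_exp_norm[OF d]])
     (auto simp: power2_eq_square intro!: mult_left_le)
qed simp

lemma sq_int_mult_integrable_scaleR:
  fixes f :: "'a::euclidean_space \<Rightarrow> 'b::euclidean_space"
  assumes "sq_int g" "sq_int f"
  shows "integrable lborel (\<lambda>x. g x *\<^sub>R f x)"
proof (rule Bochner_Integration.integrable_bound[OF sq_int_integrable_mult[OF assms]])
  show "(\<lambda>x. g x *\<^sub>R f x) \<in> borel_measurable lborel"
    using assms[THEN sq_int_measurable] by simp
qed simp

lemma sq_int_exp_norm_scaleR:
  assumes "sq_int f" shows "sq_int (\<lambda>x. exp (- (d * norm x)\<^sup>2 / 2) *\<^sub>R f x)"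
proof (rule sq_int_bound[OF assms])
  show "(\<lambda>x. exp (- (d * norm x)\<^sup>2 / 2) *\<^sub>R f x) \<in> borel_measurable borel"
    using assms[THEN sq_int_measurable] by simp
qed (auto intro!: mult_left_le_one_le)

text \<open>A translated Gaussian density is the transform partner of a modulated Gaussian weight,
  so the multiplication formula moves the weight from f to a convolution of its transform.\<close>

lemma FT1_exp_norm_L1:
  fixes f :: "real^'n::finite \<Rightarrow> complex^'k::finite"
  assumes fi: "integrable lborel f" and f: "sq_int f" and d: "0 < d"
  shows "FT1 (\<lambda>x. exp (- (d * norm x)\<^sup>2 / 2) *\<^sub>R f x) \<xi> = (LINT \<eta>|lborel. gauss d (\<xi> - \<eta>) *\<^sub>R FT1 f \<eta>)"
proof -
  have ig: "integrable lborel (\<lambda>\<eta>. gauss d (\<xi> - \<eta>) *\<^sub>R FT1 f \<eta>)"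
    by (rule sq_int_mult_integrable_scaleR[OF sq_int_lborel_diff(2)[OF sq_int_gauss[OF d]]
        plancherel_FT1(1)[OF fi f]])
  have "FT1 (\<lambda>x. exp (- (d * norm x)\<^sup>2 / 2) *\<^sub>R f x) \<xi> $ i = (LINT \<eta>|lborel. gauss d (\<xi> - \<eta>) *\<^sub>R FT1 f \<eta>)
      $ i" for i
  proof -
    let ?c = "complex_of_real ((2 * pi) powr (- real CARD('n) / 2))"
    have "(LINT \<eta>|lborel. gauss d (\<xi> - \<eta>) *\<^sub>R FT1 f \<eta>) $ i = (LINT \<eta>|lborel. ?c * (ft (\<lambda>x. f x $ i) \<eta> *
        complex_of_real (gauss d (\<eta> - \<xi>))))"
      unfolding integral_vec_nth[OF ig] unfolding vector_scaleR_component FT1_nth gauss_commute[of d \<xi>]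
      by (simp add: scaleR_conv_of_real mult_ac)
    also have "\<dots> = ?c * (LINT \<eta>|lborel. ft (\<lambda>x. f x $ i) \<eta> * complex_of_real (gauss d (\<eta> - \<xi>)))"
      by (rule integral_mult_right_zero)
    also have "(LINT \<eta>|lborel. ft (\<lambda>x. f x $ i) \<eta> * complex_of_real (gauss d (\<eta> - \<xi>)))
       = (LINT x|lborel. f x $ i * ft (\<lambda>\<eta>. complex_of_real (gauss d (\<eta> - \<xi>))) x)"
      by (rule integral_ft_mult[OF integrable_vec_nth[OF fi]]) (simp add: integrable_gauss_diff d)
    also have "\<dots> = ft (\<lambda>x. (exp (- (d * norm x)\<^sup>2 / 2) *\<^sub>R f x) $ i) \<xi>"
      unfolding ft_gauss_diff[OF d] ft_def vector_scaleR_component unfolding scaleR_conv_of_real by (simp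
          only: mult_ac of_real_exp)
    finally show ?thesis by (simp only: FT1_nth)
  qed
  then show ?thesis by (simp add: vec_eq_iff)
qed

text \<open>For fixed \<xi> both sides are continuous under convergence in square mean, since the
  Gaussian is itself square-integrable. The identity for integrable functions therefore passes along
  the sequence that defines \<open>fourier_rel\<close>, and it holds at every \<xi>.\<close>

lemma FT1_exp_norm_fourier_rel:
  fixes f :: "real^'n::finite \<Rightarrow> complex^'k::finite"
  assumes fg: "fourier_rel f g" and d: "0 < d"
  shows "FT1 (\<lambda>x. exp (- (d * norm x)\<^sup>2 / 2) *\<^sub>R f x) \<xi> = (LINT \<eta>|lborel. gauss d (\<xi> - \<eta>) *\<^sub>R g \<eta>)"
proof -
  obtain \<phi> where *: "sq_int f" "sq_int g" "\<And>k::nat. integrable lborel (\<phi> k)" "\<And>k. sq_int (\<phi> k)"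
    "(\<lambda>k. LINT x|lborel. (norm (\<phi> k x - f x))\<^sup>2) \<longlonglongrightarrow> 0"
    "(\<lambda>k. LINT x|lborel. (norm (FT1 (\<phi> k) x - g x))\<^sup>2) \<longlonglongrightarrow> 0"
    using fourier_relE[OF fg] by blast
  let ?E = "\<lambda>x::real^'n. exp (- (d * norm x)\<^sup>2 / 2)"
  let ?G = "\<lambda>\<eta>. gauss d (\<xi> - \<eta>)"
  have E: "sq_int ?E" by (rule sq_int_exp_norm[OF d])
  have G: "sq_int ?G" by (rule sq_int_lborel_diff(2)[OF sq_int_gauss[OF d]])
  have sF: "sq_int (FT1 (\<phi> k))" for k by (rule plancherel_FT1(1)[OF *(3,4)])
  have iE: "integrable lborel (\<lambda>x. ?E x *\<^sub>R h x)" if "sq_int h" for h :: "real^'n \<Rightarrow> complex^'k"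
    by (rule sq_int_mult_integrable_scaleR[OF E that])
  have iG: "integrable lborel (\<lambda>x. ?G x *\<^sub>R h x)" if "sq_int h" for h :: "real^'n \<Rightarrow> complex^'k"
    by (rule sq_int_mult_integrable_scaleR[OF G that])
  let ?c = "(2 * pi) powr (- real CARD('n) / 2)"
  have A: "(\<lambda>k. FT1 (\<lambda>x. ?E x *\<^sub>R \<phi> k x) \<xi> - FT1 (\<lambda>x. ?E x *\<^sub>R f x) \<xi>) \<longlonglongrightarrow> 0"
  proof (rule Lim_null_comparison)
    show "(\<lambda>k. real CARD('k) * (?c * (LINT x|lborel. norm (?E x) * norm (\<phi> k x - f x)))) \<longlonglongrightarrow> 0"
      using sq_int_mult_tendsto_0[OF E sq_int_diff[OF *(4,1)] *(5)] by (auto intro!: tendsto_eq_intros)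
    have "FT1 (\<lambda>x. ?E x *\<^sub>R \<phi> k x) \<xi> - FT1 (\<lambda>x. ?E x *\<^sub>R f x) \<xi> = FT1 (\<lambda>x. ?E x *\<^sub>R (\<phi> k x - f x)) \<xi>" for k
      unfolding scaleR_diff_right by (rule FT1_diff[OF iE iE, symmetric]) fact+
    then show "\<forall>\<^sub>F k in sequentially. norm (FT1 (\<lambda>x. ?E x *\<^sub>R \<phi> k x) \<xi> - FT1 (\<lambda>x. ?E x *\<^sub>R f x) \<xi>)
       \<le> real CARD('k) * (?c * (LINT x|lborel. norm (?E x) * norm (\<phi> k x - f x)))"
      using norm_FT1_le[OF iE[OF sq_int_diff[OF *(4,1)]], of _ \<xi>] by simp
  qed
  have B: "(\<lambda>k. (LINT \<eta>|lborel. ?G \<eta> *\<^sub>R FT1 (\<phi> k) \<eta>) - (LINT \<eta>|lborel. ?G \<eta> *\<^sub>R g \<eta>)) \<longlonglongrightarrow> 0"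
  proof (rule Lim_null_comparison)
    show "(\<lambda>k. LINT x|lborel. norm (?G x) * norm (FT1 (\<phi> k) x - g x)) \<longlonglongrightarrow> 0"
      by (rule sq_int_mult_tendsto_0[OF G sq_int_diff[OF sF *(2)] *(6)])
    have "(LINT \<eta>|lborel. ?G \<eta> *\<^sub>R FT1 (\<phi> k) \<eta>) - (LINT \<eta>|lborel. ?G \<eta> *\<^sub>R g \<eta>)
       = (LINT \<eta>|lborel. ?G \<eta> *\<^sub>R (FT1 (\<phi> k) \<eta> - g \<eta>))" for k
      unfolding scaleR_diff_right by (rule Bochner_Integration.integral_diff[OF iG[OF sF] iG[OF *(2)],
          symmetric])
    then have "norm ((LINT \<eta>|lborel. ?G \<eta> *\<^sub>R FT1 (\<phi> k) \<eta>) - (LINT \<eta>|lborel. ?G \<eta> *\<^sub>R g \<eta>))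
       \<le> (LINT x|lborel. norm (?G x) * norm (FT1 (\<phi> k) x - g x))" for k
      using integral_norm_bound[of lborel "\<lambda>\<eta>. ?G \<eta> *\<^sub>R (FT1 (\<phi> k) \<eta> - g \<eta>)"] by simp
    then show "\<forall>\<^sub>F k in sequentially. norm ((LINT \<eta>|lborel. ?G \<eta> *\<^sub>R FT1 (\<phi> k) \<eta>) - (LINT \<eta>|lborel. ?G \<eta>
        *\<^sub>R g \<eta>))
       \<le> (LINT x|lborel. norm (?G x) * norm (FT1 (\<phi> k) x - g x))" by simp
  qed
  show ?thesis
    by (rule LIMSEQ_unique[OF LIM_zero_cancel[OF A] LIM_zero_cancel[OF B, folded FT1_exp_norm_L1[OF
        *(3,4) d]]])
qed

text \<open>The exponent on the left has no factor 1/2 because the weight is the square of the one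
  used in the convolution formula; the convolution width is therefore exactly d.\<close>

lemma nn_integral_exp_norm_fourier_rel:
  fixes f :: "real^'n::finite \<Rightarrow> complex^'k::finite"
  assumes fg: "fourier_rel f g" and d: "0 < d"
  shows "(\<integral>\<^sup>+x. exp (- (d * norm x)\<^sup>2) * (norm (f x))\<^sup>2 \<partial>lborel)
     = (\<integral>\<^sup>+\<xi>. (norm (LINT \<eta>|lborel. gauss d (\<xi> - \<eta>) *\<^sub>R g \<eta>))\<^sup>2 \<partial>lborel)"
proof -
  have f: "sq_int f" using fg by (elim fourier_relE)
  let ?h = "\<lambda>x. exp (- (d * norm x)\<^sup>2 / 2) *\<^sub>R f x"
  have i: "integrable lborel ?h" and s: "sq_int ?h"
    using sq_int_mult_integrable_scaleR[OF sq_int_exp_norm[OF d] f] sq_int_exp_norm_scaleR[OF f] by auto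
  have "exp (- (d * norm x)\<^sup>2) * (norm (f x))\<^sup>2 = (norm (?h x))\<^sup>2" for x
    by (simp add: power_mult_distrib power2_eq_square[of "exp _"] exp_add[symmetric])
  then have "(\<integral>\<^sup>+x. exp (- (d * norm x)\<^sup>2) * (norm (f x))\<^sup>2 \<partial>lborel) = l2sq ?h"
    by (simp add: l2sq_def nsq_def)
  also have "\<dots> = l2sq (FT1 ?h)"
    unfolding l2sq_eq[OF s] l2sq_eq[OF plancherel_FT1(1)[OF i s]] plancherel_FT1(2)[OF i s] ..
  finally show ?thesis
    unfolding FT1_exp_norm_fourier_rel[OF fg d] l2sq_def nsq_def by simp
qed

section \<open>Gaussian smoothing and Fourier inversion\<close>

definition gconv :: "real \<Rightarrow> ('a::euclidean_space \<Rightarrow> 'b::euclidean_space) \<Rightarrow> 'a \<Rightarrow> 'b" where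
  "gconv d w \<xi> = (LINT \<eta>|lborel. gauss d (\<xi> - \<eta>) *\<^sub>R w \<eta>)"

lemma integrable_gconv_pair:
  fixes w :: "'a::euclidean_space \<Rightarrow> 'b::euclidean_space"
  assumes w: "integrable lborel w" and d: "0 < d"
  shows "integrable (lborel \<Otimes>\<^sub>M lborel) (\<lambda>(\<eta>,\<xi>). gauss d (\<xi> - \<eta>) *\<^sub>R w \<eta>)"
proof (rule lborel_pair.Fubini_integrable)
  have [measurable]: "w \<in> borel_measurable borel" using w by auto
  show "(\<lambda>(\<eta>,\<xi>). gauss d (\<xi> - \<eta>) *\<^sub>R w \<eta>) \<in> borel_measurable (lborel \<Otimes>\<^sub>M lborel)" by measurable
  have "(LINT \<xi>|lborel. gauss d (\<xi> - \<eta>)) = 1" for \<eta> :: 'a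
    using integral_lborel_diff(1)[of "gauss d" \<eta>] by (simp add: integral_gauss d)
  then show "integrable lborel (\<lambda>x. LINT y|lborel. norm (case (x, y) of (\<eta>, \<xi>) \<Rightarrow> gauss d (\<xi> - \<eta>) *\<^sub>R w \<eta>))"
    using w by simp
  show "AE x in lborel. integrable lborel (\<lambda>y. case (x, y) of (\<eta>, \<xi>) \<Rightarrow> gauss d (\<xi> - \<eta>) *\<^sub>R w \<eta>)"
    by (auto intro!: AE_I2 integrable_scaleR_left integrable_gauss_diff d)
qed

lemma integrable_gconv:
  fixes w :: "'a::euclidean_space \<Rightarrow> 'b::euclidean_space"
  assumes "integrable lborel w" "0 < d" shows "integrable lborel (gconv d w)"
  using lborel_pair.integrable_snd[OF integrable_gconv_pair[OF assms]] by (simp add: gconv_def[abs_def])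

lemma ft_gconv:
  fixes w :: "'a::euclidean_space \<Rightarrow> complex"
  assumes w: "integrable lborel w" and d: "0 < d"
  shows "ft (gconv d w) x = exp (- (d * norm x)\<^sup>2 / 2) * ft w x"
proof -
  have [measurable]: "w \<in> borel_measurable borel" using w by auto
  let ?e = "\<lambda>y. exp (- \<i> * complex_of_real (x \<bullet> y))"
  have i: "integrable (lborel \<Otimes>\<^sub>M lborel) (\<lambda>(\<eta>,\<xi>). ?e \<xi> * (gauss d (\<xi> - \<eta>) *\<^sub>R w \<eta>))"
    by (rule Bochner_Integration.integrable_bound[OF integrable_gconv_pair[OF w d]]) (auto simp: norm_mult)
  have "ft (gconv d w) x = (LINT \<xi>|lborel. LINT \<eta>|lborel. ?e \<xi> * (gauss d (\<xi> - \<eta>) *\<^sub>R w \<eta>))"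
    unfolding ft_def gconv_def by (simp only: integral_mult_right_zero)
  also have "\<dots> = (LINT \<eta>|lborel. LINT \<xi>|lborel. ?e \<xi> * (gauss d (\<xi> - \<eta>) *\<^sub>R w \<eta>))"
    by (rule lborel_pair.Fubini_integral[OF i])
  also have "\<dots> = (LINT \<eta>|lborel. w \<eta> * ft (\<lambda>\<xi>. complex_of_real (gauss d (\<xi> - \<eta>))) x)"
    unfolding ft_def integral_mult_right_zero[symmetric]
    by (intro Bochner_Integration.integral_cong refl) (simp add: scaleR_conv_of_real mult_ac)
  also have "\<dots> = (LINT \<eta>|lborel. exp (- (d * norm x)\<^sup>2 / 2) * (?e \<eta> * w \<eta>))"
    unfolding ft_gauss_diff[OF d] by (simp only: inner_commute mult_ac)
  finally show ?thesis unfolding ft_def by (simp only: integral_mult_right_zero)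
qed

lemma gconv_nth:
  fixes w :: "'a::euclidean_space \<Rightarrow> complex^'k::finite"
  assumes w: "sq_int w" and d: "0 < d"
  shows "gconv d w \<xi> $ i = gconv d (\<lambda>\<eta>. w \<eta> $ i) \<xi>"
proof -
  have "integrable lborel (\<lambda>\<eta>. gauss d (\<xi> - \<eta>) *\<^sub>R w \<eta>)"
    by (rule sq_int_mult_integrable_scaleR[OF sq_int_lborel_diff(2)[OF sq_int_gauss[OF d]] w])
  from integral_vec_nth[OF this] show ?thesis unfolding gconv_def by simp
qed

lemma FT1_gconv:
  fixes w :: "real^'n::finite \<Rightarrow> complex^'k::finite"
  assumes wi: "integrable lborel w" and w: "sq_int w" and d: "0 < d"
  shows "FT1 (gconv d w) x = exp (- (d * norm x)\<^sup>2 / 2) *\<^sub>R FT1 w x"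
  unfolding vec_eq_iff FT1_nth vector_scaleR_component gconv_nth[OF w d]
  using ft_gconv[OF integrable_vec_nth[OF wi] d] by (simp add: scaleR_conv_of_real mult_ac)

text \<open>Regularized inversion: the reflected transform is the inverse transform, and damping it
  returns w smoothed at scale d. The two normalizing factors cancel the power of 2 pi produced by
  the Gaussian.\<close>

lemma FT1_exp_norm_FT1:
  fixes w :: "real^'n::finite \<Rightarrow> complex^'k::finite"
  assumes wi: "integrable lborel w" and w: "sq_int w" and d: "0 < d"
  shows "FT1 (\<lambda>x. exp (- (d * norm x)\<^sup>2 / 2) *\<^sub>R FT1 w (- x)) \<xi> = gconv d w \<xi>"
proof -
  have [measurable]: "w \<in> borel_measurable borel" using wi by auto
  let ?c = "(2 * pi) powr (- real CARD('n) / 2)"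
  have c: "?c * ?c * (2 * pi) ^ CARD('n) = 1"
    by (simp add: powr_add[symmetric] powr_minus field_simps powr_realpow)
  let ?E = "\<lambda>x::real^'n. exp (- (d * norm x)\<^sup>2 / 2)"
  have "FT1 (\<lambda>x. ?E x *\<^sub>R FT1 w (- x)) \<xi> $ i = gconv d w \<xi> $ i" for i
  proof -
    let ?w = "\<lambda>x. w x $ i"
    have [measurable]: "ft ?w \<in> borel_measurable borel" by measurable
    let ?h = "\<lambda>x. exp (- \<i> * complex_of_real (\<xi> \<bullet> (-x))) * complex_of_real (?E x)"
    have ih: "integrable lborel ?h"
      by (rule Bochner_Integration.integrable_bound[OF integrable_exp_norm[OF d]]) (auto simp: norm_mult)
    have fh: "ft ?h \<eta> = complex_of_real ((2 * pi) ^ CARD('n) * gauss d (\<xi> - \<eta>))" for \<eta>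
    proof -
      have "ft ?h \<eta> = ft (\<lambda>x. complex_of_real (?E x)) (\<eta> - \<xi>)"
        unfolding ft_def mult.assoc[symmetric] exp_add[symmetric] by (simp add: inner_diff_left algebra_simps)
      then show ?thesis unfolding ft_exp_norm[OF d] by (simp add: gauss_commute)
    qed
    have "ft (\<lambda>x. (?E x *\<^sub>R FT1 w (- x)) $ i) \<xi>
       = (LINT x|lborel. exp (- \<i> * complex_of_real (\<xi> \<bullet> x)) * (?E x *\<^sub>R (?c * ft ?w (- x))))"
      unfolding ft_def[of _ \<xi>] by (simp add: FT1_nth)
    also have "\<dots> = (LINT x|lborel. exp (- \<i> * complex_of_real (\<xi> \<bullet> (-x))) * (?E x *\<^sub>R (?c * ft ?w x)))"
      by (subst integral_lborel_affine[where c="-1" and t=0]) simp_all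
    also have "\<dots> = (LINT x|lborel. ?c * (ft ?w x * ?h x))"
      unfolding scaleR_conv_of_real by (simp only: mult_ac)
    also have "\<dots> = ?c * (LINT x|lborel. ft ?w x * ?h x)" by (rule integral_mult_right_zero)
    also have "(LINT x|lborel. ft ?w x * ?h x) = (LINT \<eta>|lborel. ?w \<eta> * ft ?h \<eta>)"
      by (rule integral_ft_mult[OF integrable_vec_nth[OF wi] ih])
    also have "\<dots> = (LINT \<eta>|lborel. complex_of_real ((2 * pi) ^ CARD('n)) * (gauss d (\<xi> - \<eta>) *\<^sub>R ?w \<eta>))"
      unfolding fh scaleR_conv_of_real of_real_mult by (simp only: mult_ac)
    also have "\<dots> = complex_of_real ((2 * pi) ^ CARD('n)) * gconv d ?w \<xi>"
      unfolding gconv_def by (rule integral_mult_right_zero)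
    finally have "FT1 (\<lambda>x. ?E x *\<^sub>R FT1 w (- x)) \<xi> $ i = complex_of_real (?c * ?c * (2 * pi) ^ CARD('n))
        * gconv d ?w \<xi>"
      unfolding FT1_nth[of _ \<xi>] of_real_mult by (simp only: mult_ac)
    then show ?thesis unfolding c gconv_nth[OF w d] by simp
  qed
  then show ?thesis by (simp add: vec_eq_iff)
qed

lemma sq_int_exp_diff_tendsto_0:
  fixes v :: "'a::euclidean_space \<Rightarrow> 'b::euclidean_space"
  assumes v: "sq_int v" and d: "d \<longlonglongrightarrow> 0"
  shows "(\<lambda>k. LINT x|lborel. (norm (exp (- (d k * norm x)\<^sup>2 / 2) *\<^sub>R v x - v x))\<^sup>2) \<longlonglongrightarrow> 0"
proof -
  have [measurable]: "v \<in> borel_measurable borel" and i: "integrable lborel (\<lambda>x. (norm (v x))\<^sup>2)"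
    using v by (auto simp: sq_int_def)
  have "(\<lambda>k. LINT x|lborel. (norm (exp (- (d k * norm x)\<^sup>2 / 2) *\<^sub>R v x - v x))\<^sup>2) \<longlonglongrightarrow> (LINT x|(lborel::'a
      measure). 0)"
  proof (rule integral_dominated_convergence[where w="\<lambda>x. (norm (v x))\<^sup>2"])
    show "AE x in lborel. (\<lambda>k. (norm (exp (- (d k * norm x)\<^sup>2 / 2) *\<^sub>R v x - v x))\<^sup>2) \<longlonglongrightarrow> 0"
      using d by (intro AE_I2) (auto intro!: tendsto_eq_intros)
    show "AE x in lborel. norm ((norm (exp (- (d k * norm x)\<^sup>2 / 2) *\<^sub>R v x - v x))\<^sup>2) \<le> (norm (v x))\<^sup>2" for k
    proof (rule AE_I2)
      fix x
      have "norm (exp (- (d k * norm x)\<^sup>2 / 2) *\<^sub>R v x - v x) = \<bar>exp (- (d k * norm x)\<^sup>2 / 2) - 1\<bar> * norm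
          (v x)"
        by (metis norm_scaleR scaleR_left_diff_distrib scaleR_one)
      also have "\<dots> \<le> norm (v x)"
        by (intro mult_left_le_one_le) (auto simp: abs_if)
      finally show "norm ((norm (exp (- (d k * norm x)\<^sup>2 / 2) *\<^sub>R v x - v x))\<^sup>2) \<le> (norm (v x))\<^sup>2"
        by (simp add: power_mono)
    qed
  qed (use i in auto)
  then show ?thesis by simp
qed

text \<open>Convergence of \<open>gconv d w\<close> to \<open>w\<close> is read off from the transforms, where it is dominated convergence.\<close>
lemma fourier_rel_inverse:
  fixes w :: "real^'n::finite \<Rightarrow> complex^'k::finite"
  assumes wi: "integrable lborel w" and w: "sq_int w"
  shows "fourier_rel (\<lambda>x. FT1 w (- x)) w"
proof -
  define d where "d k = 1 / real (Suc k)" for k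
  have d: "\<And>k. 0 < d k" "d \<longlonglongrightarrow> 0" unfolding d_def using LIMSEQ_inverse_real_of_nat by (auto simp:
      inverse_eq_divide)
  have sF: "sq_int (FT1 w)" by (rule plancherel_FT1(1)[OF wi w])
  have v: "sq_int (\<lambda>x. FT1 w (- x))" using sq_int_lborel_diff(2)[OF sF, of 0] by simp
  define \<phi> where "\<phi> k x = exp (- (d k * norm x)\<^sup>2 / 2) *\<^sub>R FT1 w (- x)" for k x
  have \<phi>i: "integrable lborel (\<phi> k)" for k
    unfolding \<phi>_def by (rule sq_int_mult_integrable_scaleR[OF sq_int_exp_norm[OF d(1)] v])
  have \<phi>s: "sq_int (\<phi> k)" for k
    unfolding \<phi>_def by (rule sq_int_exp_norm_scaleR[OF v])
  have F\<phi>: "FT1 (\<phi> k) = gconv (d k) w" for k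
    unfolding \<phi>_def[abs_def] by (rule ext) (rule FT1_exp_norm_FT1[OF wi w d(1)])
  have gi: "integrable lborel (gconv (d k) w)" for k by (rule integrable_gconv[OF wi d(1)])
  have gs: "sq_int (gconv (d k) w)" for k
    using plancherel_FT1(1)[OF \<phi>i \<phi>s, of k] unfolding F\<phi> .
  have lim1: "(\<lambda>k. LINT x|lborel. (norm (\<phi> k x - FT1 w (- x)))\<^sup>2) \<longlonglongrightarrow> 0"
    unfolding \<phi>_def by (rule sq_int_exp_diff_tendsto_0[OF v d(2)])
  have "(LINT x|lborel. (norm (gconv (d k) w x - w x))\<^sup>2) = (LINT x|lborel. (norm (exp (- (d k * norm
      x)\<^sup>2 / 2) *\<^sub>R FT1 w x - FT1 w x))\<^sup>2)" for k
    using plancherel_FT1(2)[OF Bochner_Integration.integrable_diff[OF gi wi] sq_int_diff[OF gs w], of k]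
    unfolding FT1_diff[OF gi wi] FT1_gconv[OF wi w d(1)] by simp
  then have lim2: "(\<lambda>k. LINT x|lborel. (norm (FT1 (\<phi> k) x - w x))\<^sup>2) \<longlonglongrightarrow> 0"
    unfolding F\<phi> using sq_int_exp_diff_tendsto_0[OF sF d(2)] by simp
  have lim1': "(\<lambda>k. l2sq (\<lambda>x. \<phi> k x - FT1 w (- x))) \<longlonglongrightarrow> 0"
    unfolding l2sq_eq[OF sq_int_diff[OF \<phi>s v]] using tendsto_ennrealI[OF lim1] by simp
  have lim2': "(\<lambda>k. l2sq (\<lambda>x. FT1 (\<phi> k) x - w x)) \<longlonglongrightarrow> 0"
    unfolding l2sq_eq[OF sq_int_diff[OF plancherel_FT1(1)[OF \<phi>i \<phi>s] w]] using tendsto_ennrealI[OF lim2]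
        by simp
  show ?thesis
    unfolding fourier_rel_def L2_iff_sq_int
    using v w \<phi>i \<phi>s lim1' lim2' by (intro conjI exI[of _ \<phi>]) auto
qed

section \<open>Parseval's identity for inverse transforms of integrable functions\<close>

lemma norm_cinner_le:
  "norm (\<Sum>i\<in>UNIV. x $ i * cnj (y $ i)) \<le> real CARD('k) * (norm x * norm (y :: complex^'k::finite))"
proof -
  have "norm (\<Sum>i\<in>UNIV. x $ i * cnj (y $ i)) \<le> (\<Sum>i\<in>(UNIV::'k set). norm x * norm y)"
    by (rule sum_norm_le) (auto simp: norm_mult intro!: mult_mono Finite_Cartesian_Product.norm_nth_le)
  then show ?thesis by simp
qed

lemma integrable_cinner:
  fixes f g :: "'a::euclidean_space \<Rightarrow> complex^'k::finite"
  assumes f: "sq_int f" and g: "sq_int g"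
  shows "integrable lborel (\<lambda>x. \<Sum>i\<in>UNIV. f x $ i * cnj (g x $ i))"
proof (rule Bochner_Integration.integrable_bound)
  show "integrable lborel (\<lambda>x. real CARD('k) * (norm (f x) * norm (g x)))"
    by (intro integrable_mult_right sq_int_integrable_mult f g)
  have [measurable]: "f \<in> borel_measurable borel" "g \<in> borel_measurable borel"
    using f g by (auto simp: sq_int_def)
  show "(\<lambda>x. \<Sum>i\<in>UNIV. f x $ i * cnj (g x $ i)) \<in> borel_measurable lborel" by measurable
qed (use norm_cinner_le in auto)

lemma inner_L2_tendsto:
  fixes f g :: "real^'n::finite \<Rightarrow> complex^'k::finite"
  assumes f: "sq_int f" and g: "sq_int g" and \<phi>: "\<And>k::nat. sq_int (\<phi> k)"
    and l: "(\<lambda>k. LINT x|lborel. (norm (\<phi> k x - f x))\<^sup>2) \<longlonglongrightarrow> 0"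
  shows "(\<lambda>k. inner_L2 (\<phi> k) g) \<longlonglongrightarrow> inner_L2 f g"
proof (rule LIM_zero_cancel, rule Lim_null_comparison)
  show "(\<lambda>k. real CARD('k) * (LINT x|lborel. norm (g x) * norm (\<phi> k x - f x))) \<longlonglongrightarrow> 0"
    using sq_int_mult_tendsto_0[OF g sq_int_diff[OF \<phi> f] l] by (auto intro!: tendsto_eq_intros)
  have "norm (inner_L2 (\<phi> k) g - inner_L2 f g) \<le> real CARD('k) * (LINT x|lborel. norm (g x) * norm (\<phi> k x
      - f x))" for k
  proof -
    have "inner_L2 (\<phi> k) g - inner_L2 f g = (LINT x|lborel. (\<Sum>i\<in>UNIV. (\<phi> k x - f x) $ i * cnj (g x $ i)))"
      unfolding inner_L2_def Bochner_Integration.integral_diff[OF integrable_cinner[OF \<phi> g]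
          integrable_cinner[OF f g], symmetric]
      by (simp add: sum_subtractf[symmetric] left_diff_distrib)
    also have "norm \<dots> \<le> (LINT x|lborel. norm (\<Sum>i\<in>UNIV. (\<phi> k x - f x) $ i * cnj (g x $ i)))"
      by (rule integral_norm_bound)
    also have "\<dots> \<le> (LINT x|lborel. real CARD('k) * (norm (g x) * norm (\<phi> k x - f x)))"
      by (intro integral_mono integrable_norm integrable_cinner integrable_mult_right
          sq_int_integrable_mult sq_int_diff \<phi> f g)
         (metis norm_cinner_le mult.commute)
    finally show ?thesis by simp
  qed
  then show "\<forall>\<^sub>F k in sequentially. norm (inner_L2 (\<phi> k) g - inner_L2 f g) \<le> real CARD('k) * (LINT
      x|lborel. norm (g x) * norm (\<phi> k x - f x))"
    by simp
qed

lemma cnj_ft_minus: "cnj (ft w (- x)) = ft (\<lambda>y. cnj (w y)) x"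
proof -
  have "cnj (exp (- \<i> * complex_of_real (- x \<bullet> y))) = exp (- \<i> * complex_of_real (x \<bullet> y))" for y
    by (simp add: exp_cnj)
  then show ?thesis
    unfolding ft_def Bochner_Integration.integral_cnj[symmetric] complex_cnj_mult by simp
qed

lemma inner_L2_FT1:
  fixes f g :: "real^'n::finite \<Rightarrow> complex^'k::finite"
  assumes fi: "integrable lborel f" and f: "sq_int f" and wi: "integrable lborel w" and w: "sq_int w"
  shows "inner_L2 f (\<lambda>x. FT1 w (- x)) = inner_L2 (FT1 f) w"
proof -
  let ?c = "complex_of_real ((2 * pi) powr (- real CARD('n) / 2))"
  have v: "sq_int (\<lambda>x. FT1 w (- x))" using sq_int_lborel_diff(2)[OF plancherel_FT1(1)[OF wi w], of 0] by simp
  have s: "integrable lborel (\<lambda>x. a x $ i * cnj (b x $ i))" if "sq_int a" "sq_int b" for a b :: "real^'n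
      \<Rightarrow> complex^'k" and i
  proof (rule Bochner_Integration.integrable_bound[OF sq_int_integrable_mult[OF sq_int_vec_nth[OF
      that(1)] sq_int_vec_nth[OF that(2)]]])
    have [measurable]: "a \<in> borel_measurable borel" "b \<in> borel_measurable borel"
      using that by (auto simp: sq_int_def)
    show "(\<lambda>x. a x $ i * cnj (b x $ i)) \<in> borel_measurable lborel" by measurable
  qed (auto simp: norm_mult)
  have "inner_L2 f (\<lambda>x. FT1 w (- x)) = (\<Sum>i\<in>UNIV. (LINT x|lborel. f x $ i * cnj (FT1 w (- x) $ i)))"
    unfolding inner_L2_def by (rule Bochner_Integration.integral_sum) (rule s[OF f v])
  also have "\<dots> = (\<Sum>i\<in>UNIV. (LINT x|lborel. FT1 f x $ i * cnj (w x $ i)))"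
  proof (rule sum.cong[OF refl])
    fix i
    have iw: "integrable lborel (\<lambda>y. cnj (w y $ i))" using integrable_vec_nth[OF wi] by simp
    have "(LINT x|lborel. f x $ i * cnj (FT1 w (- x) $ i)) = (LINT x|lborel. ?c * (f x $ i * ft (\<lambda>y. cnj
        (w y $ i)) x))"
      by (simp add: FT1_nth cnj_ft_minus mult_ac)
    also have "\<dots> = ?c * (LINT x|lborel. f x $ i * ft (\<lambda>y. cnj (w y $ i)) x)" by (rule
        integral_mult_right_zero)
    also have "\<dots> = ?c * (LINT x|lborel. ft (\<lambda>y. f y $ i) x * cnj (w x $ i))"
      by (simp only: integral_ft_mult[OF integrable_vec_nth[OF fi] iw])
    also have "\<dots> = (LINT x|lborel. FT1 f x $ i * cnj (w x $ i))"
      unfolding FT1_nth mult.assoc by (rule integral_mult_right_zero[symmetric])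
    finally show "(LINT x|lborel. f x $ i * cnj (FT1 w (- x) $ i)) = (LINT x|lborel. FT1 f x $ i * cnj (w
        x $ i))" .
  qed
  also have "\<dots> = inner_L2 (FT1 f) w"
    unfolding inner_L2_def by (rule Bochner_Integration.integral_sum[symmetric]) (rule s[OF
        plancherel_FT1(1)[OF fi f] w])
  finally show ?thesis .
qed

text \<open>Only pairings with inverse transforms of integrable w are treated; this lets an
  orthogonality relation in physical space be tested against functions prescribed on the Fourier
  side.\<close>

lemma parseval_fourier_rel:
  fixes f g :: "real^'n::finite \<Rightarrow> complex^'k::finite"
  assumes fg: "fourier_rel f g" and wi: "integrable lborel w" and w: "sq_int w"
  shows "inner_L2 f (\<lambda>x. FT1 w (- x)) = inner_L2 g w"
proof -
  obtain \<phi> where *: "sq_int f" "sq_int g" "\<And>k::nat. integrable lborel (\<phi> k)" "\<And>k. sq_int (\<phi> k)"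
    "(\<lambda>k. LINT x|lborel. (norm (\<phi> k x - f x))\<^sup>2) \<longlonglongrightarrow> 0"
    "(\<lambda>k. LINT x|lborel. (norm (FT1 (\<phi> k) x - g x))\<^sup>2) \<longlonglongrightarrow> 0"
    using fourier_relE[OF fg] by blast
  have v: "sq_int (\<lambda>x. FT1 w (- x))" using sq_int_lborel_diff(2)[OF plancherel_FT1(1)[OF wi w], of 0] by simp
  have "(\<lambda>k. inner_L2 (\<phi> k) (\<lambda>x. FT1 w (- x))) \<longlonglongrightarrow> inner_L2 f (\<lambda>x. FT1 w (- x))"
    by (rule inner_L2_tendsto[OF *(1) v *(4,5)])
  moreover have "(\<lambda>k. inner_L2 (FT1 (\<phi> k)) w) \<longlonglongrightarrow> inner_L2 g w"
    by (rule inner_L2_tendsto[OF *(2) w plancherel_FT1(1)[OF *(3,4)] *(6)])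
  ultimately show ?thesis
    unfolding inner_L2_FT1[OF *(3,4) wi w] by (rule LIMSEQ_unique)
qed

section \<open>Spectral decomposition of the symbol\<close>

text \<open>The basis is orthonormal for the real inner product, so that complex vectors are handled
  as vectors of twice the dimension: Hermitian matrices are self-adjoint for it as well, and each
  complex eigenspace contributes twice its dimension. The eigenvalue at b is recorded as
  \<open>T b \<bullet> b\<close>, which avoids a separate labelling.\<close>

definition eigbasis :: "('a::euclidean_space \<Rightarrow> 'a) \<Rightarrow> 'a set \<Rightarrow> bool" where
  "eigbasis T B \<longleftrightarrow> finite B \<and> pairwise orthogonal B \<and> (\<forall>b\<in>B. norm b = 1 \<and> T b = (T b \<bullet> b) *\<^sub>R b) \<and> span B
      = UNIV"

text \<open>A maximizer of the quadratic form on the unit sphere of W is an eigenvector. The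
  residual \<open>r\<close> stays in W by invariance, and varying the maximizer along it forces it
  to vanish.\<close>

lemma selfadjoint_eigenvector:
  fixes T :: "'a::euclidean_space \<Rightarrow> 'a"
  assumes T: "linear T" and sa: "\<And>x y. T x \<bullet> y = x \<bullet> T y"
    and W: "subspace W" "\<And>x. x \<in> W \<Longrightarrow> T x \<in> W" and w: "w \<in> W" "w \<noteq> 0"
  shows "\<exists>v\<in>W. norm v = 1 \<and> T v = (T v \<bullet> v) *\<^sub>R v"
proof -
  have cT: "continuous_on S T" for S using T by (simp add: linear_continuous_on linear_conv_bounded_linear)
  have "compact (sphere 0 1 \<inter> W)" by (intro compact_Int_closed closed_subspace W) simp
  moreover have "w /\<^sub>R norm w \<in> sphere 0 1 \<inter> W" using w W by (auto simp: subspace_scale)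
  moreover have "continuous_on (sphere 0 1 \<inter> W) (\<lambda>x. T x \<bullet> x)" by (intro continuous_intros cT)
  ultimately obtain v where v: "v \<in> sphere 0 1 \<inter> W" and max: "\<And>x. x \<in> sphere 0 1 \<inter> W \<Longrightarrow> T x \<bullet> x \<le> T v \<bullet> v"
    using continuous_attains_sup[of "sphere 0 1 \<inter> W" "\<lambda>x. T x \<bullet> x"] by blast
  define \<mu> where "\<mu> = T v \<bullet> v"
  have le: "T x \<bullet> x \<le> \<mu> * (x \<bullet> x)" if "x \<in> W" for x
  proof (cases "x = 0")
    case False
    then have "T (x /\<^sub>R norm x) \<bullet> (x /\<^sub>R norm x) \<le> \<mu>" unfolding \<mu>_def using that W
      by (intro max) (auto simp: subspace_scale)
    then show ?thesis using False T
      by (simp add: linear_scale divide_simps dot_square_norm power2_eq_square)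
  qed (use T linear_0 in auto)
  define r where "r = T v - \<mu> *\<^sub>R v"
  have vW: "v \<in> W" "v \<bullet> v = 1" using v by (auto simp: dot_square_norm)
  have rW: "r \<in> W" unfolding r_def using vW W by (intro subspace_diff subspace_scale) auto
  define c where "c = \<mu> * (r \<bullet> r) - T r \<bullet> r"
  \<comment> \<open>Maximality at v + t r: the constant terms cancel and the linear term is 2 t (r
    \<bullet> r), as T v = r + \<mu> v. A linear lower bound by a quadratic for all t is possible
    only if r = 0; the values t = 1 and t = (r \<bullet> r)/c refute the alternatives according to
    the sign of \<open>c\<close>.\<close>
  have key: "2 * t * (r \<bullet> r) \<le> t\<^sup>2 * c" for t
  proof -
    have I: "T (v + t *\<^sub>R r) \<bullet> (v + t *\<^sub>R r) \<le> \<mu> * ((v + t *\<^sub>R r) \<bullet> (v + t *\<^sub>R r))"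
      using vW rW W by (intro le subspace_add subspace_scale) auto
    have e1: "T (v + t *\<^sub>R r) \<bullet> (v + t *\<^sub>R r) = \<mu> + 2 * t * (T v \<bullet> r) + t\<^sup>2 * (T r \<bullet> r)"
      using T sa[of r v] by (simp add: linear_add linear_scale inner_simps \<mu>_def power2_eq_square
          algebra_simps inner_commute)
    have e2: "(v + t *\<^sub>R r) \<bullet> (v + t *\<^sub>R r) = 1 + 2 * t * (v \<bullet> r) + t\<^sup>2 * (r \<bullet> r)"
      using vW by (simp add: inner_simps power2_eq_square algebra_simps inner_commute)
    have "T v = r + \<mu> *\<^sub>R v" by (simp add: r_def)
    then have e3: "T v \<bullet> r = r \<bullet> r + \<mu> * (v \<bullet> r)" by (metis inner_add_left inner_scaleR_left)
    show ?thesis using I unfolding e1 e2 e3 by (simp add: c_def algebra_simps)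
  qed
  have "r \<bullet> r = 0"
  proof (cases "c \<le> 0")
    case True
    moreover have "2 * (r \<bullet> r) \<le> c" using key[of 1] by simp
    ultimately show ?thesis using inner_ge_zero[of r] by linarith
  next
    case False
    have "2 * (r \<bullet> r / c) * (r \<bullet> r) \<le> (r \<bullet> r / c)\<^sup>2 * c" by (rule key)
    then have "2 * ((r \<bullet> r) * (r \<bullet> r)) \<le> (r \<bullet> r) * (r \<bullet> r)"
      using False by (simp add: divide_simps power2_eq_square)
    then have "r \<bullet> r \<le> 0" by (simp add: mult_le_0_iff)
    then show ?thesis using inner_ge_zero[of r] by linarith
  qed
  then have "T v = \<mu> *\<^sub>R v" by (simp add: r_def)
  moreover have "norm v = 1" using v by simp
  ultimately show ?thesis using vW(1) unfolding \<mu>_def by blast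
qed

text \<open>Eigenvectors are collected one at a time: the orthogonal complement of those already
  found is invariant by self-adjointness and nonzero as long as their number is below the
  dimension.\<close>

lemma eigbasis_exists:
  fixes T :: "'a::euclidean_space \<Rightarrow> 'a"
  assumes T: "linear T" and sa: "\<And>x y. T x \<bullet> y = x \<bullet> T y"
  shows "\<exists>B. eigbasis T B"
proof -
  have "\<exists>B. finite B \<and> card B = n \<and> pairwise orthogonal B \<and> (\<forall>b\<in>B. norm b = 1 \<and> T b = (T b \<bullet> b) *\<^sub>R b)"
    if "n \<le> DIM('a)" for n
    using that
  proof (induction n)
    case 0
    show ?case by (intro exI[of _ "{}"]) auto
  next
    case (Suc n)
    then obtain B where B: "finite B" "card B = n" "pairwise orthogonal B"
      "\<And>b. b \<in> B \<Longrightarrow> norm b = 1" "\<And>b. b \<in> B \<Longrightarrow> T b = (T b \<bullet> b) *\<^sub>R b"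
      using Suc_leD by blast
    define W where "W = {x. \<forall>b\<in>B. x \<bullet> b = 0}"
    have "dim B < DIM('a)" using B(1,2) Suc.prems dim_le_card'[OF B(1)] by simp
    then obtain w where "w \<noteq> 0" "\<And>y. y \<in> span B \<Longrightarrow> orthogonal w y"
      using orthogonal_to_subspace_exists by blast
    then have w: "w \<in> W" "w \<noteq> 0" unfolding W_def by (auto simp: orthogonal_def span_base)
    have "subspace W" unfolding W_def subspace_def by (auto simp: inner_simps)
    moreover have "T x \<in> W" if "x \<in> W" for x
    proof -
      have "T x \<bullet> b = 0" if "b \<in> B" for b
      proof -
        have "T x \<bullet> b = x \<bullet> ((T b \<bullet> b) *\<^sub>R b)" using B(5)[OF that] sa by metis
        then show ?thesis using \<open>x \<in> W\<close> that by (simp add: W_def)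
      qed
      then show ?thesis by (simp add: W_def)
    qed
    ultimately obtain v where v: "v \<in> W" "norm v = 1" "T v = (T v \<bullet> v) *\<^sub>R v"
      using selfadjoint_eigenvector[OF T sa _ _ w] by blast
    have "v \<notin> B" using v(1,2) unfolding W_def by (auto simp: dot_square_norm)
    show ?case
    proof (intro exI[of _ "insert v B"] conjI)
      show "pairwise orthogonal (insert v B)"
        using B(3) v(1) by (auto simp: pairwise_insert orthogonal_def W_def inner_commute)
      show "\<forall>b\<in>insert v B. norm b = 1 \<and> T b = (T b \<bullet> b) *\<^sub>R b" using B(4,5) v(2,3) by blast
    qed (use B(1,2) \<open>v \<notin> B\<close> in auto)
  qed
  from this[OF order_refl] obtain B where B: "finite B" "card B = DIM('a)" "pairwise orthogonal B"
      "\<forall>b\<in>B. norm b = 1 \<and> T b = (T b \<bullet> b) *\<^sub>R b" by blast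
  have "0 \<notin> B" using B(4) by (metis norm_zero zero_neq_one)
  then have "independent B" using B(3) by (rule pairwise_orthogonal_independent[rotated])
  then have "dim B = DIM('a)" using B(2) by (simp add: dim_eq_card_independent)
  then have "span B = UNIV" by (simp add: dim_eq_full)
  then show ?thesis using B unfolding eigbasis_def by blast
qed

context
  fixes T :: "'a::euclidean_space \<Rightarrow> 'a" and B assumes B: "eigbasis T B"
begin

lemma eigbasis_finite: "finite B" and eigbasis_norm: "b \<in> B \<Longrightarrow> norm b = 1"
  and eigbasis_eigen: "b \<in> B \<Longrightarrow> T b = (T b \<bullet> b) *\<^sub>R b"
  and eigbasis_orthogonal: "pairwise orthogonal B" and eigbasis_span: "span B = UNIV"
  using B unfolding eigbasis_def by blast+

lemma eigbasis_inner: "b \<in> B \<Longrightarrow> c \<in> B \<Longrightarrow> b \<bullet> c = (if b = c then 1 else 0)"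
  using eigbasis_orthogonal eigbasis_norm by (auto simp: pairwise_def orthogonal_def dot_square_norm)

lemma eigbasis_expand: "(\<Sum>b\<in>B. (x \<bullet> b) *\<^sub>R b) = x"
proof -
  define y where "y = x - (\<Sum>b\<in>B. (x \<bullet> b) *\<^sub>R b)"
  have y0: "y \<bullet> c = 0" if "c \<in> B" for c
  proof -
    have "(\<Sum>b\<in>B. (x \<bullet> b) *\<^sub>R b) \<bullet> c = (\<Sum>b\<in>B. if b = c then x \<bullet> b else 0)"
      unfolding inner_sum_left by (intro sum.cong refl) (simp add: eigbasis_inner that)
    also have "\<dots> = x \<bullet> c" using that eigbasis_finite by simp
    finally show ?thesis by (simp add: y_def inner_diff_left)
  qed
  have "y \<in> span B" using eigbasis_span by simp
  then have "orthogonal y y" by (rule orthogonal_to_span) (simp add: orthogonal_def y0)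
  then show ?thesis by (simp add: y_def orthogonal_def)
qed

lemma eigbasis_sum_squares: "(\<Sum>b\<in>B. (x \<bullet> b)\<^sup>2) = (norm x)\<^sup>2"
proof -
  have "(norm x)\<^sup>2 = x \<bullet> (\<Sum>b\<in>B. (x \<bullet> b) *\<^sub>R b)" by (simp add: eigbasis_expand power2_norm_eq_inner)
  then show ?thesis by (simp add: inner_sum_right power2_eq_square)
qed

lemma eigbasis_card: "card B = DIM('a)"
proof -
  have "0 \<notin> B" using eigbasis_norm by force
  with eigbasis_orthogonal have "independent B" by (rule pairwise_orthogonal_independent)
  then show ?thesis using eigbasis_span by (metis dim_eq_card_independent dim_eq_full)
qed

lemma eigbasis_funpow:
  assumes T: "linear T"
  shows "(T ^^ m) x = (\<Sum>b\<in>B. ((T b \<bullet> b) ^ m * (x \<bullet> b)) *\<^sub>R b)"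
proof (induction m)
  case 0
  show ?case by (simp add: eigbasis_expand)
next
  case (Suc m)
  have "(T ^^ Suc m) x = (\<Sum>b\<in>B. ((T b \<bullet> b) ^ m * (x \<bullet> b)) *\<^sub>R T b)"
    using Suc T by (simp add: linear_sum linear_scale)
  also have "\<dots> = (\<Sum>b\<in>B. ((T b \<bullet> b) ^ m * (x \<bullet> b)) *\<^sub>R ((T b \<bullet> b) *\<^sub>R b))"
    using eigbasis_eigen by (intro sum.cong refl) metis
  finally show ?case by (simp only: scaleR_scaleR power_Suc mult_ac)
qed

end

section \<open>The symbol as a self-adjoint map and its functional calculus\<close>

lemma matrix_vector_mult_adjoint:
  fixes A :: "complex^'k^'k::finite"
  assumes A: "hermitian_mat A"
  shows "(A *v x) \<bullet> y = x \<bullet> (A *v y)"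
proof -
  have c: "z \<bullet> w = Re (z * cnj w)" for z w :: complex by (simp add: inner_complex_def)
  have "(A *v x) \<bullet> y = Re (\<Sum>i\<in>UNIV. \<Sum>j\<in>UNIV. A $ i $ j * x $ j * cnj (y $ i))"
    by (simp add: inner_vec_def c matrix_vector_mult_def sum_distrib_right)
  also have "(\<Sum>i\<in>UNIV. \<Sum>j\<in>UNIV. A $ i $ j * x $ j * cnj (y $ i)) = (\<Sum>j\<in>UNIV. \<Sum>i\<in>UNIV. A $ i $ j * x $ j *
      cnj (y $ i))"
    by (rule sum.swap)
  also have "\<dots> = (\<Sum>j\<in>UNIV. \<Sum>i\<in>UNIV. x $ j * (cnj (A $ j $ i) * cnj (y $ i)))"
  proof (intro sum.cong refl)
    fix i j
    have "A $ i $ j = cnj (A $ j $ i)" using A unfolding hermitian_mat_def by blast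
    then show "A $ i $ j * x $ j * cnj (y $ i) = x $ j * (cnj (A $ j $ i) * cnj (y $ i))" by simp
  qed
  also have "Re \<dots> = x \<bullet> (A *v y)"
    by (simp add: inner_vec_def c matrix_vector_mult_def sum_distrib_left)
  finally show ?thesis .
qed

lemma bilinear_Mhom: "bilinear (\<lambda>\<xi> v. Mhom M \<xi> *v v)"
  unfolding bilinear_def
proof (intro conjI allI linearI)
qed (auto simp: vec_eq_iff Mhom_def matrix_vector_mult_def algebra_simps sum.distrib sum_distrib_left
    scaleR_conv_of_real[of _ "_::complex"])

lemma linear_Mhom: "linear (\<lambda>v. Mhom M \<xi> *v v)"
  using bilinear_Mhom unfolding bilinear_def by blast

lemma Mhom_scaleR: "Mhom M (r *\<^sub>R \<xi>) *v v = r *\<^sub>R (Mhom M \<xi> *v v)"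
  using bilinear_lmul[OF bilinear_Mhom] by metis

lemma hermitian_Mhom: "\<forall>j. hermitian_mat (M j) \<Longrightarrow> hermitian_mat (Mhom M \<xi>)"
  unfolding hermitian_mat_def
proof (intro allI)
  fix a b assume h: "\<forall>j a b. M j $ a $ b = cnj (M j $ b $ a)"
  have "complex_of_real (\<xi> $ j) * M j $ a $ b = cnj (complex_of_real (\<xi> $ j) * M j $ b $ a)" for j
    using h by (metis complex_cnj_complex_of_real complex_cnj_mult)
  then show "Mhom M \<xi> $ a $ b = cnj (Mhom M \<xi> $ b $ a)"
    by (simp only: Mhom_def vec_lambda_beta cnj_sum)
qed

lemma Mhom_adjoint:
  assumes "\<forall>j. hermitian_mat (M j)"
  shows "(Mhom M \<xi> *v x) \<bullet> y = x \<bullet> (Mhom M \<xi> *v y)"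
  by (rule matrix_vector_mult_adjoint[OF hermitian_Mhom[OF assms]])

lemma borel_measurable_Mhom[measurable (raw)]:
  assumes [measurable]: "\<xi> \<in> borel_measurable N" "w \<in> borel_measurable N"
  shows "(\<lambda>x. Mhom M (\<xi> x) *v w x) \<in> borel_measurable N"
  unfolding borel_measurable_vec_iff Mhom_def matrix_vector_mult_def by simp

lemma borel_measurable_Mhom_funpow[measurable (raw)]:
  assumes [measurable]: "\<xi> \<in> borel_measurable N" "w \<in> borel_measurable N"
  shows "(\<lambda>x. ((\<lambda>v. Mhom M (\<xi> x) *v v) ^^ m) (w x)) \<in> borel_measurable N"
proof (induction m)
  case (Suc m)
  note Suc[measurable]
  show ?case by simp
qed simp

text \<open>The k-th polynomial is within 1/(k + 1) of q on [-k, k]. Pointwise convergence on the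
  whole line is enough, because each matrix has only finitely many eigenvalues.\<close>

lemma continuous_poly_approx:
  fixes q :: "real \<Rightarrow> real"
  assumes q: "continuous_on UNIV q"
  shows "\<exists>a n. \<forall>x. (\<lambda>k. \<Sum>i\<le>n k. a k i * x ^ i) \<longlonglongrightarrow> q x"
proof -
  have "\<exists>a n. \<forall>x\<in>cball 0 (real k). \<bar>q x - (\<Sum>i\<le>n. a i * x ^ i)\<bar> < 1 / real (Suc k)" for k
  proof -
    have "continuous_on (cball 0 (real k)) q" by (rule continuous_on_subset[OF q]) simp
    from Stone_Weierstrass_polynomial_function[OF compact_cball this, of "1 / real (Suc k)"]
    obtain g where g: "polynomial_function g" "\<And>x. x \<in> cball 0 (real k) \<Longrightarrow> norm (q x - g x) < 1 / real (Suc k)"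
      by auto
    then have "real_polynomial_function g" by (simp add: real_polynomial_function_eq)
    then obtain a n where "g = (\<lambda>x. \<Sum>i\<le>n. a i * x ^ i)" unfolding real_polynomial_function_iff_sum by blast
    then show ?thesis using g(2) by (intro exI[of _ a] exI[of _ n]) auto
  qed
  then obtain a n where an: "\<And>k x. x \<in> cball 0 (real k) \<Longrightarrow> \<bar>q x - (\<Sum>i\<le>n k. a k i * x ^ i)\<bar> < 1 / real (Suc
      k)" by metis
  have "(\<lambda>k. \<Sum>i\<le>n k. a k i * x ^ i) \<longlonglongrightarrow> q x" for x
  proof (rule LIM_zero_cancel, rule Lim_null_comparison)
    show "(\<lambda>k. 1 / real (Suc k)) \<longlonglongrightarrow> 0" using LIMSEQ_inverse_real_of_nat by (simp add: inverse_eq_divide)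
    obtain N where "\<bar>x\<bar> \<le> real N" using real_arch_simple by blast
    then have "x \<in> cball 0 (real k)" if "k \<ge> N" for k using that by auto
    then show "\<forall>\<^sub>F k in sequentially. norm ((\<Sum>i\<le>n k. a k i * x ^ i) - q x) \<le> 1 / real (Suc k)"
      using an by (intro eventually_sequentiallyI[of N]) (auto simp: abs_minus_commute less_imp_le)
  qed
  then show ?thesis by blast
qed

text \<open>Choosing the eigenbasis at \<open>sgn \<xi>\<close> makes it constant along rays.\<close>
definition EB :: "('n::finite \<Rightarrow> complex^'k^'k::finite) \<Rightarrow> real^'n \<Rightarrow> (complex^'k) set" where
  "EB M \<xi> = (SOME B. eigbasis (\<lambda>v. Mhom M (sgn \<xi>) *v v) B)"

definition lam :: "('n::finite \<Rightarrow> complex^'k^'k::finite) \<Rightarrow> real^'n \<Rightarrow> complex^'k \<Rightarrow> real" where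
  "lam M \<xi> b = (Mhom M \<xi> *v b) \<bullet> b"

lemma EB_scaleR: "0 < r \<Longrightarrow> EB M (r *\<^sub>R \<xi>) = EB M \<xi>"
  by (simp add: EB_def sgn_scaleR)

lemma lam_scaleR: "lam M (r *\<^sub>R \<xi>) b = r * lam M \<xi> b"
  by (simp add: lam_def Mhom_scaleR)

lemma norm_scaleR_sgn: "norm x *\<^sub>R sgn x = (x::'a::real_normed_vector)"
  by (cases "x = 0") (simp_all add: sgn_div_norm)

text \<open>This is q(M(\<xi>)) w. As an operator it does not depend on the basis, which is what
  makes measurability in \<xi> possible although \<open>EB\<close> is an arbitrary choice.\<close>

definition fcalc :: "('n::finite \<Rightarrow> complex^'k^'k::finite) \<Rightarrow> (real \<Rightarrow> real) \<Rightarrow> real^'n \<Rightarrow> complex^'k \<Rightarrow>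
    complex^'k" where
  "fcalc M q \<xi> w = (\<Sum>b\<in>EB M \<xi>. (q (lam M \<xi> b) * (w \<bullet> b)) *\<^sub>R b)"

text \<open>By homogeneity the symbol at \<xi> is |\<xi>| times the symbol at
  \<open>sgn \<xi>\<close>, so the chosen basis diagonalizes both; this includes \<xi> = 0.\<close>

lemma eigbasis_EB:
  assumes h: "\<forall>j. hermitian_mat (M j)"
  shows "eigbasis (\<lambda>v. Mhom M \<xi> *v v) (EB M \<xi>)"
proof -
  have *: "eigbasis (\<lambda>v. Mhom M (sgn \<xi>) *v v) (EB M \<xi>)"
    unfolding EB_def by (rule someI_ex) (rule eigbasis_exists[OF linear_Mhom Mhom_adjoint[OF h]])
  have e: "Mhom M \<xi> *v b = norm \<xi> *\<^sub>R (Mhom M (sgn \<xi>) *v b)" for b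
    by (metis Mhom_scaleR norm_scaleR_sgn)
  have "Mhom M \<xi> *v b = ((Mhom M \<xi> *v b) \<bullet> b) *\<^sub>R b" if "b \<in> EB M \<xi>" for b
  proof -
    have "Mhom M \<xi> *v b = norm \<xi> *\<^sub>R (((Mhom M (sgn \<xi>) *v b) \<bullet> b) *\<^sub>R b)"
      unfolding e using eigbasis_eigen[OF * that] by metis
    also have "\<dots> = ((Mhom M \<xi> *v b) \<bullet> b) *\<^sub>R b" unfolding e by simp
    finally show ?thesis .
  qed
  then show ?thesis using * unfolding eigbasis_def by blast
qed

context
  fixes M :: "'n::finite \<Rightarrow> complex^'k^'k::finite"
  assumes h: "\<forall>j. hermitian_mat (M j)"
begin

lemmas EB_finite = eigbasis_finite[OF eigbasis_EB[OF h]]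
  and EB_norm = eigbasis_norm[OF eigbasis_EB[OF h]]
  and EB_inner = eigbasis_inner[OF eigbasis_EB[OF h]]
  and EB_sum_squares = eigbasis_sum_squares[OF eigbasis_EB[OF h]]
  and EB_card = eigbasis_card[OF eigbasis_EB[OF h]]

lemma EB_eigen: "b \<in> EB M \<xi> \<Longrightarrow> Mhom M \<xi> *v b = lam M \<xi> b *\<^sub>R b"
  unfolding lam_def by (rule eigbasis_eigen[OF eigbasis_EB[OF h]])

lemma EB_funpow: "((\<lambda>v. Mhom M \<xi> *v v) ^^ m) x = fcalc M (\<lambda>t. t ^ m) \<xi> x"
  unfolding fcalc_def lam_def by (rule eigbasis_funpow[OF eigbasis_EB[OF h] linear_Mhom])

lemma borel_measurable_fcalc_limit:
  assumes lim: "\<And>x. (\<lambda>k. p k x) \<longlonglongrightarrow> q x"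
    and m: "\<And>k::nat. (\<lambda>x. fcalc M (p k) (\<xi> x) (w x)) \<in> borel_measurable N"
  shows "(\<lambda>x. fcalc M q (\<xi> x) (w x)) \<in> borel_measurable N"
  by (rule borel_measurable_LIMSEQ_metric[OF m]) (auto simp: fcalc_def intro!: tendsto_intros lim)

text \<open>For a polynomial q the sum over the basis is a polynomial in the matrix applied to w,
  hence measurable; a continuous q is reached by a pointwise limit.\<close>

lemma borel_measurable_fcalc:
  assumes q: "continuous_on UNIV q"
    and [measurable]: "\<xi> \<in> borel_measurable N" "w \<in> borel_measurable N"
  shows "(\<lambda>x. fcalc M q (\<xi> x) (w x)) \<in> borel_measurable N"
proof -
  obtain a n where an: "\<And>x. (\<lambda>k::nat. \<Sum>i\<le>n k. a k i * x ^ i) \<longlonglongrightarrow> q x"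
    using continuous_poly_approx[OF q] by blast
  have "fcalc M (\<lambda>x. \<Sum>i\<le>n k. a k i * x ^ i) \<xi> w = (\<Sum>i\<le>n k. a k i *\<^sub>R ((\<lambda>v. Mhom M \<xi> *v v) ^^ i) w)" for k \<xi> w
    unfolding EB_funpow fcalc_def scaleR_sum_right
    by (subst sum.swap) (simp add: sum_distrib_right scaleR_left.sum mult.assoc)
  then show ?thesis
    by (intro borel_measurable_fcalc_limit[OF an]) simp
qed

text \<open>The indicator of 0 is discontinuous, but it is the limit of the powers of
  exp(-t^2).\<close>

lemma borel_measurable_fcalc_0:
  assumes [measurable]: "\<xi> \<in> borel_measurable N" "w \<in> borel_measurable N"
  shows "(\<lambda>x. fcalc M (\<lambda>t. if t = 0 then 1 else 0) (\<xi> x) (w x)) \<in> borel_measurable N"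
proof (rule borel_measurable_fcalc_limit)
  show "(\<lambda>k. exp (- t\<^sup>2) ^ k) \<longlonglongrightarrow> (if t = 0 then 1 else 0)" for t :: real
    by (auto intro!: LIMSEQ_realpow_zero)
  show "(\<lambda>x. fcalc M (\<lambda>t. exp (- t\<^sup>2) ^ k) (\<xi> x) (w x)) \<in> borel_measurable N" for k
    by (intro borel_measurable_fcalc continuous_intros) auto
qed

lemma borel_measurable_fcalc_nz:
  assumes q: "continuous_on UNIV q"
    and [measurable]: "\<xi> \<in> borel_measurable N" "w \<in> borel_measurable N"
  shows "(\<lambda>x. fcalc M (\<lambda>t. if t = 0 then 0 else q t) (\<xi> x) (w x)) \<in> borel_measurable N"
proof (rule borel_measurable_fcalc_limit)
  have "(\<lambda>k. q t * (1 - exp (- t\<^sup>2) ^ k)) \<longlonglongrightarrow> q t * (1 - 0)" if "t \<noteq> 0" for t :: real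
    using that by (intro tendsto_intros LIMSEQ_realpow_zero) auto
  then show "(\<lambda>k. q t * (1 - exp (- t\<^sup>2) ^ k)) \<longlonglongrightarrow> (if t = 0 then 0 else q t)" for t :: real
    by auto
  show "(\<lambda>x. fcalc M (\<lambda>t. q t * (1 - exp (- t\<^sup>2) ^ k)) (\<xi> x) (w x)) \<in> borel_measurable N" for k
    by (intro borel_measurable_fcalc continuous_intros q) auto
qed

lemma fcalc_inner: "fcalc M q \<xi> w \<bullet> z = (\<Sum>b\<in>EB M \<xi>. q (lam M \<xi> b) * (w \<bullet> b) * (z \<bullet> b))"
  unfolding fcalc_def inner_sum_left by (simp add: inner_commute)

text \<open>A trace over the standard basis expresses a sum over eigenvalues alone. Through it such
  sums inherit measurability from the functional calculus.\<close>

lemma fcalc_trace: "(\<Sum>e\<in>Basis. fcalc M q \<xi> e \<bullet> e) = (\<Sum>b\<in>EB M \<xi>. q (lam M \<xi> b))"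
proof -
  have s: "(\<Sum>e\<in>Basis. (e \<bullet> b)\<^sup>2) = (norm b)\<^sup>2" for b :: "complex^'k"
    unfolding power2_norm_eq_inner using euclidean_inner[of b b] by (simp add: power2_eq_square inner_commute)
  have "(\<Sum>e\<in>Basis. fcalc M q \<xi> e \<bullet> e) = (\<Sum>b\<in>EB M \<xi>. \<Sum>e\<in>Basis. q (lam M \<xi> b) * (e \<bullet> b)\<^sup>2)"
    unfolding fcalc_inner by (subst sum.swap) (simp add: power2_eq_square mult.assoc)
  also have "\<dots> = (\<Sum>b\<in>EB M \<xi>. q (lam M \<xi> b) * (norm b)\<^sup>2)"
    unfolding sum_distrib_left[symmetric] s ..
  also have "\<dots> = (\<Sum>b\<in>EB M \<xi>. q (lam M \<xi> b))"
    by (intro sum.cong refl) (simp add: EB_norm)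
  finally show ?thesis .
qed

text \<open>Powers of the matrix act on the real basis by real eigenvalues; the coefficients of the
  series are complex and sum to a phase. The phase multiplies b as a complex scalar, so the result
  is not a real combination of the basis.\<close>

lemma expM_EB:
  "expM t (Mhom M \<xi>) w = (\<Sum>b\<in>EB M \<xi>. (w \<bullet> b) *\<^sub>R (exp (- \<i> * complex_of_real (t * lam M \<xi> b)) *s b))"
proof -
  let ?c = "\<lambda>m. (- \<i> * complex_of_real t) ^ m / fact m"
  have s1: "(\<lambda>m. (?c m * complex_of_real (l ^ m)) *s b) sums (exp (- \<i> * complex_of_real (t * l)) *s b)"
      for l and b :: "complex^'k"
  proof -
    have "(\<lambda>m. (- \<i> * complex_of_real (t * l)) ^ m /\<^sub>R fact m) sums exp (- \<i> * complex_of_real (t * l))"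
      by (rule exp_converges)
    moreover have "(- \<i> * complex_of_real (t * l)) ^ m /\<^sub>R fact m = ?c m * complex_of_real (l ^ m)" for m
    proof -
      have "- \<i> * complex_of_real (t * l) = (- \<i> * complex_of_real t) * complex_of_real l" by simp
      then show ?thesis
        by (simp only: power_mult_distrib scaleR_conv_of_real of_real_power) (simp add: field_simps)
    qed
    ultimately have "(\<lambda>m. ?c m * complex_of_real (l ^ m)) sums exp (- \<i> * complex_of_real (t * l))" by simp
    then show ?thesis
      by (rule bounded_linear.sums[rotated]) (auto intro!: linear_conv_bounded_linear[THEN iffD1] linearI
          simp: vector_sadd_rdistrib vec_eq_iff algebra_simps)
  qed
  have "?c m *s ((\<lambda>v. Mhom M \<xi> *v v) ^^ m) w = (\<Sum>b\<in>EB M \<xi>. (w \<bullet> b) *\<^sub>R ((?c m * complex_of_real (lam M \<xi>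
      b ^ m)) *s b))" for m
    unfolding EB_funpow fcalc_def
    by (simp add: vec_eq_iff sum_distrib_left scaleR_conv_of_real[of _ "_::complex"] mult_ac)
  moreover have "(\<lambda>m. \<Sum>b\<in>EB M \<xi>. (w \<bullet> b) *\<^sub>R ((?c m * complex_of_real (lam M \<xi> b ^ m)) *s b)) sums
     (\<Sum>b\<in>EB M \<xi>. (w \<bullet> b) *\<^sub>R (exp (- \<i> * complex_of_real (t * lam M \<xi> b)) *s b))"
    by (intro sums_sum sums_scaleR_right s1)
  ultimately show ?thesis unfolding expM_def by (simp add: sums_iff)
qed

text \<open>A crude bound by counting basis vectors; it serves only to provide integrable majorants,
  where the constant is immaterial.\<close>

lemma norm_expM_le: "norm (expM t (Mhom M \<xi>) w) \<le> real DIM(complex^'k) * norm w"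
proof -
  have "norm (expM t (Mhom M \<xi>) w) \<le> (\<Sum>b\<in>EB M \<xi>. norm w)"
    unfolding expM_EB
  proof (rule sum_norm_le)
    fix b assume b: "b \<in> EB M \<xi>"
    have "norm (exp (- \<i> * complex_of_real (t * lam M \<xi> b)) *s b) = norm b"
      by (simp add: norm_vec_def norm_mult L2_set_def)
    then show "norm ((w \<bullet> b) *\<^sub>R (exp (- \<i> * complex_of_real (t * lam M \<xi> b)) *s b)) \<le> norm w"
      using Cauchy_Schwarz_ineq2[of w b] EB_norm[OF b] by simp
  qed
  then show ?thesis by (simp add: EB_card)
qed

lemma borel_measurable_vector_smult[measurable (raw)]:
  assumes "c \<in> borel_measurable N" "w \<in> borel_measurable N"
  shows "(\<lambda>x. c x *s (w x :: complex^'k)) \<in> borel_measurable N"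
  using assms unfolding borel_measurable_vec_iff by (auto intro!: borel_measurable_times)

lemma borel_measurable_expM[measurable (raw)]:
  assumes [measurable]: "t \<in> borel_measurable N" "\<xi> \<in> borel_measurable N" "w \<in> borel_measurable N"
  shows "(\<lambda>x. expM (t x) (Mhom M (\<xi> x)) (w x)) \<in> borel_measurable N"
  unfolding expM_def by measurable

end

text \<open>The coefficient \<open>s\<close> is the imaginary part of the complex inner product of a
  and b. Its value is left implicit because its sine factor integrates to 0 against an even function
  of time.\<close>

lemma inner_rotation:
  obtains s where "\<And>\<alpha> \<beta>. (exp (- \<i> * complex_of_real \<alpha>) *s a) \<bullet> (exp (- \<i> * complex_of_real \<beta>) *s b)
     = cos (\<alpha> - \<beta>) * (a \<bullet> (b::complex^'k::finite)) + sin (\<alpha> - \<beta>) * s"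
proof -
  have "(exp (- \<i> * complex_of_real \<alpha>) * z) \<bullet> (exp (- \<i> * complex_of_real \<beta>) * w)
     = cos (\<alpha> - \<beta>) * (z \<bullet> w) + sin (\<alpha> - \<beta>) * (Im z * Re w - Re z * Im w)" for \<alpha> \<beta> and z w :: complex
    by (simp add: inner_complex_def Re_exp Im_exp cos_diff sin_diff) (simp add: algebra_simps)
  then show ?thesis
    by (intro that[of "\<Sum>i\<in>UNIV. Im (a $ i) * Re (b $ i) - Re (a $ i) * Im (b $ i)"])
       (simp add: inner_vec_def sum.distrib sum_distrib_left)
qed

lemma gauss_real: "gauss r (x::real) = normal_density 0 r x"
  by (simp add: gauss_def)

lemma integral_exp_cos_sin:
  assumes r: "0 < r"
  shows "integrable lborel (\<lambda>t::real. exp (- (r * t)\<^sup>2 / 2) * cos (t * y))"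
    and "(LINT t|lborel. exp (- (r * t)\<^sup>2 / 2) * cos (t * y)) = 2 * pi * normal_density 0 r y"
    and "integrable lborel (\<lambda>t::real. exp (- (r * t)\<^sup>2 / 2) * sin (t * y))"
    and "(LINT t|lborel. exp (- (r * t)\<^sup>2 / 2) * sin (t * y)) = 0"
proof -
  let ?F = "\<lambda>t. iexp (y \<bullet> t) * complex_of_real (exp (- (r * norm t)\<^sup>2 / 2))"
  have i: "integrable lborel ?F"
    by (rule Bochner_Integration.integrable_bound[OF integrable_exp_norm[OF r]]) (auto simp: norm_mult)
  have R: "Re (?F t) = exp (- (r * t)\<^sup>2 / 2) * cos (t * y)" "Im (?F t) = exp (- (r * t)\<^sup>2 / 2) * sin (t *
      y)" for t :: real
    by (simp_all add: Re_exp Im_exp power_mult_distrib mult_ac)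
  have I: "(LINT t|lborel. ?F t) = complex_of_real (2 * pi * normal_density 0 r y)"
    using integral_iexp_exp_norm[OF r, of y] by (simp add: gauss_real)
  show "integrable lborel (\<lambda>t::real. exp (- (r * t)\<^sup>2 / 2) * cos (t * y))"
    "integrable lborel (\<lambda>t::real. exp (- (r * t)\<^sup>2 / 2) * sin (t * y))"
    using integrable_Re[OF i] integrable_Im[OF i] unfolding R by auto
  show "(LINT t|lborel. exp (- (r * t)\<^sup>2 / 2) * cos (t * y)) = 2 * pi * normal_density 0 r y"
    "(LINT t|lborel. exp (- (r * t)\<^sup>2 / 2) * sin (t * y)) = 0"
    using arg_cong[OF I, of Re] arg_cong[OF I, of Im] unfolding integral_Re[OF i, symmetric]
        integral_Im[OF i, symmetric] R by auto
qed

section \<open>Nonzero eigenvalues\<close>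

lemma vec_subspace_imp_subspace:
  assumes "vec.subspace (W :: (complex^'k::finite) set)" shows "subspace W"
  unfolding subspace_def
proof (intro conjI ballI allI)
  show "c *\<^sub>R x \<in> W" if "x \<in> W" for c x
  proof -
    have "c *\<^sub>R x = complex_of_real c *s x" by (simp add: vec_eq_iff scaleR_conv_of_real[of _ "_::complex"])
    then show ?thesis using vec.subspace_scale[OF assms that] by simp
  qed
qed (use assms vec.subspace_0 vec.subspace_add in auto)

text \<open>Dimensions are counted over the complex numbers, as in \<open>kerdim\<close>. A basis of
  S is extended to the whole space, and the dimension formula shows that the added vectors span a
  space meeting S only in 0.\<close>

lemma vec_complement_exists:
  fixes S :: "(complex^'k::finite) set"
  assumes S: "vec.subspace S"
  obtains W where "vec.subspace W" "vec.dim W + vec.dim S = CARD('k)" "W \<inter> S = {0}"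
proof -
  obtain B where B: "B \<subseteq> S" "vec.independent B" "S \<subseteq> vec.span B" "card B = vec.dim S"
    using vec.basis_exists by blast
  have sB: "vec.span B = S" using B S by (simp add: vec.span_subspace)
  obtain C where C': "B \<subseteq> C" "C \<subseteq> UNIV" "vec.independent C" "UNIV \<subseteq> vec.span C"
    by (rule vec.maximal_independent_subset_extend[OF subset_UNIV B(2)])
  note C = C'(1,3,4)
  have fin: "finite C" using C(2) by (rule vec.finiteI_independent)
  have cC: "card C = CARD('k)"
    using vec.basis_card_eq_dim[OF C'(2,4,3)] by (simp only: vec_dim_card)
  have iD: "vec.independent (C - B)" using C(2) by (rule vec.independent_mono) auto
  show ?thesis
  proof (rule that[of "vec.span (C - B)"])
    have "vec.dim (vec.span (C - B)) = card C - card B"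
      by (rule trans[OF vec.dim_span_eq_card_independent[OF iD] card_Diff_subset[OF finite_subset[OF C(1)
          fin] C(1)]])
    then show "vec.dim (vec.span (C - B)) + vec.dim S = CARD('k)"
      using B(4) cC card_mono[OF fin C(1)] by simp
    show "vec.span (C - B) \<inter> S = {0}"
    proof -
      have "vec.span (C - B) \<inter> vec.span B = {0}"
      proof -
        have e1: "vec.dim {x + y |x y. x \<in> vec.span (C - B) \<and> y \<in> vec.span B} + vec.dim (vec.span (C - B)
            \<inter> vec.span B)
            = vec.dim (vec.span (C - B)) + vec.dim (vec.span B)"
          by (rule vec.dim_sums_Int) auto
        have e2: "{x + y |x y. x \<in> vec.span (C - B) \<and> y \<in> vec.span B} = UNIV"
          using C(1,3) vec.span_Un[of "C - B" B] by (auto simp: Un_absorb2 Diff_partition)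
        have e3: "vec.dim (vec.span (C - B)) + vec.dim (vec.span B) = CARD('k)"
          using \<open>vec.dim (vec.span (C - B)) + vec.dim S = CARD('k)\<close> sB by simp
        have "vec.dim (vec.span (C - B) \<inter> vec.span B) = 0" using e1 unfolding e2 e3 vec_dim_card by linarith
        then have "vec.span (C - B) \<inter> vec.span B \<subseteq> {0}" by (simp only: vec.dim_eq_0)
        then show ?thesis using vec.span_zero by blast
      qed
      then show ?thesis by (simp add: sB)
    qed
  qed simp
qed

lemma vec_subspace_ker: "vec.subspace {v::complex^'k::finite. A *v v = 0}"
  unfolding vec.subspace_def by (auto simp: matrix_vector_right_distrib vector_scalar_commute)

text \<open>Near \<open>\<xi>\<^sub>0\<close> the symbol stays injective on a complement \<open>W\<close> of the kernel. A small nonzero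
  eigenvalue would, together with the kernel, produce a space of dimension \<open>d + 1\<close>, which has to meet \<open>W\<close>.\<close>
lemma eigenvalue_local_lower_bound:
  fixes M :: "'n::finite \<Rightarrow> complex^'k^'k::finite"
  assumes h: "\<forall>j. hermitian_mat (M j)"
    and d: "\<And>\<xi>. \<xi> \<noteq> 0 \<Longrightarrow> kerdim (Mhom M \<xi>) = d" and \<xi>0: "\<xi>0 \<noteq> 0"
  shows "\<exists>c>0. \<exists>e>0. \<forall>\<xi> \<mu> v. norm (\<xi> - \<xi>0) < e \<longrightarrow> \<xi> \<noteq> 0 \<longrightarrow> v \<noteq> 0 \<longrightarrow> Mhom M \<xi> *v v = \<mu> *\<^sub>R v \<longrightarrow> \<mu> \<noteq> 0 \<longrightarrow> c \<le> \<bar>\<mu>\<bar>"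
proof -
  obtain W where W: "vec.subspace W" "vec.dim W + d = CARD('k)" "W \<inter> {v. Mhom M \<xi>0 *v v = 0} = {0}"
    using vec_complement_exists[OF vec_subspace_ker[of "Mhom M \<xi>0"]] d[OF \<xi>0] unfolding kerdim_def by metis
  have sW: "subspace W" by (rule vec_subspace_imp_subspace[OF W(1)])
  have bl: "bounded_linear (\<lambda>v. Mhom M \<xi>0 *v v)" using linear_Mhom by (simp add: linear_conv_bounded_linear)
  obtain c where c: "c > 0" "\<And>x. x \<in> W \<Longrightarrow> c * norm x \<le> norm (Mhom M \<xi>0 *v x)"
    using injective_imp_isometric[OF closed_subspace[OF sW] sW bl] W(3) by blast
  obtain L where L: "L > 0" "\<And>\<xi> v. norm (Mhom M \<xi> *v v) \<le> norm \<xi> * norm v * L"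
    using bounded_bilinear.pos_bounded[OF bilinear_conv_bounded_bilinear[THEN iffD1, OF bilinear_Mhom[of
        M]]] by blast
  \<comment> \<open>Within the radius c/(2 L) the symbol changes by at most c/2 in operator norm,
    half of the injectivity constant \<open>c\<close> on W.\<close>
  have "c / 2 \<le> \<bar>\<mu>\<bar>" if \<xi>: "norm (\<xi> - \<xi>0) < c / (2 * L)" "\<xi> \<noteq> 0" and v: "v \<noteq> 0" "Mhom M \<xi> *v v = \<mu> *\<^sub>R v"
      and \<mu>: "\<mu> \<noteq> 0" for \<xi> \<mu> v
  proof -
    let ?K = "{v. Mhom M \<xi> *v v = 0}"
    let ?U = "vec.span (insert v ?K)"
    have sK: "vec.span ?K = ?K" by (rule vec.span_eq_iff[THEN iffD2, OF vec_subspace_ker])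
    have "v \<notin> ?K" using v \<mu> by simp
    then have "v \<notin> vec.span ?K" unfolding sK .
    then have "vec.dim ?U = d + 1" using d[OF \<xi>(2)] by (simp add: vec.dim_insert kerdim_def)
    moreover have "vec.dim {x + y |x y. x \<in> ?U \<and> y \<in> W} + vec.dim (?U \<inter> W) = vec.dim ?U + vec.dim W"
      by (rule vec.dim_sums_Int) (use W in auto)
    moreover have "vec.dim {x + y |x y. x \<in> ?U \<and> y \<in> W} \<le> CARD('k)"
      unfolding vec_dim_card[where 'a=complex, symmetric] by (rule vec.dim_subset) simp
    ultimately have "vec.dim (?U \<inter> W) \<noteq> 0" using W(2) by linarith
    then obtain z where z: "z \<in> ?U" "z \<in> W" "z \<noteq> 0" by (auto simp: vec.dim_eq_0)
    then obtain a where "z - a *s v \<in> vec.span ?K" using vec.span_insert[of v ?K] by auto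
    then have k: "Mhom M \<xi> *v (z - a *s v) = 0" unfolding sK by simp
    define v' where "v' = a *s v"
    have v': "Mhom M \<xi> *v v' = \<mu> *\<^sub>R v'"
      unfolding v'_def vector_scalar_commute v(2) by (simp add: vec_eq_iff)
    \<comment> \<open>The kernel part z - v' and the part v' belong to the distinct eigenvalues 0
      and \<mu>, hence are orthogonal. So v' is no longer than z, and the symbol enlarges z by at
      most |\<mu>|.\<close>
    have "\<mu> * ((z - v') \<bullet> v') = (z - v') \<bullet> (Mhom M \<xi> *v v')" unfolding v' by simp
    also have "\<dots> = 0" unfolding Mhom_adjoint[OF h, symmetric] using k v'_def by simp
    finally have o: "(z - v') \<bullet> v' = 0" using \<mu> by simp
    have "(norm z)\<^sup>2 = (norm (z - v'))\<^sup>2 + (norm v')\<^sup>2"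
      using o norm_add_Pythagorean[of "z - v'" v'] by (simp add: orthogonal_def)
    then have "norm v' \<le> norm z" by (simp add: power2_le_imp_le)
    moreover have "Mhom M \<xi> *v z = \<mu> *\<^sub>R v'"
      using k v' unfolding v'_def[symmetric] by (simp add: matrix_vector_mult_diff_distrib)
    ultimately have up: "norm (Mhom M \<xi> *v z) \<le> \<bar>\<mu>\<bar> * norm z" by (simp add: mult_left_mono)
    have "Mhom M \<xi>0 *v z = Mhom M \<xi> *v z - Mhom M (\<xi> - \<xi>0) *v z"
      using bilinear_lsub[OF bilinear_Mhom, of M \<xi> \<xi>0 z] by simp
    then have "norm (Mhom M \<xi>0 *v z) \<le> norm (Mhom M \<xi> *v z) + norm (\<xi> - \<xi>0) * norm z * L"
      using norm_triangle_ineq4[of "Mhom M \<xi> *v z" "Mhom M (\<xi> - \<xi>0) *v z"] L(2)[of "\<xi> - \<xi>0" z] by simp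
    also have "\<dots> \<le> \<bar>\<mu>\<bar> * norm z + c / (2 * L) * norm z * L"
      using up \<xi>(1) L(1) by (intro add_mono mult_right_mono) auto
    also have "\<dots> = (\<bar>\<mu>\<bar> + c / 2) * norm z" using L(1) by (simp add: field_simps)
    finally have "c * norm z \<le> (\<bar>\<mu>\<bar> + c / 2) * norm z" using c(2)[OF z(2)] by linarith
    then show ?thesis using z(3) by simp
  qed
  then show ?thesis using c(1) L(1) by (intro exI[of _ "c/2"] conjI exI[of _ "c / (2 * L)"]) auto
qed

text \<open>Compactness of the unit sphere makes the local bounds uniform: points violating the
  bounds 1/(n + 1) would accumulate at some l and contradict the bound near l. Homogeneity extends
  the estimate to all frequencies.\<close>

lemma eigenvalue_lower_bound:
  fixes M :: "'n::finite \<Rightarrow> complex^'k^'k::finite"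
  assumes h: "\<forall>j. hermitian_mat (M j)" and sp: "strongly_propagative M"
  shows "\<exists>c>0. \<forall>\<xi> \<mu> v. v \<noteq> 0 \<longrightarrow> Mhom M \<xi> *v v = \<mu> *\<^sub>R v \<longrightarrow> \<mu> \<noteq> 0 \<longrightarrow> c * norm \<xi> \<le> \<bar>\<mu>\<bar>"
proof -
  obtain d where d: "\<And>\<xi>::real^'n. \<xi> \<noteq> 0 \<Longrightarrow> kerdim (Mhom M \<xi>) = d"
    using sp unfolding strongly_propagative_def by blast
  define P where "P \<xi> c \<longleftrightarrow> (\<forall>\<mu> v. v \<noteq> 0 \<longrightarrow> Mhom M \<xi> *v v = \<mu> *\<^sub>R v \<longrightarrow> \<mu> \<noteq> 0 \<longrightarrow> c \<le> \<bar>\<mu>\<bar>)" for \<xi> c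
  have mono: "P \<xi> c \<Longrightarrow> c' \<le> c \<Longrightarrow> P \<xi> c'" for \<xi> c c' unfolding P_def by (meson order_trans)
  have "\<exists>c>0. \<forall>\<xi>\<in>sphere 0 1. P \<xi> c"
  proof (rule ccontr)
    assume neg: "\<not> ?thesis"
    have "\<exists>\<xi>\<in>sphere 0 1. \<not> P \<xi> (1 / real (Suc n))" for n
    proof -
      have "1 / real (Suc n) > 0" by simp
      then show ?thesis using neg by blast
    qed
    then obtain x where x: "\<And>n. x n \<in> sphere 0 1" "\<And>n. \<not> P (x n) (1 / real (Suc n))" by metis
    have "compact (sphere (0::real^'n) 1)" by simp
    then obtain l r where l: "l \<in> sphere 0 1" "strict_mono r" "(x \<circ> r) \<longlonglongrightarrow> l"
      using x(1) unfolding compact_def by blast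
    then have "l \<noteq> 0" by auto
    from eigenvalue_local_lower_bound[OF h d this] obtain c e where ce: "c > 0" "e > 0"
      "\<And>\<xi>. norm (\<xi> - l) < e \<Longrightarrow> \<xi> \<noteq> 0 \<Longrightarrow> P \<xi> c" unfolding P_def by blast
    from LIMSEQ_D[OF l(3) ce(2)] obtain N where N: "\<And>n. n \<ge> N \<Longrightarrow> norm (x (r n) - l) < e" by auto
    obtain m where m: "1 / real (Suc m) < c" using ce(1) nat_approx_posE by blast
    define n where "n = max N m"
    have "norm (x (r n)) = 1" using x(1)[of "r n"] by simp
    then have "x (r n) \<noteq> 0" by auto
    then have "P (x (r n)) c" using N[of n] by (intro ce(3)) (auto simp: n_def)
    moreover have "1 / real (Suc (r n)) \<le> c"
    proof -
      have "m \<le> r n" using seq_suble[OF l(2), of n] by (simp add: n_def)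
      then have "1 / real (Suc (r n)) \<le> 1 / real (Suc m)" by (simp add: frac_le)
      then show ?thesis using m by simp
    qed
    ultimately show False using x(2) mono by blast
  qed
  then obtain c where c: "c > 0" "\<And>\<xi>. \<xi> \<in> sphere 0 1 \<Longrightarrow> P \<xi> c" by blast
  have "c * norm \<xi> \<le> \<bar>\<mu>\<bar>" if v: "v \<noteq> 0" "Mhom M \<xi> *v v = \<mu> *\<^sub>R v" "\<mu> \<noteq> 0" for \<xi> \<mu> v
  proof (cases "\<xi> = 0")
    case False
    have "Mhom M (\<xi> /\<^sub>R norm \<xi>) *v v = (\<mu> / norm \<xi>) *\<^sub>R v"
      unfolding Mhom_scaleR v(2) by (simp add: field_simps)
    moreover have "P (\<xi> /\<^sub>R norm \<xi>) c" using False by (intro c(2)) simp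
    moreover have "\<mu> / norm \<xi> \<noteq> 0" using v False by simp
    ultimately have "c \<le> \<bar>\<mu> / norm \<xi>\<bar>" using v(1) unfolding P_def by blast
    then show ?thesis using False by (simp add: field_simps)
  qed simp
  then show ?thesis using c(1) by blast
qed

section \<open>Polar coordinates\<close>

lemma nn_integral_inverse_Icc:
  assumes a: "0 < (a::real)"
  shows "(\<integral>\<^sup>+r. ennreal (1 / r) * indicator {a / exp 1 .. a} r \<partial>lborel) = 1"
proof -
  have "(\<integral>\<^sup>+r. ennreal (1 / r) * indicator {a / exp 1 .. a} r \<partial>lborel) = ennreal (ln a - ln (a / exp 1))"
  proof (rule nn_integral_FTC_Icc)
    have e: "a / exp 1 > 0" using a by simp
    show "DERIV ln r :> 1 / r" if "r \<in> {a / exp 1..a}" for r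
      using that e by (intro DERIV_ln_divide) auto
    show "0 \<le> 1 / r" if "r \<in> {a / exp 1..a}" for r
      using that e by (intro divide_nonneg_nonneg) auto
    show "a / exp 1 \<le> a" using a by (simp add: divide_le_eq mult_le_cancel_left1)
  qed simp
  then show ?thesis using a by (simp add: ln_div)
qed

text \<open>Polar coordinates without a surface measure: the sphere is replaced by the shell
  \<open>1 \<le> |\<omega>| \<le> e\<close>, which every ray meets in a set of \<open>dr / r\<close>-measure \<open>1\<close>.\<close>
definition shell :: "'a::euclidean_space set" where
  "shell = {\<omega>. 1 \<le> norm \<omega> \<and> norm \<omega> \<le> exp 1}"

lemma shell_borel[measurable]: "shell \<in> sets borel"
  unfolding shell_def by measurable

text \<open>For fixed r the substitution y = r \<omega> has Jacobian r^n, which leaves dr/r.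
  Exchanging the order, a nonzero y meets the scaled shell exactly for r between |y|/e and |y|, an
  interval of dr/r-measure 1.\<close>

lemma nn_integral_polar:
  fixes F :: "'a::euclidean_space \<Rightarrow> ennreal"
  assumes [measurable]: "F \<in> borel_measurable borel"
  shows "(\<integral>\<^sup>+\<omega>. indicator shell \<omega> * (\<integral>\<^sup>+r. indicator {0<..} r * ennreal (r ^ (DIM('a) - 1)) * F (r *\<^sub>R \<omega>)
      \<partial>lborel) \<partial>lborel)
     = (\<integral>\<^sup>+\<xi>. F \<xi> \<partial>lborel)" (is "?L = _")
proof -
  let ?n = "DIM('a)"
  have "?L = (\<integral>\<^sup>+\<omega>. (\<integral>\<^sup>+r. indicator shell \<omega> * (indicator {0<..} r * ennreal (r ^ (?n - 1)) * F (r *\<^sub>R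
      \<omega>)) \<partial>lborel) \<partial>lborel)"
    by (intro nn_integral_cong nn_integral_cmult[symmetric]) measurable
  also have "\<dots> = (\<integral>\<^sup>+r. (\<integral>\<^sup>+\<omega>. indicator shell \<omega> * (indicator {0<..} r * ennreal (r ^ (?n - 1)) * F (r
      *\<^sub>R \<omega>)) \<partial>lborel) \<partial>lborel)"
    by (rule lborel_pair.Fubini') measurable
  also have "\<dots> = (\<integral>\<^sup>+r. (\<integral>\<^sup>+y. indicator {0<..} r * ennreal (1 / r) * (indicator shell (y /\<^sub>R r) * F y)
      \<partial>lborel) \<partial>lborel)"
  proof (rule nn_integral_cong)
    fix r :: real
    show "(\<integral>\<^sup>+\<omega>. indicator shell \<omega> * (indicator {0<..} r * ennreal (r ^ (?n - 1)) * F (r *\<^sub>R \<omega>)) \<partial>lborel)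
       = (\<integral>\<^sup>+y. indicator {0<..} r * ennreal (1 / r) * (indicator shell (y /\<^sub>R r) * F y) \<partial>lborel)"
    proof (cases "r > 0")
      case True
      have "(\<integral>\<^sup>+y. indicator {0<..} r * ennreal (1 / r) * (indicator shell (y /\<^sub>R r) * F y) \<partial>lborel)
         = ennreal (\<bar>r\<bar> ^ ?n) * (\<integral>\<^sup>+\<omega>. indicator {0<..} r * ennreal (1 / r) * (indicator shell ((0 + r
             *\<^sub>R \<omega>) /\<^sub>R r) * F (0 + r *\<^sub>R \<omega>)) \<partial>lborel)"
        using True by (intro nn_integral_lborel_affine) auto
      also have "\<dots> = (\<integral>\<^sup>+\<omega>. ennreal (r ^ ?n) * (ennreal (1 / r) * (indicator shell \<omega> * F (r *\<^sub>R \<omega>))) \<partial>lborel)"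
        using True by (subst nn_integral_cmult[symmetric]) auto
      also have "\<dots> = (\<integral>\<^sup>+\<omega>. indicator shell \<omega> * (indicator {0<..} r * ennreal (r ^ (?n - 1)) * F (r *\<^sub>R
          \<omega>)) \<partial>lborel)"
      proof -
        have "r ^ ?n * (1 / r) = r ^ (?n - 1)" using True DIM_positive[where 'a='a] by (simp add: power_diff)
        then have "ennreal (r ^ ?n) * ennreal (1 / r) = ennreal (r ^ (?n - 1))"
          using True by (simp add: ennreal_mult[symmetric])
        then show ?thesis using True by (simp add: mult.assoc[symmetric]) (simp add: mult_ac)
      qed
      finally show ?thesis by simp
    qed simp
  qed
  also have "\<dots> = (\<integral>\<^sup>+y. (\<integral>\<^sup>+r. indicator {0<..} r * ennreal (1 / r) * (indicator shell (y /\<^sub>R r) * F y)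
      \<partial>lborel) \<partial>lborel)"
    by (rule lborel_pair.Fubini'[symmetric]) measurable
  also have "\<dots> = (\<integral>\<^sup>+y. F y \<partial>lborel)"
  proof (rule nn_integral_cong_AE)
    have "AE y in lborel. y \<noteq> (0::'a)" by (rule AE_lborel_singleton)
    then show "AE y in lborel. (\<integral>\<^sup>+r. indicator {0<..} r * ennreal (1 / r) * (indicator shell (y /\<^sub>R r) *
        F y) \<partial>lborel) = F y"
    proof eventually_elim
      case (elim y)
      have *: "indicator {0<..} r * ennreal (1 / r) * indicator shell (y /\<^sub>R r)
         = ennreal (1 / r) * indicator {norm y / exp 1 .. norm y} r" for r
      proof (cases "r > 0")
        case True
        then have "y /\<^sub>R r \<in> shell \<longleftrightarrow> r \<in> {norm y / exp 1 .. norm y}"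
          by (auto simp: shell_def divide_simps mult.commute)
        then show ?thesis using True by (simp add: indicator_def)
      next
        case False
        have "norm y / exp 1 > 0" using elim by simp
        then show ?thesis using False by (auto simp: indicator_def)
      qed
      have "(\<integral>\<^sup>+r. indicator {0<..} r * ennreal (1 / r) * (indicator shell (y /\<^sub>R r) * F y) \<partial>lborel)
         = (\<integral>\<^sup>+r. ennreal (1 / r) * indicator {norm y / exp 1 .. norm y} r * F y \<partial>lborel)"
        by (simp only: *[symmetric] mult.assoc)
      also have "\<dots> = F y"
        using nn_integral_inverse_Icc[of "norm y"] elim by (subst nn_integral_multc) auto
      finally show ?case .
    qed
  qed
  finally show ?thesis .
qed

section \<open>Gaussians along rays\<close>

definition Cg :: "nat \<Rightarrow> real" where
  "Cg n = sqrt 2 ^ n * exp ((exp 1)\<^sup>2 / 2)"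

text \<open>From |b|^2 \<le> 2 |a|^2 + 2 |b - a|^2, doubling the variance absorbs a shift. In
  \<open>Cg\<close> the factor sqrt 2 ^ n is the ratio of normalizations, and exp((exp 1)^2 / 2)
  pays for a shift of length e d, the largest one that occurs along a ray through the shell.\<close>

lemma gauss_shift_le:
  fixes a b :: "'a::euclidean_space"
  assumes d: "0 < d" and ab: "norm (b - a) \<le> exp 1 * d"
  shows "gauss d a \<le> Cg DIM('a) * gauss (sqrt 2 * d) b"
proof -
  have "norm b \<le> norm a + norm (b - a)" using norm_triangle_ineq[of a "b - a"] by simp
  then have "(norm b)\<^sup>2 \<le> 2 * (norm a)\<^sup>2 + 2 * (norm (b - a))\<^sup>2"
    by (intro order_trans[OF power_mono power2_add_le]) auto
  also have "(norm (b - a))\<^sup>2 \<le> (exp 1 * d)\<^sup>2" using ab by (intro power_mono) auto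
  finally have "(norm b)\<^sup>2 \<le> 2 * (norm a)\<^sup>2 + 2 * (exp 1 * d)\<^sup>2" by simp
  then have "(norm b)\<^sup>2 / (4 * d\<^sup>2) \<le> (2 * (norm a)\<^sup>2 + 2 * (exp 1 * d)\<^sup>2) / (4 * d\<^sup>2)"
    by (intro divide_right_mono) auto
  also have "\<dots> = (norm a)\<^sup>2 / (2 * d\<^sup>2) + (exp 1)\<^sup>2 / 2"
    using d by (simp add: power_mult_distrib add_divide_distrib)
  finally have "- (norm a)\<^sup>2 / (2 * d\<^sup>2) \<le> (exp 1)\<^sup>2 / 2 + - (norm b)\<^sup>2 / (2 * (sqrt 2 * d)\<^sup>2)"
    by (simp add: power_mult_distrib)
  then have e: "exp (- (norm a)\<^sup>2 / (2 * d\<^sup>2)) \<le> exp ((exp 1)\<^sup>2 / 2) * exp (- (norm b)\<^sup>2 / (2 * (sqrt 2 *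
      d)\<^sup>2))"
    unfolding exp_add[symmetric] by simp
  have s: "1 / sqrt (2 * pi * d\<^sup>2) = sqrt 2 * (1 / sqrt (2 * pi * (sqrt 2 * d)\<^sup>2))"
    using d by (simp add: real_sqrt_mult power_mult_distrib divide_simps)
  have "gauss d a = (sqrt 2 * (1 / sqrt (2 * pi * (sqrt 2 * d)\<^sup>2))) ^ DIM('a) * exp (- (norm a)\<^sup>2 / (2 *
      d\<^sup>2))"
    unfolding gauss_eq s ..
  also have "\<dots> \<le> (sqrt 2 * (1 / sqrt (2 * pi * (sqrt 2 * d)\<^sup>2))) ^ DIM('a) *
      (exp ((exp 1)\<^sup>2 / 2) * exp (- (norm b)\<^sup>2 / (2 * (sqrt 2 * d)\<^sup>2)))"
    using e by (intro mult_left_mono) auto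
  also have "\<dots> = Cg DIM('a) * gauss (sqrt 2 * d) b"
    unfolding gauss_eq Cg_def power_mult_distrib by (simp only: mult_ac)
  finally show ?thesis .
qed

lemma Cg_pos: "0 < Cg n" by (simp add: Cg_def)

text \<open>A value on the ray is dominated by the average of the wider Gaussian over the interval
  [r, r + d]; this is the origin of the factor 1/d. The interval lies beyond r, so that r^m \<le>
  t^m on it.\<close>

lemma gauss_ray_le:
  fixes \<xi> \<omega> :: "'a::euclidean_space"
  assumes d: "0 < d" and r: "0 < r" and \<omega>: "norm \<omega> \<le> exp 1"
  shows "ennreal (r ^ m * gauss d (\<xi> - r *\<^sub>R \<omega>))
    \<le> ennreal (Cg DIM('a) / d) * (\<integral>\<^sup>+r. indicator {0<..} r * ennreal (r ^ m) * gauss (sqrt 2 * d) (\<xi> - r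
        *\<^sub>R \<omega>) \<partial>lborel)"
proof -
  let ?g = "\<lambda>r. gauss (sqrt 2 * d) (\<xi> - r *\<^sub>R \<omega>)"
  have le: "r ^ m * gauss d (\<xi> - r *\<^sub>R \<omega>) \<le> Cg DIM('a) * (t ^ m * ?g t)" if t: "t \<in> {r..r+d}" for t
  proof -
    have "norm ((\<xi> - t *\<^sub>R \<omega>) - (\<xi> - r *\<^sub>R \<omega>)) = \<bar>r - t\<bar> * norm \<omega>"
      by (simp add: scaleR_left_diff_distrib[symmetric])
    also have "\<dots> \<le> d * exp 1" using t d \<omega> by (intro mult_mono) auto
    finally have "gauss d (\<xi> - r *\<^sub>R \<omega>) \<le> Cg DIM('a) * ?g t"
      by (intro gauss_shift_le d) (simp add: mult.commute)
    then have "r ^ m * gauss d (\<xi> - r *\<^sub>R \<omega>) \<le> t ^ m * (Cg DIM('a) * ?g t)"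
      using t r by (intro mult_mono power_mono) auto
    then show ?thesis by (simp add: mult_ac)
  qed
  have "ennreal (r ^ m * gauss d (\<xi> - r *\<^sub>R \<omega>)) = ennreal (1 / d) * (ennreal (r ^ m * gauss d (\<xi> - r *\<^sub>R
      \<omega>)) * emeasure lborel {r..r+d})"
    using d r by (simp add: ennreal_mult'[symmetric])
  also have "ennreal (r ^ m * gauss d (\<xi> - r *\<^sub>R \<omega>)) * emeasure lborel {r..r+d}
     = (\<integral>\<^sup>+t. ennreal (r ^ m * gauss d (\<xi> - r *\<^sub>R \<omega>)) * indicator {r..r+d} t \<partial>lborel)"
    by (rule nn_integral_cmult_indicator[symmetric]) simp
  also have "\<dots> \<le> (\<integral>\<^sup>+t. ennreal (Cg DIM('a)) * (indicator {0<..} t * ennreal (t ^ m) * ?g t) \<partial>lborel)"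
  proof (rule nn_integral_mono)
    fix t
    show "ennreal (r ^ m * gauss d (\<xi> - r *\<^sub>R \<omega>)) * indicator {r..r+d} t \<le> ennreal (Cg DIM('a)) *
        (indicator {0<..} t * ennreal (t ^ m) * ?g t)"
    proof (cases "t \<in> {r..r+d}")
      case True
      then have "t > 0" using r by simp
      have "ennreal (r ^ m * gauss d (\<xi> - r *\<^sub>R \<omega>)) \<le> ennreal (Cg DIM('a) * (t ^ m * ?g t))"
        by (rule ennreal_leI[OF le[OF True]])
      then show ?thesis using True \<open>t > 0\<close> Cg_pos[of "DIM('a)"] by (simp add: ennreal_mult)
    qed simp
  qed
  also have "\<dots> = ennreal (Cg DIM('a)) * (\<integral>\<^sup>+t. indicator {0<..} t * ennreal (t ^ m) * ?g t \<partial>lborel)"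
    by (rule nn_integral_cmult) measurable
  finally show ?thesis
    using Cg_pos[of "DIM('a)"] d by (simp add: mult_left_mono mult.assoc[symmetric] ennreal_mult[symmetric])
qed

section \<open>The space-time estimate for a Gaussian weight\<close>

context
  fixes M :: "'n::finite \<Rightarrow> complex^'k^'k::finite" and c0 :: real
  assumes h: "\<forall>j. hermitian_mat (M j)" and c0: "0 < c0"
    and lower: "\<And>\<xi> \<mu> v. v \<noteq> 0 \<Longrightarrow> Mhom M \<xi> *v v = \<mu> *\<^sub>R v \<Longrightarrow> \<mu> \<noteq> 0 \<Longrightarrow> c0 * norm \<xi> \<le> \<bar>\<mu>\<bar>"
begin

text \<open>The density at \<nu> of the nonzero eigenvalues of the symbol, counted by the real basis
  and smoothed at width \<sigma>.\<close>

definition dens :: "real \<Rightarrow> real \<Rightarrow> real^'n \<Rightarrow> real" where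
  "dens \<sigma> \<nu> \<xi> = (\<Sum>b\<in>EB M \<xi>. if lam M \<xi> b = 0 then 0 else normal_density 0 \<sigma> (\<nu> - lam M \<xi> b))"

lemma dens_nonneg: "0 \<le> dens \<sigma> \<nu> \<xi>"
  unfolding dens_def by (auto intro!: sum_nonneg)

lemma continuous_normal_density: "continuous_on UNIV (\<lambda>x. normal_density 0 \<sigma> (\<nu> - x))"
  by (cases "\<sigma> = 0") (auto simp: normal_density_def intro!: continuous_intros)

lemma borel_measurable_dens[measurable]: "dens \<sigma> \<nu> \<in> borel_measurable borel"
proof -
  have "dens \<sigma> \<nu> = (\<lambda>\<xi>. \<Sum>e\<in>Basis. fcalc M (\<lambda>t. if t = 0 then 0 else normal_density 0 \<sigma> (\<nu> - t)) \<xi> e \<bullet> e)"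
    unfolding fcalc_trace[OF h] dens_def ..
  also have "\<dots> \<in> borel_measurable borel"
    by (intro borel_measurable_sum borel_measurable_inner borel_measurable_const
        borel_measurable_fcalc_nz[OF h continuous_normal_density]) auto
  finally show ?thesis .
qed

lemma lam_lower: "b \<in> EB M \<xi> \<Longrightarrow> lam M \<xi> b \<noteq> 0 \<Longrightarrow> c0 * norm \<xi> \<le> \<bar>lam M \<xi> b\<bar>"
  using lower[OF _ EB_eigen[OF h]] EB_norm[OF h] by (metis norm_zero zero_neq_one)

lemma nn_integral_normal_density_affine:
  assumes l: "l \<noteq> 0" and \<sigma>: "0 < \<sigma>"
  shows "(\<integral>\<^sup>+r. ennreal (normal_density 0 \<sigma> (\<nu> - r * l)) \<partial>lborel) = ennreal (1 / \<bar>l\<bar>)"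
proof -
  have n: "(\<integral>\<^sup>+x. ennreal (normal_density 0 \<sigma> x) \<partial>lborel) = 1"
    using \<sigma> by (subst nn_integral_eq_integral) (auto simp: integral_normal_density)
  have "1 = ennreal \<bar>- l\<bar> * (\<integral>\<^sup>+r. ennreal (normal_density 0 \<sigma> (\<nu> + (- l) * r)) \<partial>lborel)"
    unfolding n[symmetric] using l by (intro nn_integral_real_affine) auto
  then have "ennreal (1 / \<bar>l\<bar>) * 1 = ennreal (1 / \<bar>l\<bar>) * (ennreal \<bar>l\<bar> * (\<integral>\<^sup>+r. ennreal (normal_density 0
      \<sigma> (\<nu> - r * l)) \<partial>lborel))"
    by (simp add: mult.commute)
  then show ?thesis using l by (simp add: mult.assoc[symmetric] ennreal_mult[symmetric])
qed

text \<open>Along the ray every summand is a normal density in an affine function of r, so it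
  integrates to the reciprocal of the slope at most, whatever \<nu> and \<sigma> are. On the shell
  |\<omega>| \<ge> 1, and the slopes that occur are at least \<open>c0\<close> in modulus.\<close>

lemma dens_ray_le:
  assumes \<sigma>: "0 < \<sigma>" and \<omega>: "1 \<le> norm \<omega>"
  shows "(\<integral>\<^sup>+r. indicator {0<..} r * ennreal (dens \<sigma> \<nu> (r *\<^sub>R \<omega>)) \<partial>lborel) \<le> ennreal (real
      DIM(complex^'k) / c0)"
proof -
  let ?f = "\<lambda>b r. ennreal (if lam M \<omega> b = 0 then 0 else normal_density 0 \<sigma> (\<nu> - r * lam M \<omega> b))"
  have "(\<integral>\<^sup>+r. indicator {0<..} r * ennreal (dens \<sigma> \<nu> (r *\<^sub>R \<omega>)) \<partial>lborel) \<le> (\<integral>\<^sup>+r. (\<Sum>b\<in>EB M \<omega>. ?f b r)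
      \<partial>lborel)"
  proof (rule nn_integral_mono)
    fix r :: real
    show "indicator {0<..} r * ennreal (dens \<sigma> \<nu> (r *\<^sub>R \<omega>)) \<le> (\<Sum>b\<in>EB M \<omega>. ?f b r)"
    proof (cases "0 < r")
      case True
      have "dens \<sigma> \<nu> (r *\<^sub>R \<omega>) = (\<Sum>b\<in>EB M \<omega>. if lam M \<omega> b = 0 then 0 else normal_density 0 \<sigma> (\<nu> - r * lam
          M \<omega> b))"
        unfolding dens_def EB_scaleR[OF True] lam_scaleR using True by (intro sum.cong refl) auto
      then show ?thesis using True by (subst sum_ennreal) auto
    qed simp
  qed
  also have "\<dots> = (\<Sum>b\<in>EB M \<omega>. (\<integral>\<^sup>+r. ?f b r \<partial>lborel))"
    by (rule nn_integral_sum) measurable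
  also have "\<dots> \<le> (\<Sum>b\<in>EB M \<omega>. ennreal (1 / c0))"
  proof (rule sum_mono)
    fix b assume b: "b \<in> EB M \<omega>"
    show "(\<integral>\<^sup>+r. ?f b r \<partial>lborel) \<le> ennreal (1 / c0)"
    proof (cases "lam M \<omega> b = 0")
      case False
      have "c0 * 1 \<le> c0 * norm \<omega>" using \<omega> c0 by (intro mult_left_mono) auto
      then have "c0 \<le> \<bar>lam M \<omega> b\<bar>" using lam_lower[OF b False] by simp
      then have "1 / \<bar>lam M \<omega> b\<bar> \<le> 1 / c0" using c0 by (intro frac_le) auto
      then show ?thesis using False by (simp add: nn_integral_normal_density_affine[OF False \<sigma>] ennreal_leI)
    qed simp
  qed
  also have "\<dots> = ennreal (real DIM(complex^'k) / c0)"
    using c0 by (simp add: EB_card[OF h] ennreal_of_nat_eq_real_of_nat ennreal_mult[symmetric])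
  finally show ?thesis .
qed

text \<open>In polar coordinates the eigenvalues are linear in \<open>r\<close> with slope bounded away from \<open>0\<close>.\<close>
lemma gauss_dens_le:
  assumes \<sigma>: "0 < \<sigma>" and d: "0 < d"
  shows "(\<integral>\<^sup>+\<eta>. ennreal (gauss d (\<xi> - \<eta>)) * ennreal (dens \<sigma> \<nu> \<eta>) \<partial>lborel) \<le> ennreal (Cg CARD('n) * (real
      DIM(complex^'k) / c0) / d)"
proof -
  let ?n = "CARD('n)"
  let ?K = "ennreal (real DIM(complex^'k) / c0)"
  let ?J = "\<lambda>\<omega>. (\<integral>\<^sup>+r. indicator {0<..} r * ennreal (r ^ (?n - 1)) * gauss (sqrt 2 * d) (\<xi> - r *\<^sub>R \<omega>)
      \<partial>lborel)"
  let ?F = "\<lambda>r \<omega>. ennreal (gauss d (\<xi> - r *\<^sub>R \<omega>)) * ennreal (dens \<sigma> \<nu> (r *\<^sub>R \<omega>))"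
  let ?S = "\<lambda>\<omega>. ennreal (Cg ?n / d) * ?J \<omega>"
  have "(\<integral>\<^sup>+\<eta>. ennreal (gauss d (\<xi> - \<eta>)) * ennreal (dens \<sigma> \<nu> \<eta>) \<partial>lborel)
     = (\<integral>\<^sup>+\<omega>. indicator shell \<omega> * (\<integral>\<^sup>+r. indicator {0<..} r * ennreal (r ^ (?n - 1)) *
          ?F r \<omega> \<partial>lborel) \<partial>lborel)"
    by (subst nn_integral_polar[symmetric]) simp_all
  also have "\<dots> \<le> (\<integral>\<^sup>+\<omega>. ?K * (ennreal (Cg ?n / d) * (indicator shell \<omega> * ?J \<omega>)) \<partial>lborel)"
  proof (rule nn_integral_mono)
    fix \<omega> :: "real^'n"
    show "indicator shell \<omega> * (\<integral>\<^sup>+r. indicator {0<..} r * ennreal (r ^ (?n - 1)) *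
          ?F r \<omega> \<partial>lborel)
        \<le> ?K * (ennreal (Cg ?n / d) * (indicator shell \<omega> * ?J \<omega>))"
    proof (cases "\<omega> \<in> shell")
      case True
      then have \<omega>: "1 \<le> norm \<omega>" "norm \<omega> \<le> exp 1" by (auto simp: shell_def)
      \<comment> \<open>The bound \<open>?S \<omega>\<close> for the weighted Gaussian holds for all
        r > 0 at once and leaves the radial integral, where only the eigenvalue density remains.
        Integrated over the shell, the averages in \<open>?S\<close> recombine to the total mass of
        the wider Gaussian.\<close>
      have "(\<integral>\<^sup>+r. indicator {0<..} r * ennreal (r ^ (?n - 1)) * ?F r \<omega> \<partial>lborel)
         \<le> (\<integral>\<^sup>+r. ?S \<omega> * (indicator {0<..} r * ennreal (dens \<sigma> \<nu> (r *\<^sub>R \<omega>))) \<partial>lborel)"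
      proof (rule nn_integral_mono)
        fix r :: real
        show "indicator {0<..} r * ennreal (r ^ (?n - 1)) * ?F r \<omega>
            \<le> ?S \<omega> * (indicator {0<..} r * ennreal (dens \<sigma> \<nu> (r *\<^sub>R \<omega>)))"
        proof (cases "0 < r")
          case True
          then have "ennreal (r ^ (?n - 1)) * ennreal (gauss d (\<xi> - r *\<^sub>R \<omega>)) \<le> ?S \<omega>"
            using gauss_ray_le[OF d True \<omega>(2), of "?n - 1" \<xi>] by (simp add: ennreal_mult)
          then show ?thesis using True by (simp add: mult.assoc[symmetric] mult_right_mono)
        qed simp
      qed
      also have "\<dots> = ?S \<omega> * (\<integral>\<^sup>+r. indicator {0<..} r * ennreal (dens \<sigma> \<nu> (r *\<^sub>R \<omega>)) \<partial>lborel)"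
        by (rule nn_integral_cmult) measurable
      also have "\<dots> \<le> ?S \<omega> * ?K"
        by (intro mult_left_mono dens_ray_le \<sigma> \<omega>) auto
      finally show ?thesis using True by (simp add: mult_ac)
    qed simp
  qed
  also have "\<dots> = ?K * (ennreal (Cg ?n / d) * (\<integral>\<^sup>+\<omega>. indicator shell \<omega> * ?J \<omega> \<partial>lborel))"
    by (subst nn_integral_cmult, measurable, subst nn_integral_cmult, measurable)
  also have "(\<integral>\<^sup>+\<omega>. indicator shell \<omega> * ?J \<omega> \<partial>lborel)
      = (\<integral>\<^sup>+\<eta>. gauss (sqrt 2 * d) (\<xi> - \<eta>) \<partial>lborel)"
    using nn_integral_polar[of "\<lambda>\<eta>. ennreal (gauss (sqrt 2 * d) (\<xi> - \<eta>))"] by simp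
  also have "\<dots> = 1" using d by (intro nn_integral_gauss_diff) simp
  also have "?K * (ennreal (Cg ?n / d) * 1) = ennreal (Cg CARD('n) * (real DIM(complex^'k) / c0) / d)"
    using d c0 Cg_pos[of ?n] by (simp add: ennreal_mult[symmetric] mult_ac)
  finally show ?thesis .
qed


section \<open>The kernel on pairs of frequencies and its Schur bound\<close>

context
  fixes f :: "real^'n \<Rightarrow> complex^'k"
  assumes f: "sq_int f" and orth: "\<And>\<xi> b. b \<in> EB M \<xi> \<Longrightarrow> lam M \<xi> b = 0 \<Longrightarrow> f \<xi> \<bullet> b = 0"
begin

lemma f_borel[measurable]: "f \<in> borel_measurable borel"
  using f by (rule sq_int_measurable)

text \<open>The majorant for one half of the pair kernel: only the squares of the components at
  \<eta> enter, paired with all nonzero eigenvalues at \<zeta>. It contains no inner product between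
  eigenvectors at different frequencies.\<close>

definition Dk :: "real \<Rightarrow> real^'n \<Rightarrow> real^'n \<Rightarrow> real" where
  "Dk \<sigma> \<eta> \<zeta> = (\<Sum>a\<in>EB M \<eta>. (f \<eta> \<bullet> a)\<^sup>2 * dens \<sigma> (lam M \<eta> a) \<zeta>)"

lemma Dk_nonneg: "0 \<le> Dk \<sigma> \<eta> \<zeta>"
  unfolding Dk_def by (intro sum_nonneg mult_nonneg_nonneg dens_nonneg) auto

text \<open>Expanding exp(x y / \<sigma>^2) separates the variables. This is needed for joint
  measurability, since the functional calculus treats one frequency at a time.\<close>

lemma normal_density_diff_sums:
  assumes "0 < \<sigma>"
  shows "(\<lambda>m. (1 / sqrt (2 * pi * \<sigma>\<^sup>2) / ((\<sigma>\<^sup>2) ^ m * fact m)) * ((exp (- x\<^sup>2 / (2 * \<sigma>\<^sup>2)) * x ^ m) *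
      (exp (- y\<^sup>2 / (2 * \<sigma>\<^sup>2)) * y ^ m)))
     sums normal_density 0 \<sigma> (x - y)"
proof -
  let ?c = "1 / sqrt (2 * pi * \<sigma>\<^sup>2) * (exp (- x\<^sup>2 / (2 * \<sigma>\<^sup>2)) * exp (- y\<^sup>2 / (2 * \<sigma>\<^sup>2)))"
  have "(\<lambda>m. ?c * ((x * y / \<sigma>\<^sup>2) ^ m /\<^sub>R fact m)) sums (?c * exp (x * y / \<sigma>\<^sup>2))"
    by (intro sums_mult exp_converges)
  moreover have "?c * exp (x * y / \<sigma>\<^sup>2) = normal_density 0 \<sigma> (x - y)"
  proof -
    have "- x\<^sup>2 / (2 * \<sigma>\<^sup>2) + - y\<^sup>2 / (2 * \<sigma>\<^sup>2) + x * y / \<sigma>\<^sup>2 = - (x - y)\<^sup>2 / (2 * \<sigma>\<^sup>2)"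
      using assms by (simp add: divide_simps power2_eq_square) (simp add: algebra_simps)
    then show ?thesis by (simp add: normal_density_def mult.assoc exp_add[symmetric])
  qed
  moreover have "?c * ((x * y / \<sigma>\<^sup>2) ^ m /\<^sub>R fact m) = (1 / sqrt (2 * pi * \<sigma>\<^sup>2) / ((\<sigma>\<^sup>2) ^ m * fact m)) *
      ((exp (- x\<^sup>2 / (2 * \<sigma>\<^sup>2)) * x ^ m) * (exp (- y\<^sup>2 / (2 * \<sigma>\<^sup>2)) * y ^ m))" for m
    by (simp add: power_divide power_mult_distrib field_simps)
  ultimately show ?thesis by simp
qed

text \<open>The kernel is a series of products: a quadratic form of a function of the matrix at
  \<eta>, times a trace over nonzero eigenvalues at \<zeta>. Each factor is measurable by
  itself.\<close>

lemma borel_measurable_Dk: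
  assumes \<sigma>: "0 < \<sigma>"
  shows "(\<lambda>p. Dk \<sigma> (fst p) (snd p)) \<in> borel_measurable (borel \<Otimes>\<^sub>M borel)"
proof -
  define c where "c m = 1 / sqrt (2 * pi * \<sigma>\<^sup>2) / ((\<sigma>\<^sup>2) ^ m * fact m)" for m :: nat
  define q where "q m x = exp (- x\<^sup>2 / (2 * \<sigma>\<^sup>2)) * x ^ m" for m :: nat and x :: real
  have nd: "(\<lambda>m. c m * (q m x * q m y)) sums normal_density 0 \<sigma> (x - y)" for x y
    unfolding c_def q_def by (rule normal_density_diff_sums[OF \<sigma>])
  have q: "continuous_on UNIV (q m)" for m
    unfolding q_def using \<sigma> by (intro continuous_intros) auto
  define A where "A m \<xi> = fcalc M (q m) \<xi> (f \<xi>) \<bullet> f \<xi>" for m \<xi>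
  define B where "B m \<xi> = (\<Sum>e\<in>Basis. fcalc M (\<lambda>t. if t = 0 then 0 else q m t) \<xi> e \<bullet> e)" for m \<xi>
  have [measurable]: "A m \<in> borel_measurable borel" for m
    unfolding A_def by (intro borel_measurable_inner borel_measurable_fcalc[OF h q]) auto
  have [measurable]: "B m \<in> borel_measurable borel" for m
    unfolding B_def by (intro borel_measurable_sum borel_measurable_inner borel_measurable_fcalc_nz[OF h
        q]) auto
  have A: "A m \<xi> = (\<Sum>a\<in>EB M \<xi>. q m (lam M \<xi> a) * (f \<xi> \<bullet> a)\<^sup>2)" for m \<xi>
    unfolding A_def fcalc_inner[OF h] by (simp add: power2_eq_square mult.assoc)
  have B: "B m \<xi> = (\<Sum>b\<in>EB M \<xi>. if lam M \<xi> b = 0 then 0 else q m (lam M \<xi> b))" for m \<xi>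
    unfolding B_def fcalc_trace[OF h] ..
  have "(\<lambda>m. c m * (A m \<eta> * B m \<zeta>)) sums Dk \<sigma> \<eta> \<zeta>" for \<eta> \<zeta>
  proof -
    have "(\<lambda>m. \<Sum>a\<in>EB M \<eta>. (f \<eta> \<bullet> a)\<^sup>2 * (\<Sum>b\<in>EB M \<zeta>. if lam M \<zeta> b = 0 then 0 else c m * (q m (lam M \<eta> a) *
        q m (lam M \<zeta> b))))
      sums Dk \<sigma> \<eta> \<zeta>"
      unfolding Dk_def dens_def by (intro sums_sum sums_mult) (auto intro: nd)
    moreover have "(\<Sum>a\<in>EB M \<eta>. (f \<eta> \<bullet> a)\<^sup>2 * (\<Sum>b\<in>EB M \<zeta>. if lam M \<zeta> b = 0 then 0 else c m * (q m (lam M \<eta>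
        a) * q m (lam M \<zeta> b))))
       = c m * (A m \<eta> * B m \<zeta>)" for m
      unfolding A B sum_product unfolding sum_distrib_left
      by (intro sum.cong refl) (auto simp: power2_eq_square)
    ultimately show ?thesis by simp
  qed
  then have "Dk \<sigma> \<eta> \<zeta> = (\<Sum>m. c m * (A m \<eta> * B m \<zeta>))" for \<eta> \<zeta> by (simp add: sums_iff)
  then show ?thesis by simp
qed

lemma borel_measurable_Dk':
  assumes \<sigma>: "0 < \<sigma>" and [measurable]: "a \<in> borel_measurable N" "b \<in> borel_measurable N"
  shows "(\<lambda>x. Dk \<sigma> (a x) (b x)) \<in> borel_measurable N"
  using measurable_compose[OF _ borel_measurable_Dk[OF \<sigma>], of "\<lambda>x. (a x, b x)" N] by simp

text \<open>The row bound for Schur's test. The estimate for \<open>dens\<close> does not depend on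
  \<nu>, so the eigenvalues at \<eta> drop out and the squared components sum to
  |f(\<eta>)|^2.\<close>

lemma Dk_gauss_le:
  assumes \<sigma>: "0 < \<sigma>" and d: "0 < d"
  shows "(\<integral>\<^sup>+\<zeta>. ennreal (gauss d (\<xi> - \<zeta>)) * ennreal (Dk \<sigma> \<eta> \<zeta>) \<partial>lborel)
     \<le> ennreal (Cg CARD('n) * (real DIM(complex^'k) / c0) / d) * ennreal ((norm (f \<eta>))\<^sup>2)"
proof -
  define C where "C = Cg CARD('n) * (real DIM(complex^'k) / c0) / d"
  have C: "C \<ge> 0" unfolding C_def using c0 d Cg_pos[of "CARD('n)"] by auto
  have "(\<integral>\<^sup>+\<zeta>. ennreal (gauss d (\<xi> - \<zeta>)) * ennreal (Dk \<sigma> \<eta> \<zeta>) \<partial>lborel)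
    = (\<integral>\<^sup>+\<zeta>. (\<Sum>a\<in>EB M \<eta>. ennreal ((f \<eta> \<bullet> a)\<^sup>2) * (ennreal (gauss d (\<xi> - \<zeta>)) * ennreal (dens \<sigma> (lam M \<eta> a)
        \<zeta>))) \<partial>lborel)"
    unfolding Dk_def
    by (intro nn_integral_cong) (simp add: sum_ennreal[symmetric] dens_nonneg ennreal_mult
        sum_distrib_left mult_ac)
  also have "\<dots> = (\<Sum>a\<in>EB M \<eta>. ennreal ((f \<eta> \<bullet> a)\<^sup>2) * (\<integral>\<^sup>+\<zeta>. ennreal (gauss d (\<xi> - \<zeta>)) * ennreal (dens \<sigma>
      (lam M \<eta> a) \<zeta>) \<partial>lborel))"
    by (subst nn_integral_sum) (auto simp: nn_integral_cmult)
  also have "\<dots> \<le> (\<Sum>a\<in>EB M \<eta>. ennreal ((f \<eta> \<bullet> a)\<^sup>2) * ennreal C)"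
    by (intro sum_mono mult_left_mono gauss_dens_le[OF \<sigma> d, folded C_def]) auto
  also have "\<dots> = ennreal (\<Sum>a\<in>EB M \<eta>. (f \<eta> \<bullet> a)\<^sup>2 * C)"
    using C by (subst sum_ennreal[symmetric]) (auto simp: ennreal_mult)
  also have "\<dots> = ennreal C * ennreal ((norm (f \<eta>))\<^sup>2)"
    unfolding sum_distrib_right[symmetric] EB_sum_squares[OF h] using C by (simp add: ennreal_mult
        mult.commute)
  finally show ?thesis unfolding C_def .
qed

definition U :: "real \<Rightarrow> real^'n \<Rightarrow> complex^'k" where
  "U t \<xi> = expM t (Mhom M \<xi>) (f \<xi>)"

definition Tk :: "real \<Rightarrow> real^'n \<Rightarrow> real^'n \<Rightarrow> real" where
  "Tk \<sigma> \<eta> \<zeta> = (LINT t|lborel. exp (- (\<sigma> * t)\<^sup>2 / 2) * (U t \<eta> \<bullet> U t \<zeta>))"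

lemma U_measurable[measurable (raw)]:
  assumes [measurable]: "t \<in> borel_measurable N" "\<xi> \<in> borel_measurable N"
  shows "(\<lambda>x. U (t x) (\<xi> x)) \<in> borel_measurable N"
  unfolding U_def by (intro borel_measurable_expM[OF h]) auto

lemma norm_U_le: "norm (U t \<xi>) \<le> real DIM(complex^'k) * norm (f \<xi>)"
  unfolding U_def by (rule norm_expM_le[OF h])

text \<open>Both factors expand in eigenvectors; each pair contributes a cosine and a sine of its
  eigenvalue difference. Against the Gaussian in time the cosine gives 2 pi times a normal density
  and the sine gives 0.\<close>

lemma Tk_eq:
  assumes \<sigma>: "0 < \<sigma>"
  shows "Tk \<sigma> \<eta> \<zeta> = (\<Sum>a\<in>EB M \<eta>. \<Sum>b\<in>EB M \<zeta>. (f \<eta> \<bullet> a) * (f \<zeta> \<bullet> b) * (2 * pi * normal_density 0 \<sigma> (lam M \<eta>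
      a - lam M \<zeta> b) * (a \<bullet> b)))"
proof -
  have "\<exists>s. \<forall>a b \<alpha> \<beta>. (exp (- \<i> * complex_of_real \<alpha>) *s a) \<bullet> (exp (- \<i> * complex_of_real \<beta>) *s b)
     = cos (\<alpha> - \<beta>) * (a \<bullet> (b::complex^'k)) + sin (\<alpha> - \<beta>) * s a b"
    using inner_rotation by metis
  then obtain s where s: "\<And>a b \<alpha> \<beta>. (exp (- \<i> * complex_of_real \<alpha>) *s a) \<bullet> (exp (- \<i> * complex_of_real \<beta>)
      *s b)
     = cos (\<alpha> - \<beta>) * (a \<bullet> (b::complex^'k)) + sin (\<alpha> - \<beta>) * s a b" by blast
  let ?E = "\<lambda>t. exp (- (\<sigma> * t)\<^sup>2 / 2)"
  let ?y = "\<lambda>a b. lam M \<eta> a - lam M \<zeta> b"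
  have "?E t * (U t \<eta> \<bullet> U t \<zeta>) = (\<Sum>a\<in>EB M \<eta>. \<Sum>b\<in>EB M \<zeta>. (f \<eta> \<bullet> a) * (f \<zeta> \<bullet> b) *
      (?E t * cos (t * ?y a b) * (a \<bullet> b) + ?E t * sin (t * ?y a b) * s a b))" for t
    unfolding U_def expM_EB[OF h] inner_sum_left inner_sum_right inner_scaleR_left inner_scaleR_right s
        sum_distrib_left
    by (subst sum.swap) (intro sum.cong refl, simp add: algebra_simps)
  then have "Tk \<sigma> \<eta> \<zeta> = (LINT t|lborel. (\<Sum>a\<in>EB M \<eta>. \<Sum>b\<in>EB M \<zeta>. (f \<eta> \<bullet> a) * (f \<zeta> \<bullet> b) *
      (?E t * cos (t * ?y a b) * (a \<bullet> b) + ?E t * sin (t * ?y a b) * s a b)))"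
    unfolding Tk_def by presburger
  also have "\<dots> = (\<Sum>a\<in>EB M \<eta>. \<Sum>b\<in>EB M \<zeta>. (f \<eta> \<bullet> a) * (f \<zeta> \<bullet> b) * (2 * pi * normal_density 0 \<sigma> (?y a b) *
      (a \<bullet> b)))"
  proof -
    have hb: "has_bochner_integral lborel (\<lambda>t. ?E t * cos (t * y)) (2 * pi * normal_density 0 \<sigma> y)"
      "has_bochner_integral lborel (\<lambda>t. ?E t * sin (t * y)) 0" for y
      using integral_exp_cos_sin[OF \<sigma>, of y] by (auto simp: has_bochner_integral_iff)
    have "has_bochner_integral lborel (\<lambda>t. \<Sum>a\<in>EB M \<eta>. \<Sum>b\<in>EB M \<zeta>. (f \<eta> \<bullet> a) * (f \<zeta> \<bullet> b) *
      (?E t * cos (t * ?y a b) * (a \<bullet> b) + ?E t * sin (t * ?y a b) * s a b))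
     (\<Sum>a\<in>EB M \<eta>. \<Sum>b\<in>EB M \<zeta>. (f \<eta> \<bullet> a) * (f \<zeta> \<bullet> b) * (2 * pi * normal_density 0 \<sigma> (?y a b) * (a \<bullet> b) + 0 *
         s a b))"
      by (intro has_bochner_integral_sum has_bochner_integral_mult_right has_bochner_integral_add
          has_bochner_integral_mult_left hb)
    then show ?thesis by (simp add: has_bochner_integral_iff)
  qed
  finally show ?thesis .
qed

text \<open>The inequality 2 |x y| \<le> x^2 + y^2 distributes each term over the two frequencies,
  and |a \<bullet> b| \<le> 1. A pair with a zero eigenvalue contributes nothing, since
  \<open>orth\<close> annihilates the corresponding component; this is why \<open>dens\<close> may
  omit zero.\<close>

lemma abs_Tk_le:
  assumes \<sigma>: "0 < \<sigma>"
  shows "\<bar>Tk \<sigma> \<eta> \<zeta>\<bar> \<le> pi * (Dk \<sigma> \<eta> \<zeta> + Dk \<sigma> \<zeta> \<eta>)"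
proof -
  let ?n = "\<lambda>a b. normal_density 0 \<sigma> (lam M \<eta> a - lam M \<zeta> b)"
  let ?A = "\<lambda>a b. (f \<eta> \<bullet> a)\<^sup>2 * (if lam M \<zeta> b = 0 then 0 else ?n a b)"
  let ?B = "\<lambda>a b. (f \<zeta> \<bullet> b)\<^sup>2 * (if lam M \<eta> a = 0 then 0 else ?n a b)"
  have "\<bar>(f \<eta> \<bullet> a) * (f \<zeta> \<bullet> b) * (2 * pi * ?n a b * (a \<bullet> b))\<bar> \<le> pi * (?A a b + ?B a b)"
    if a: "a \<in> EB M \<eta>" and b: "b \<in> EB M \<zeta>" for a b
  proof (cases "lam M \<eta> a = 0 \<or> lam M \<zeta> b = 0")
    case True
    then show ?thesis using orth[OF a] orth[OF b] by auto
  next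
    case False
    have "\<bar>a \<bullet> b\<bar> \<le> 1" using Cauchy_Schwarz_ineq2[of a b] EB_norm[OF h a] EB_norm[OF h b] by simp
    then have "\<bar>(f \<eta> \<bullet> a) * (f \<zeta> \<bullet> b)\<bar> * (2 * pi * ?n a b) * \<bar>a \<bullet> b\<bar> \<le> \<bar>(f \<eta> \<bullet> a) * (f \<zeta> \<bullet> b)\<bar> * (2 * pi
        * ?n a b)"
      by (intro mult_left_le) auto
    also have "\<dots> = pi * ?n a b * (2 * \<bar>f \<eta> \<bullet> a\<bar> * \<bar>f \<zeta> \<bullet> b\<bar>)" by (simp add: abs_mult)
    also have "\<dots> \<le> pi * ?n a b * (\<bar>f \<eta> \<bullet> a\<bar>\<^sup>2 + \<bar>f \<zeta> \<bullet> b\<bar>\<^sup>2)"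
      by (intro mult_left_mono sum_squares_bound) auto
    finally show ?thesis using False by (simp add: abs_mult algebra_simps)
  qed
  then have "\<bar>Tk \<sigma> \<eta> \<zeta>\<bar> \<le> (\<Sum>a\<in>EB M \<eta>. \<Sum>b\<in>EB M \<zeta>. pi * (?A a b + ?B a b))"
    unfolding Tk_eq[OF \<sigma>] by (intro order_trans[OF sum_abs] sum_mono) (auto intro!: order_trans[OF
        sum_abs] sum_mono)
  also have "\<dots> = pi * ((\<Sum>a\<in>EB M \<eta>. \<Sum>b\<in>EB M \<zeta>. ?A a b) + (\<Sum>a\<in>EB M \<eta>. \<Sum>b\<in>EB M \<zeta>. ?B a b))"
    by (simp add: sum_distrib_left sum.distrib distrib_left)
  also have "(\<Sum>a\<in>EB M \<eta>. \<Sum>b\<in>EB M \<zeta>. ?A a b) = Dk \<sigma> \<eta> \<zeta>"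
    by (simp add: Dk_def dens_def sum_distrib_left)
  also have "(\<Sum>a\<in>EB M \<eta>. \<Sum>b\<in>EB M \<zeta>. ?B a b) = (\<Sum>b\<in>EB M \<zeta>. \<Sum>a\<in>EB M \<eta>. ?B a b)" by (rule sum.swap)
  also have "\<dots> = Dk \<sigma> \<zeta> \<eta>"
    unfolding Dk_def dens_def sum_distrib_left by (intro sum.cong refl) (simp add: normal_density_def
        power2_commute)
  finally show ?thesis .
qed


section \<open>From the pair kernel to the space-time integral\<close>

lemma integrable_gauss_norm_f:
  assumes d: "0 < d" shows "integrable lborel (\<lambda>\<eta>. gauss d (\<xi> - \<eta>) * norm (f \<eta>))"
  using sq_int_integrable_mult[OF sq_int_lborel_diff(2)[OF sq_int_gauss[OF d], of \<xi>] f] by simp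

definition Wk :: "real \<Rightarrow> real \<Rightarrow> real^'n \<Rightarrow> real \<Rightarrow> (real^'n) \<times> (real^'n) \<Rightarrow> real" where
  "Wk \<sigma> d \<xi> t p = exp (- (\<sigma> * t)\<^sup>2 / 2) * ((gauss d (\<xi> - fst p) * gauss d (\<xi> - snd p)) * (U t (fst p) \<bullet> U
      t (snd p)))"

lemma abs_inner_U_le: "\<bar>U t \<eta> \<bullet> U t \<zeta>\<bar> \<le> (real DIM(complex^'k))\<^sup>2 * (norm (f \<eta>) * norm (f \<zeta>))"
proof -
  have "\<bar>U t \<eta> \<bullet> U t \<zeta>\<bar> \<le> norm (U t \<eta>) * norm (U t \<zeta>)" by (rule Cauchy_Schwarz_ineq2)
  also have "\<dots> \<le> (real DIM(complex^'k) * norm (f \<eta>)) * (real DIM(complex^'k) * norm (f \<zeta>))"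
    by (intro mult_mono norm_U_le) auto
  finally show ?thesis by (simp add: power2_eq_square mult_ac)
qed

text \<open>The majorant factors into a Gaussian in t and two integrable functions of frequency. All
  decay in t comes from the Gaussian, as the bound on the evolution is uniform in time.\<close>

lemma integrable_Wk_pair:
  assumes \<sigma>: "0 < \<sigma>" and d: "0 < d"
  shows "integrable (lborel \<Otimes>\<^sub>M (lborel \<Otimes>\<^sub>M lborel)) (\<lambda>(t, p). Wk \<sigma> d \<xi> t p)"
proof -
  let ?K = "(real DIM(complex^'k))\<^sup>2"
  let ?g = "\<lambda>\<eta>. gauss d (\<xi> - \<eta>) * norm (f \<eta>)"
  have g: "integrable lborel (\<lambda>\<eta>. complex_of_real (?g \<eta>))"
    using integrable_gauss_norm_f[OF d] by (rule integrable_of_real)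
  have e: "integrable lborel (\<lambda>t::real. complex_of_real (?K * exp (- (\<sigma> * norm t)\<^sup>2 / 2)))"
    by (intro integrable_of_real integrable_mult_right integrable_exp_norm \<sigma>)
  have sf: "sigma_finite_measure (lborel \<Otimes>\<^sub>M lborel :: ((real^'n) \<times> (real^'n)) measure)"
    unfolding lborel_prod by (rule sigma_finite_lborel)
  have "integrable (lborel \<Otimes>\<^sub>M (lborel \<Otimes>\<^sub>M lborel)) (\<lambda>q. complex_of_real (?K * exp (- (\<sigma> * norm (fst q ::
      real))\<^sup>2 / 2)) *
      (complex_of_real (?g (fst (snd q))) * complex_of_real (?g (snd (snd q)))))"
    by (rule integrable_mult_pair[OF sigma_finite_lborel sf e integrable_mult_pair[OF sigma_finite_lborel
        sigma_finite_lborel g g]])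
  then show ?thesis
  proof (rule Bochner_Integration.integrable_bound)
    show "(\<lambda>(t, p). Wk \<sigma> d \<xi> t p) \<in> borel_measurable (lborel \<Otimes>\<^sub>M (lborel \<Otimes>\<^sub>M lborel))"
      unfolding Wk_def by measurable
    have "\<bar>Wk \<sigma> d \<xi> t (\<eta>, \<zeta>)\<bar> \<le> ?K * exp (- (\<sigma> * norm t)\<^sup>2 / 2) * (?g \<eta> * ?g \<zeta>)" for t \<eta> \<zeta>
    proof -
      have "\<bar>Wk \<sigma> d \<xi> t (\<eta>, \<zeta>)\<bar> = exp (- (\<sigma> * t)\<^sup>2 / 2) * (gauss d (\<xi> - \<eta>) * gauss d (\<xi> - \<zeta>)) * \<bar>U t \<eta> \<bullet>
          U t \<zeta>\<bar>"
        by (simp add: Wk_def abs_mult)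
      also have "\<dots> \<le> exp (- (\<sigma> * t)\<^sup>2 / 2) * (gauss d (\<xi> - \<eta>) * gauss d (\<xi> - \<zeta>)) * (?K * (norm (f \<eta>) *
          norm (f \<zeta>)))"
        by (intro mult_left_mono abs_inner_U_le) auto
      finally show ?thesis by (simp add: power_mult_distrib mult_ac)
    qed
    then show "AE q in lborel \<Otimes>\<^sub>M (lborel \<Otimes>\<^sub>M lborel). norm (case q of (t, p) \<Rightarrow> Wk \<sigma> d \<xi> t p)
        \<le> norm (complex_of_real (?K * exp (- (\<sigma> * norm (fst q))\<^sup>2 / 2)) *
      (complex_of_real (?g (fst (snd q))) * complex_of_real (?g (snd (snd q)))))"
      by (intro AE_I2) (auto simp: norm_mult abs_mult simp del: of_real_mult split: prod.splits)
  qed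
qed

lemma integrable_gauss_U:
  assumes d: "0 < d" shows "integrable lborel (\<lambda>\<eta>. gauss d (\<xi> - \<eta>) *\<^sub>R U t \<eta>)"
proof (rule Bochner_Integration.integrable_bound)
  show "integrable lborel (\<lambda>\<eta>. real DIM(complex^'k) * (gauss d (\<xi> - \<eta>) * norm (f \<eta>)))"
    by (intro integrable_mult_right integrable_gauss_norm_f d)
  show "AE \<eta> in lborel. norm (gauss d (\<xi> - \<eta>) *\<^sub>R U t \<eta>) \<le> norm (real DIM(complex^'k) * (gauss d (\<xi> - \<eta>)
      * norm (f \<eta>)))"
    using norm_U_le[of t] by (intro AE_I2) (auto simp: abs_mult mult.left_commute[of _ "gauss _ _"] simp
        del: DIM_cart intro!: mult_left_mono)
qed measurable

text \<open>The square of an integral is a double integral, obtained by moving the inner product out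
  of one variable and then the other.\<close>

lemma gconv_U_square:
  assumes \<sigma>: "0 < \<sigma>" and d: "0 < d"
  shows "(LINT p|(lborel \<Otimes>\<^sub>M lborel). Wk \<sigma> d \<xi> t p) = exp (- (\<sigma> * t)\<^sup>2 / 2) * (norm (gconv d (U t) \<xi>))\<^sup>2"
proof -
  let ?V = "gconv d (U t) \<xi>"
  let ?F = "\<lambda>\<eta>. gauss d (\<xi> - \<eta>) *\<^sub>R U t \<eta>"
  have i: "integrable lborel ?F" by (rule integrable_gauss_U[OF d])
  have ip: "integrable (lborel \<Otimes>\<^sub>M lborel) (Wk \<sigma> d \<xi> t)"
  proof (rule Bochner_Integration.integrable_bound)
    show "integrable (lborel \<Otimes>\<^sub>M lborel) (\<lambda>p. complex_of_real (norm (?F (fst p))) * complex_of_real (norm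
        (?F (snd p))))"
      using i by (intro integrable_mult_pair sigma_finite_lborel integrable_of_real integrable_norm)
    show "Wk \<sigma> d \<xi> t \<in> borel_measurable (lborel \<Otimes>\<^sub>M lborel)" unfolding Wk_def[abs_def] by measurable
    have "\<bar>Wk \<sigma> d \<xi> t (\<eta>, \<zeta>)\<bar> \<le> norm (?F \<eta>) * norm (?F \<zeta>)" for \<eta> \<zeta>
    proof -
      have "Wk \<sigma> d \<xi> t (\<eta>, \<zeta>) = exp (- (\<sigma> * t)\<^sup>2 / 2) * (?F \<eta> \<bullet> ?F \<zeta>)" by (simp add: Wk_def mult_ac)
      then have "\<bar>Wk \<sigma> d \<xi> t (\<eta>, \<zeta>)\<bar> = exp (- (\<sigma> * t)\<^sup>2 / 2) * \<bar>?F \<eta> \<bullet> ?F \<zeta>\<bar>" by (simp only: abs_mult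
          abs_exp_cancel)
      also have "\<dots> \<le> \<bar>?F \<eta> \<bullet> ?F \<zeta>\<bar>" by (intro mult_left_le_one_le) auto
      also have "\<dots> \<le> norm (?F \<eta>) * norm (?F \<zeta>)" by (rule Cauchy_Schwarz_ineq2)
      finally show ?thesis .
    qed
    then show "AE p in lborel \<Otimes>\<^sub>M lborel. norm (Wk \<sigma> d \<xi> t p) \<le> norm (complex_of_real (norm (?F (fst p)))
        * complex_of_real (norm (?F (snd p))))"
      by (intro AE_I2) (simp only: norm_mult norm_of_real abs_norm_cancel real_norm_def, metis prod.collapse)
  qed
  have "(LINT p|(lborel \<Otimes>\<^sub>M lborel). Wk \<sigma> d \<xi> t p) = (LINT \<eta>|lborel. LINT \<zeta>|lborel. Wk \<sigma> d \<xi> t (\<eta>, \<zeta>))"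
    by (rule lborel_pair.integral_fst'[OF ip, symmetric])
  also have "\<dots> = (LINT \<eta>|lborel. exp (- (\<sigma> * t)\<^sup>2 / 2) * (?F \<eta> \<bullet> ?V))"
  proof (rule Bochner_Integration.integral_cong[OF refl])
    fix \<eta>
    have "(LINT \<zeta>|lborel. Wk \<sigma> d \<xi> t (\<eta>, \<zeta>)) = (LINT \<zeta>|lborel. exp (- (\<sigma> * t)\<^sup>2 / 2) * (?F \<eta> \<bullet> ?F \<zeta>))"
      by (simp add: Wk_def mult_ac)
    also have "\<dots> = exp (- (\<sigma> * t)\<^sup>2 / 2) * (LINT \<zeta>|lborel. ?F \<eta> \<bullet> ?F \<zeta>)" by (rule integral_mult_right_zero)
    also have "(LINT \<zeta>|lborel. ?F \<eta> \<bullet> ?F \<zeta>) = ?F \<eta> \<bullet> ?V"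
      unfolding gconv_def by (rule integral_inner_right) (use i in auto)
    finally show "(LINT \<zeta>|lborel. Wk \<sigma> d \<xi> t (\<eta>, \<zeta>)) = exp (- (\<sigma> * t)\<^sup>2 / 2) * (?F \<eta> \<bullet> ?V)" .
  qed
  also have "\<dots> = exp (- (\<sigma> * t)\<^sup>2 / 2) * (LINT \<eta>|lborel. ?F \<eta> \<bullet> ?V)" by (rule integral_mult_right_zero)
  also have "(LINT \<eta>|lborel. ?F \<eta> \<bullet> ?V) = ?V \<bullet> ?V"
    unfolding gconv_def by (rule integral_inner_left) (use i in auto)
  finally show ?thesis by (simp add: power2_norm_eq_inner)
qed

text \<open>Fubini moves the time integral inside, where it produces \<open>Tk\<close>. The two
  halves of its bound exchange \<eta> and \<zeta>, while the Gaussian factors are symmetric; both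
  give the same integral, so pi becomes 2 pi.\<close>

lemma time_integral_le:
  assumes \<sigma>: "0 < \<sigma>" and d: "0 < d"
  shows "(\<integral>\<^sup>+t. ennreal (exp (- (\<sigma> * t)\<^sup>2 / 2) * (norm (gconv d (U t) \<xi>))\<^sup>2) \<partial>lborel)
    \<le> ennreal (2 * pi) * (\<integral>\<^sup>+\<eta>. ennreal (gauss d (\<xi> - \<eta>)) * (\<integral>\<^sup>+\<zeta>. ennreal (gauss d (\<xi> - \<zeta>)) * ennreal
        (Dk \<sigma> \<eta> \<zeta>) \<partial>lborel) \<partial>lborel)"
proof -
  note [measurable (raw)] = borel_measurable_Dk'[OF \<sigma>]
  interpret P: pair_sigma_finite "lborel :: real measure" "lborel \<Otimes>\<^sub>M lborel :: ((real^'n) \<times> (real^'n))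
      measure"
    unfolding lborel_prod ..
  let ?g = "\<lambda>\<eta>. gauss d (\<xi> - \<eta>)"
  let ?D = "\<lambda>p. ennreal (?g (fst p)) * (ennreal (?g (snd p)) * ennreal (Dk \<sigma> (fst p) (snd p)))"
  let ?D' = "\<lambda>p. ennreal (?g (fst p)) * (ennreal (?g (snd p)) * ennreal (Dk \<sigma> (snd p) (fst p)))"
  let ?T = "\<lambda>p. ?g (fst p) * ?g (snd p) * Tk \<sigma> (fst p) (snd p)"
  let ?W = "\<lambda>t. exp (- (\<sigma> * t)\<^sup>2 / 2) * (norm (gconv d (U t) \<xi>))\<^sup>2"
  let ?I = "(\<integral>\<^sup>+\<eta>. ennreal (?g \<eta>) * (\<integral>\<^sup>+\<zeta>. ennreal (?g \<zeta>) * ennreal (Dk \<sigma> \<eta> \<zeta>) \<partial>lborel) \<partial>lborel)"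
  have two_pi: "ennreal pi * (x + x) = ennreal (2 * pi) * x" for x
    unfolding mult_2 by (subst ennreal_plus) (auto simp: distrib_left distrib_right)
  have m1: "?D \<in> borel_measurable (lborel \<Otimes>\<^sub>M lborel)"
    and m2: "?D' \<in> borel_measurable (lborel \<Otimes>\<^sub>M lborel)"
    by measurable
  have i: "integrable (lborel \<Otimes>\<^sub>M (lborel \<Otimes>\<^sub>M lborel)) (case_prod (Wk \<sigma> d \<xi>))"
    using integrable_Wk_pair[OF \<sigma> d] .
  have T: "(LINT t|lborel. Wk \<sigma> d \<xi> t p) = ?T p" for p
  proof -
    have "(LINT t|lborel. Wk \<sigma> d \<xi> t p) = (LINT t|lborel. (?g (fst p) * ?g (snd p)) * (exp (- (\<sigma> * t)\<^sup>2 /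
        2) * (U t (fst p) \<bullet> U t (snd p))))"
      unfolding Wk_def by (simp only: mult_ac)
    then show ?thesis unfolding Tk_def by simp
  qed
  have iT: "integrable (lborel \<Otimes>\<^sub>M lborel) ?T"
    using P.integrable_snd[OF i] unfolding T .
  have it: "integrable lborel ?W"
    using P.integrable_fst[OF i] unfolding gconv_U_square[OF \<sigma> d] .
  have "(\<integral>\<^sup>+t. ennreal (?W t) \<partial>lborel)
     = ennreal (LINT t|lborel. ?W t)"
    by (rule nn_integral_eq_integral[OF it]) auto
  also have "(LINT t|lborel. ?W t) = (LINT p|(lborel \<Otimes>\<^sub>M lborel). ?T p)"
    unfolding gconv_U_square[OF \<sigma> d, symmetric] T[symmetric] by (rule P.Fubini_integral[OF i, symmetric])
  \<comment> \<open>Moduli are taken only now, after integration in time: the oscillation has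
    already been turned into concentration where eigenvalues agree.\<close>
  also have "ennreal \<dots> \<le> ennreal (LINT p|(lborel \<Otimes>\<^sub>M lborel). norm (?T p))"
    by (intro ennreal_leI order_trans[OF _ integral_norm_bound]) auto
  also have "\<dots> = (\<integral>\<^sup>+p. ennreal (norm (?T p)) \<partial>(lborel \<Otimes>\<^sub>M lborel))"
    by (rule nn_integral_eq_integral[symmetric]) (use iT in auto)
  also have "\<dots> \<le> (\<integral>\<^sup>+p. ennreal pi * (?D p
        + ?D' p) \<partial>(lborel \<Otimes>\<^sub>M lborel))"
  proof (rule nn_integral_mono)
    fix p :: "(real^'n) \<times> (real^'n)"
    have "norm (?T p) \<le> ?g (fst p) * ?g (snd p) * (pi * (Dk \<sigma> (fst p) (snd p) + Dk \<sigma> (snd p) (fst p)))"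
      using abs_Tk_le[OF \<sigma>, of "fst p" "snd p"] by (auto simp: abs_mult intro!: mult_left_mono)
    also have "\<dots> = pi * (?g (fst p) * (?g (snd p) * Dk \<sigma> (fst p) (snd p)) + ?g (fst p) * (?g (snd p) * Dk
        \<sigma> (snd p) (fst p)))"
      by (simp add: algebra_simps)
    finally show "ennreal (norm (?T p)) \<le> ennreal pi * (?D p
        + ?D' p)"
      by (simp add: ennreal_mult[symmetric] ennreal_plus[symmetric] Dk_nonneg ennreal_leI del: ennreal_plus)
  qed
  also have "\<dots> = ennreal pi * ((\<integral>\<^sup>+p. ?D p \<partial>(lborel \<Otimes>\<^sub>M lborel))
      + (\<integral>\<^sup>+p. ?D' p \<partial>(lborel \<Otimes>\<^sub>M lborel)))"
    by (subst nn_integral_cmult, measurable, subst nn_integral_add, measurable)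
  also have "(\<integral>\<^sup>+p. ?D p \<partial>(lborel \<Otimes>\<^sub>M lborel))
      = ?I" (is "?L = _")
  proof -
    have "?L = (\<integral>\<^sup>+\<eta>. (\<integral>\<^sup>+\<zeta>. ennreal (?g \<eta>) * (ennreal (?g \<zeta>) * ennreal (Dk \<sigma> \<eta> \<zeta>)) \<partial>lborel) \<partial>lborel)"
      using lborel.nn_integral_fst[OF m1] by simp
    also have "\<dots> = ?I" by (intro nn_integral_cong nn_integral_cmult) measurable
    finally show ?thesis .
  qed
  also have "(\<integral>\<^sup>+p. ?D' p \<partial>(lborel \<Otimes>\<^sub>M lborel))
      = ?I" (is "?L = _")
  proof -
    have "?L = (\<integral>\<^sup>+\<eta>. (\<integral>\<^sup>+\<zeta>. ennreal (?g \<zeta>) * (ennreal (?g \<eta>) * ennreal (Dk \<sigma> \<eta> \<zeta>)) \<partial>lborel) \<partial>lborel)"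
      using lborel_pair.nn_integral_snd[OF m2] by simp
    also have "\<dots> = (\<integral>\<^sup>+\<eta>. (\<integral>\<^sup>+\<zeta>. ennreal (?g \<eta>) * (ennreal (?g \<zeta>) * ennreal (Dk \<sigma> \<eta> \<zeta>)) \<partial>lborel) \<partial>lborel)"
      by (simp only: mult_ac)
    also have "\<dots> = ?I" by (intro nn_integral_cong nn_integral_cmult) measurable
    finally show ?thesis .
  qed
  finally show ?thesis unfolding two_pi .
qed

text \<open>The \<zeta>-integral is controlled by the row bound, then the \<xi>-integral of the
  remaining Gaussian is 1, which leaves the squared norm of f. The constant does not involve
  \<sigma>.\<close>

lemma weighted_spacetime_le:
  assumes \<sigma>: "0 < \<sigma>" and d: "0 < d"
  shows "(\<integral>\<^sup>+t. (\<integral>\<^sup>+\<xi>. ennreal (exp (- (\<sigma> * t)\<^sup>2 / 2) * (norm (gconv d (U t) \<xi>))\<^sup>2) \<partial>lborel) \<partial>lborel)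
    \<le> ennreal (2 * pi * (Cg CARD('n) * (real DIM(complex^'k) / c0) / d)) * l2sq f"
proof -
  define C where "C = Cg CARD('n) * (real DIM(complex^'k) / c0) / d"
  have C: "C \<ge> 0" unfolding C_def using c0 d Cg_pos[of "CARD('n)"] by auto
  note [measurable (raw)] = borel_measurable_Dk'[OF \<sigma>]
  have "(\<integral>\<^sup>+t. (\<integral>\<^sup>+\<xi>. ennreal (exp (- (\<sigma> * t)\<^sup>2 / 2) * (norm (gconv d (U t) \<xi>))\<^sup>2) \<partial>lborel) \<partial>lborel)
     = (\<integral>\<^sup>+\<xi>. (\<integral>\<^sup>+t. ennreal (exp (- (\<sigma> * t)\<^sup>2 / 2) * (norm (gconv d (U t) \<xi>))\<^sup>2) \<partial>lborel) \<partial>lborel)"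
    unfolding gconv_def by (rule lborel_pair.Fubini') measurable
  also have "\<dots> \<le> (\<integral>\<^sup>+\<xi>. ennreal (2 * pi) * (\<integral>\<^sup>+\<eta>. ennreal (gauss d (\<xi> - \<eta>)) * (ennreal C * ennreal ((norm
      (f \<eta>))\<^sup>2)) \<partial>lborel) \<partial>lborel)"
    by (intro nn_integral_mono order_trans[OF time_integral_le[OF \<sigma> d]] mult_left_mono
         Dk_gauss_le[OF \<sigma> d, folded C_def]) auto
  also have "\<dots> = (\<integral>\<^sup>+\<xi>. (\<integral>\<^sup>+\<eta>. ennreal (2 * pi) * (ennreal (gauss d (\<xi> - \<eta>)) * (ennreal C * ennreal
      ((norm (f \<eta>))\<^sup>2))) \<partial>lborel) \<partial>lborel)"
    by (intro nn_integral_cong nn_integral_cmult[symmetric]) measurable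
  also have "\<dots> = (\<integral>\<^sup>+\<eta>. (\<integral>\<^sup>+\<xi>. ennreal (2 * pi) * (ennreal (gauss d (\<xi> - \<eta>)) * (ennreal C * ennreal
      ((norm (f \<eta>))\<^sup>2))) \<partial>lborel) \<partial>lborel)"
    by (rule lborel_pair.Fubini') measurable
  also have "\<dots> = (\<integral>\<^sup>+\<eta>. ennreal (2 * pi * C) * ennreal ((norm (f \<eta>))\<^sup>2) \<partial>lborel)"
  proof (rule nn_integral_cong)
    fix \<eta>
    have "(\<integral>\<^sup>+\<xi>. ennreal (2 * pi) * (ennreal (gauss d (\<xi> - \<eta>)) * (ennreal C * ennreal ((norm (f \<eta>))\<^sup>2)))
        \<partial>lborel)
       = (\<integral>\<^sup>+\<xi>. ennreal (gauss d (\<xi> - \<eta>)) * (ennreal (2 * pi) * (ennreal C * ennreal ((norm (f \<eta>))\<^sup>2)))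
           \<partial>lborel)"
      by (simp only: mult_ac)
    also have "\<dots> = (\<integral>\<^sup>+\<xi>. ennreal (gauss d (\<xi> - \<eta>)) \<partial>lborel) * (ennreal (2 * pi) * (ennreal C * ennreal
        ((norm (f \<eta>))\<^sup>2)))"
      by (rule nn_integral_multc) measurable
    also have "\<dots> = ennreal (2 * pi * C) * ennreal ((norm (f \<eta>))\<^sup>2)"
      unfolding nn_integral_gauss_diff[OF d] using C by (simp add: ennreal_mult' mult.assoc[symmetric])
    finally show "(\<integral>\<^sup>+\<xi>. ennreal (2 * pi) * (ennreal (gauss d (\<xi> - \<eta>)) * (ennreal C * ennreal ((norm (f
        \<eta>))\<^sup>2))) \<partial>lborel)
       = ennreal (2 * pi * C) * ennreal ((norm (f \<eta>))\<^sup>2)" .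
  qed
  also have "\<dots> = ennreal (2 * pi * C) * l2sq f"
    unfolding l2sq_def nsq_def by (subst nn_integral_cmult) auto
  finally show ?thesis unfolding C_def .
qed

text \<open>Fatou's lemma along \<sigma> = 1/(k + 1) removes the damping, because the preceding
  bound is independent of \<sigma>.\<close>

lemma spacetime_le:
  assumes d: "0 < d"
  shows "(\<integral>\<^sup>+t. (\<integral>\<^sup>+\<xi>. ennreal ((norm (gconv d (U t) \<xi>))\<^sup>2) \<partial>lborel) \<partial>lborel)
    \<le> ennreal (2 * pi * (Cg CARD('n) * (real DIM(complex^'k) / c0) / d)) * l2sq f" (is "_ \<le> ?R")
proof -
  define s where "s k = 1 / real (Suc k)" for k
  have s: "\<And>k. 0 < s k" "s \<longlonglongrightarrow> 0" unfolding s_def using LIMSEQ_inverse_real_of_nat by (auto simp: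
      inverse_eq_divide)
  let ?G = "\<lambda>t. (\<integral>\<^sup>+\<xi>. ennreal ((norm (gconv d (U t) \<xi>))\<^sup>2) \<partial>lborel)"
  have mG: "?G \<in> borel_measurable lborel" unfolding gconv_def by measurable
  have mg: "(\<lambda>\<xi>. ennreal ((norm (gconv d (U t) \<xi>))\<^sup>2)) \<in> borel_measurable lborel" for t unfolding
      gconv_def by measurable
  have eq: "(\<integral>\<^sup>+\<xi>. ennreal (exp (- (s k * t)\<^sup>2 / 2) * (norm (gconv d (U t) \<xi>))\<^sup>2) \<partial>lborel) = ennreal (exp
      (- (s k * t)\<^sup>2 / 2)) * ?G t" for k t
    by (simp only: ennreal_mult' exp_ge_zero nn_integral_cmult[OF mg])
  have "(\<integral>\<^sup>+t. ?G t \<partial>lborel) = (\<integral>\<^sup>+t. liminf (\<lambda>k. ennreal (exp (- (s k * t)\<^sup>2 / 2)) * ?G t) \<partial>lborel)"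
  proof (rule nn_integral_cong)
    fix t :: real
    have "(\<lambda>k. ennreal (exp (- (s k * t)\<^sup>2 / 2))) \<longlonglongrightarrow> ennreal (exp (- (0 * t)\<^sup>2 / 2))"
      by (intro tendsto_intros s(2)) auto
    then have "(\<lambda>k. ennreal (exp (- (s k * t)\<^sup>2 / 2)) * ?G t) \<longlonglongrightarrow> ennreal (exp (- (0 * t)\<^sup>2 / 2)) * ?G t"
      by (intro tendsto_mult_ennreal tendsto_const) auto
    from lim_imp_Liminf[OF trivial_limit_sequentially this]
    show "?G t = liminf (\<lambda>k. ennreal (exp (- (s k * t)\<^sup>2 / 2)) * ?G t)" by simp
  qed
  also have "\<dots> \<le> liminf (\<lambda>k. \<integral>\<^sup>+t. ennreal (exp (- (s k * t)\<^sup>2 / 2)) * ?G t \<partial>lborel)"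
    by (intro nn_integral_liminf borel_measurable_times_ennreal mG) auto
  also have "\<dots> \<le> liminf (\<lambda>k. ?R)"
    using weighted_spacetime_le[OF s(1) d] unfolding eq by (intro Liminf_mono always_eventually) auto
  also have "\<dots> = ?R" by (simp add: Liminf_const)
  finally show ?thesis .
qed

end

end

section \<open>The kernel of the operator and the polynomial weight\<close>

lemma Re_cinner: "Re (\<Sum>i\<in>UNIV. x $ i * cnj (y $ i)) = x \<bullet> (y :: complex^'k::finite)"
  by (simp add: inner_vec_def inner_complex_def)

lemma Re_inner_L2:
  fixes f g :: "real^'n::finite \<Rightarrow> complex^'k::finite"
  assumes "sq_int f" "sq_int g"
  shows "Re (inner_L2 f g) = (LINT x|lborel. f x \<bullet> g x)" and "integrable lborel (\<lambda>x. f x \<bullet> g x)"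
  using integrable_Re[OF integrable_cinner[OF assms]] integral_Re[OF integrable_cinner[OF assms]]
  unfolding inner_L2_def Re_cinner by auto

context
  fixes M :: "'n::finite \<Rightarrow> complex^'k^'k::finite"
  assumes h: "\<forall>j. hermitian_mat (M j)"
begin

text \<open>The orthogonal projection onto the kernel of the symbol at \<xi>; writing it as a
  function of the matrix gives measurability in \<xi>.\<close>

definition kerproj :: "real^'n \<Rightarrow> complex^'k \<Rightarrow> complex^'k" where
  "kerproj = fcalc M (\<lambda>t. if t = 0 then 1 else 0)"

lemma kerproj_inner:
  assumes b: "b \<in> EB M \<xi>"
  shows "kerproj \<xi> w \<bullet> b = (if lam M \<xi> b = 0 then w \<bullet> b else 0)"
proof -
  have "kerproj \<xi> w \<bullet> b = (\<Sum>c\<in>EB M \<xi>. if c = b then (if lam M \<xi> b = 0 then w \<bullet> b else 0) else 0)"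
    unfolding kerproj_def fcalc_inner[OF h] by (intro sum.cong refl) (auto simp: EB_inner[OF h b])
  also have "\<dots> = (if lam M \<xi> b = 0 then w \<bullet> b else 0)" using b EB_finite[OF h] by simp
  finally show ?thesis .
qed

lemma Mhom_kerproj: "Mhom M \<xi> *v kerproj \<xi> w = 0"
proof -
  have "Mhom M \<xi> *v kerproj \<xi> w = (\<Sum>b\<in>EB M \<xi>. ((if lam M \<xi> b = 0 then 1 else 0) * (w \<bullet> b)) *\<^sub>R (Mhom M \<xi>
      *v b))"
    unfolding kerproj_def fcalc_def by (simp add: linear_sum[OF linear_Mhom] linear_scale[OF linear_Mhom])
  also have "\<dots> = 0" by (intro sum.neutral ballI) (simp add: EB_eigen[OF h])
  finally show ?thesis .
qed

lemma inner_kerproj: "w \<bullet> kerproj \<xi> w = (norm (kerproj \<xi> w))\<^sup>2"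
proof -
  have "(norm (kerproj \<xi> w))\<^sup>2 = (\<Sum>b\<in>EB M \<xi>. (if lam M \<xi> b = 0 then w \<bullet> b else 0)\<^sup>2)"
    unfolding EB_sum_squares[OF h, of _ \<xi>, symmetric] by (intro sum.cong refl) (simp add: kerproj_inner)
  also have "\<dots> = kerproj \<xi> w \<bullet> w"
    unfolding kerproj_def fcalc_inner[OF h] by (intro sum.cong refl) (auto simp: power2_eq_square)
  finally show ?thesis by (simp add: inner_commute)
qed

lemma norm_kerproj_le: "norm (kerproj \<xi> w) \<le> norm w"
proof -
  have "norm (kerproj \<xi> w) * norm (kerproj \<xi> w) \<le> norm w * norm (kerproj \<xi> w)"
    using Cauchy_Schwarz_ineq2[of w "kerproj \<xi> w"] unfolding inner_kerproj by (simp add: power2_eq_square)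
  then show ?thesis by (cases "kerproj \<xi> w = 0") auto
qed

lemma sq_int_kerproj:
  assumes f: "sq_int f" shows "sq_int (\<lambda>\<xi>. kerproj \<xi> (f \<xi>))"
  using f sq_int_measurable[OF f] norm_kerproj_le unfolding kerproj_def
  by (intro sq_int_bound[OF f] borel_measurable_fcalc_0[OF h]) (auto simp: kerproj_def)

lemma sq_int_indicator_cball: "sq_int (indicator (cball 0 R) :: 'a::euclidean_space \<Rightarrow> real)"
  unfolding sq_int_def
proof
  have "(\<lambda>x::'a. (norm (indicator (cball 0 R) x :: real))\<^sup>2) = indicator (cball 0 R)"
    by (auto simp: indicator_def)
  then show "integrable lborel (\<lambda>x::'a. (norm (indicator (cball 0 R) x :: real))\<^sup>2)"
    by (auto intro!: integrable_real_indicator emeasure_bounded_finite)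
qed (intro borel_measurable_indicator, simp)

text \<open>The kernel component of the transform is itself a test function: cut off to a ball it is
  integrable, and its inverse transform lies in \<open>kerL M\<close>. Orthogonality and Parseval's
  identity then say that its squared norm vanishes, for every radius.\<close>

lemma kerproj_eq_0_AE:
  assumes u0: "fourier_rel u0 f" and orth: "\<forall>v\<in>kerL M. inner_L2 u0 v = 0"
  shows "AE \<xi> in lborel. kerproj \<xi> (f \<xi>) = 0"
proof -
  have f: "sq_int f" using u0 by (elim fourier_relE)
  have P: "sq_int (\<lambda>\<xi>. kerproj \<xi> (f \<xi>))" by (rule sq_int_kerproj[OF f])
  have R: "AE \<xi> in lborel. indicator (cball 0 (real R)) \<xi> *\<^sub>R kerproj \<xi> (f \<xi>) = 0" for R :: nat
  proof -
    let ?w = "\<lambda>\<xi>. indicator (cball 0 (real R)) \<xi> *\<^sub>R kerproj \<xi> (f \<xi>)"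
    have wi: "integrable lborel ?w" by (rule sq_int_mult_integrable_scaleR[OF sq_int_indicator_cball P])
    have w: "sq_int ?w"
      using sq_int_measurable[OF P] by (intro sq_int_bound[OF P]) (auto simp: indicator_def)
    have v: "fourier_rel (\<lambda>x. FT1 ?w (- x)) ?w" by (rule fourier_rel_inverse[OF wi w])
    have "(\<lambda>x. FT1 ?w (- x)) \<in> kerL M"
      unfolding kerL_def mem_Collect_eq
    proof (intro conjI exI[of _ ?w] v)
      show "L2 (\<lambda>x. FT1 ?w (- x))" using v unfolding fourier_rel_def by blast
      show "AE \<xi> in lborel. Mhom M \<xi> *v ?w \<xi> = 0"
        by (simp add: linear_scale[OF linear_Mhom] Mhom_kerproj)
    qed
    then have "inner_L2 f ?w = 0" using orth parseval_fourier_rel[OF u0 wi w] by simp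
    then have I0: "(LINT \<xi>|lborel. f \<xi> \<bullet> ?w \<xi>) = 0" using Re_inner_L2(1)[OF f w] by simp
    have eq: "f \<xi> \<bullet> ?w \<xi> = (norm (?w \<xi>))\<^sup>2" for \<xi>
      by (auto simp: inner_kerproj indicator_def)
    have "AE \<xi> in lborel. (norm (?w \<xi>))\<^sup>2 = 0"
      using I0 w unfolding eq sq_int_def by (subst (asm) integral_nonneg_eq_0_iff_AE) auto
    then show ?thesis by eventually_elim simp
  qed
  have "AE \<xi> in lborel. \<forall>R::nat. indicator (cball 0 (real R)) \<xi> *\<^sub>R kerproj \<xi> (f \<xi>) = 0"
    unfolding AE_all_countable using R by blast
  then show ?thesis
  proof eventually_elim
    case (elim \<xi>)
    obtain R :: nat where "norm \<xi> \<le> real R" using real_arch_simple by blast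
    then show ?case using elim[rule_format, of R] by simp
  qed
qed

end

section \<open>The polynomial weight and the projection\<close>

lemma one_plus_norm_sq_pos: "0 < 1 + (norm (x::'a::real_normed_vector))\<^sup>2"
  by (simp add: add_pos_nonneg)

lemma wt_pos: "0 < wt s x"
  unfolding wt_def using one_plus_norm_sq_pos[of x] by simp

lemma borel_measurable_wt[measurable]: "wt s \<in> borel_measurable borel"
  unfolding wt_def[abs_def] by measurable

lemma wt_half_square: "(wt (s / 2) x)\<^sup>2 = wt s x"
  unfolding wt_def power2_eq_square by (simp add: powr_add[symmetric])

lemma wt_le_1: "s \<le> 0 \<Longrightarrow> wt s x \<le> 1"
  unfolding wt_def using powr_mono[of s 0 "1 + (norm x)\<^sup>2"] one_plus_norm_sq_pos[of x] by simp

text \<open>The projection g lies in \<open>Ups\<close> and may be tested against itself. With the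
  residual orthogonal to g, expanding the square of the projected function gives the
  contraction.\<close>

lemma l2sq_is_E_proj_le:
  fixes M :: "'n::finite \<Rightarrow> complex^'k^'k::finite"
  assumes s: "0 < s" and u: "sq_int u" and E: "is_E_proj M s (\<lambda>x. wt (- s/2) x *\<^sub>R u x) g"
  shows "(\<integral>\<^sup>+x. ennreal ((norm (g x))\<^sup>2) \<partial>lborel) \<le> (\<integral>\<^sup>+x. ennreal (wt (- s) x) * ennreal ((norm (u
      x))\<^sup>2) \<partial>lborel)"
proof -
  let ?F = "\<lambda>x. wt (- s/2) x *\<^sub>R u x"
  have [measurable]: "u \<in> borel_measurable borel" using u by (rule sq_int_measurable)
  have F: "sq_int ?F"
  proof (rule sq_int_bound[OF u])
    show "norm (?F x) \<le> norm (u x)" for x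
      using s wt_pos[of "- s/2" x] wt_le_1[of "- s/2" x] by (simp add: mult_left_le_one_le)
  qed simp
  obtain hh where hh: "L2s s hh" and gh: "g = (\<lambda>x. wt (s/2) x *\<^sub>R hh x)"
    using E unfolding is_E_proj_def Ups_def UpsS_def by auto
  have [measurable]: "hh \<in> borel_measurable borel" using hh by (simp add: L2s_def)
  have "(norm (g x))\<^sup>2 = wt s x * (norm (hh x))\<^sup>2" for x
    unfolding gh by (simp add: power_mult_distrib wt_half_square)
  then have "l2sq g = l2ssq s hh" by (simp add: l2sq_def l2ssq_def nsq_def)
  then have "L2 g" using hh unfolding L2_def L2s_def gh by simp
  then have g: "sq_int g" by (simp add: L2_iff_sq_int)
  have "inner_L2 (\<lambda>x. ?F x - g x) g = 0" using E unfolding is_E_proj_def by blast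
  then have 0: "(LINT x|lborel. (?F x - g x) \<bullet> g x) = 0" using Re_inner_L2(1)[OF sq_int_diff[OF F g] g]
      by simp
  have i: "integrable lborel (\<lambda>x. (norm (?F x))\<^sup>2)" "integrable lborel (\<lambda>x. (norm (g x))\<^sup>2)"
    "integrable lborel (\<lambda>x. (?F x - g x) \<bullet> g x)"
    using F g Re_inner_L2(2)[OF sq_int_diff[OF F g] g] by (auto simp: sq_int_def)
  have pw: "(norm b)\<^sup>2 + 2 * ((a - b) \<bullet> b) \<le> (norm a)\<^sup>2" for a b :: "complex^'k"
    using zero_le_power2[of "norm (a - b)"]
    by (simp add: power2_norm_eq_inner inner_diff_left inner_diff_right inner_commute)
  have "(LINT x|lborel. (norm (g x))\<^sup>2) = (LINT x|lborel. (norm (g x))\<^sup>2 + 2 * ((?F x - g x) \<bullet> g x))"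
    using i 0 by simp
  also have "\<dots> \<le> (LINT x|lborel. (norm (?F x))\<^sup>2)"
    by (intro integral_mono pw Bochner_Integration.integrable_add integrable_mult_right i)
  finally have "l2sq g \<le> l2sq ?F" unfolding l2sq_eq[OF g] l2sq_eq[OF F] by (rule ennreal_leI)
  moreover have "(norm (?F x))\<^sup>2 = wt (- s) x * (norm (u x))\<^sup>2" for x
    using wt_half_square[of "- s" x] by (simp add: power_mult_distrib)
  ultimately show ?thesis
    by (simp add: l2sq_def nsq_def ennreal_mult less_imp_le[OF wt_pos])
qed

text \<open>For each x one term of the series suffices, the one whose scale matches x; the sum is
  there because the index depends on x.\<close>

lemma wt_le_suminf_gauss:
  fixes x :: "real^'n::finite"
  assumes s: "0 < s"
  shows "ennreal (wt (- s) x) \<le> (\<Sum>m. ennreal (exp 1 * 4 powr s * 4 powr (- s * real m)) * ennreal (exp (-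
      (1 / 2 ^ m * norm x)\<^sup>2)))"
proof -
  define y where "y = 1 + (norm x)\<^sup>2"
  have y: "y \<ge> 1" unfolding y_def by simp
  \<comment> \<open>Here 4^(m - 1) \<le> y \<le> 4^m. The upper bound keeps the Gaussian above
    exp(-1), which costs the factor e; the lower bound costs the factor
    \<open>4 powr s\<close>.\<close>
  define m where "m = nat \<lceil>log 4 y\<rceil>"
  have "log 4 y \<ge> 0" using y by simp
  then have m: "log 4 y \<le> real m" "real m \<le> log 4 y + 1" unfolding m_def by linarith+
  have y1: "y \<le> 4 powr real m" using m(1) y by (simp add: log_le_iff)
  have "4 powr (real m - 1) \<le> y" using m(2) y by (simp add: le_log_iff[symmetric])
  then have "y powr (- s) \<le> (4 powr (real m - 1)) powr (- s)" using s by (intro powr_mono2') auto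
  also have "\<dots> = 4 powr s * 4 powr (- s * real m)"
    unfolding powr_powr powr_add[symmetric] by (simp add: algebra_simps)
  finally have 1: "y powr (- s) \<le> 4 powr s * 4 powr (- s * real m)" .
  have "(1 / 2 ^ m * norm x)\<^sup>2 = (norm x)\<^sup>2 / 4 ^ m"
    by (simp add: power_divide power2_eq_square power_mult_distrib[symmetric])
  also have "\<dots> \<le> 1" using y1 unfolding y_def by (simp add: powr_realpow)
  finally have 2: "exp (-1) \<le> exp (- (1 / 2 ^ m * norm x)\<^sup>2)" by simp
  have "wt (- s) x = exp 1 * (y powr (- s)) * exp (-1)" by (simp add: wt_def y_def exp_minus)
  also have "\<dots> \<le> exp 1 * (4 powr s * 4 powr (- s * real m)) * exp (- (1 / 2 ^ m * norm x)\<^sup>2)"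
    using 1 2 by (intro mult_mono) auto
  finally have "ennreal (wt (- s) x) \<le> ennreal (exp 1 * 4 powr s * 4 powr (- s * real m)) * ennreal (exp
      (- (1 / 2 ^ m * norm x)\<^sup>2))"
    by (simp add: ennreal_mult[symmetric] mult.assoc ennreal_leI)
  also have "\<dots> \<le> (\<Sum>m. ennreal (exp 1 * 4 powr s * 4 powr (- s * real m)) * ennreal (exp (- (1 / 2 ^ m *
      norm x)\<^sup>2)))"
    using sum_le_suminf[OF summableI, of "{m}" "\<lambda>m. ennreal (exp 1 * 4 powr s * 4 powr (- s * real m)) *
        ennreal (exp (- (1 / 2 ^ m * norm x)\<^sup>2))"]
    by simp
  finally show ?thesis .
qed

theorem theorem8p1:
  fixes M :: "'n::finite \<Rightarrow> complex^'k^'k::finite" and s :: real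
  assumes "CARD('n) \<ge> 2"
    and "\<forall>j. hermitian_mat (M j)"
    and "strongly_propagative M"
    and "s > 1/2"
  shows "\<exists>C>0. \<forall>(u0::real^'n \<Rightarrow> complex^'k) u0h
            (u::real \<Rightarrow> real^'n \<Rightarrow> complex^'k) (uZ::real \<Rightarrow> real^'n \<Rightarrow> complex^'k).
     L2 u0 \<and> fourier_rel u0 u0h \<and> (\<forall>v\<in>kerL M. inner_L2 u0 v = 0) \<and>
     (\<forall>t. fourier_rel (u t) (\<lambda>\<xi>. expM t (Mhom M \<xi>) (u0h \<xi>))) \<and>
     (\<forall>t. is_E_proj M s (\<lambda>x. wt (- s/2) x *\<^sub>R u t x) (uZ t))
     \<longrightarrow> (\<integral>\<^sup>+ t. (\<integral>\<^sup>+ x. ennreal ((norm (uZ t x))\<^sup>2) \<partial>lborel) \<partial>lborel) \<le> ennreal C * l2sq u0"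
proof -
  note h = assms(2)
  obtain c0 where c0: "c0 > 0" and lower: "\<And>\<xi> \<mu> v. v \<noteq> 0 \<Longrightarrow> Mhom M \<xi> *v v = \<mu> *\<^sub>R v \<Longrightarrow> \<mu> \<noteq> 0 \<Longrightarrow> c0 * norm \<xi>
      \<le> \<bar>\<mu>\<bar>"
    using eigenvalue_lower_bound[OF h assms(3)] by blast
  have s: "s > 0" "s > 1/2" using assms(4) by auto
  \<comment> \<open>The constant of \<open>spacetime_le\<close> is B/d, hence B 2^m at the scale d =
    2^-m.\<close>
  define B where "B = 2 * pi * (Cg CARD('n) * (real DIM(complex^'k) / c0))"
  have B: "B > 0" unfolding B_def using c0 Cg_pos[of "CARD('n)"] by simp
  define a where "a m = exp 1 * 4 powr s * 4 powr (- s * real m)" for m :: nat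
  have a: "a m > 0" for m unfolding a_def by simp
  \<comment> \<open>The loss 2^m against the decay 4^(-s m) leaves a geometric series with ratio
    2^(1 - 2 s), which is below 1 because s > 1/2.\<close>
  have am: "a m * (B * 2 ^ m) = exp 1 * 4 powr s * B * (2 powr (1 - 2 * s)) ^ m" for m
  proof -
    have "4 powr (- s * real m) * 2 ^ m = (2 powr (1 - 2 * s)) ^ m"
    proof -
      have "(4::real) powr y = 2 powr (2 * y)" for y
        using powr_powr[of 2 2 y] by simp
      then have "4 powr (- s * real m) * 2 ^ m = 2 powr (2 * (- s * real m)) * 2 powr (real m)"
        by (simp add: powr_realpow)
      also have "\<dots> = (2 powr (1 - 2 * s)) ^ m"
        unfolding powr_add[symmetric] by (simp add: powr_power algebra_simps)
      finally show ?thesis .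
    qed
    then show ?thesis unfolding a_def by (simp add: mult_ac)
  qed
  have sm: "summable (\<lambda>m. a m * (B * 2 ^ m))"
    unfolding am using s by (intro summable_mult summable_geometric) (simp add: powr_less_one)
  define C where "C = (\<Sum>m. a m * (B * 2 ^ m))"
  have C: "C > 0" unfolding C_def using a B by (intro suminf_pos sm) auto
  show ?thesis
  proof (intro exI[of _ C] conjI C allI impI, elim conjE)
    fix u0 u0h :: "real^'n \<Rightarrow> complex^'k" and u uZ :: "real \<Rightarrow> real^'n \<Rightarrow> complex^'k"
    assume u0: "fourier_rel u0 u0h" and orth: "\<forall>v\<in>kerL M. inner_L2 u0 v = 0"
      and u: "\<forall>t. fourier_rel (u t) (\<lambda>\<xi>. expM t (Mhom M \<xi>) (u0h \<xi>))"
      and uZ: "\<forall>t. is_E_proj M s (\<lambda>x. wt (- s/2) x *\<^sub>R u t x) (uZ t)"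
    have uh: "sq_int u0h" using u0 by (elim fourier_relE)
    have ut: "sq_int (u t)" for t using u by (auto elim: fourier_relE)
    have [measurable]: "u t \<in> borel_measurable borel" for t using ut by (rule sq_int_measurable)
    \<comment> \<open>The pointwise estimates need orthogonality to the kernel at every frequency,
      while the hypothesis on \<open>u0\<close> gives it almost everywhere. Subtracting the kernel
      component changes \<open>u0h\<close> only on a null set.\<close>
    define f where "f \<xi> = u0h \<xi> - kerproj M \<xi> (u0h \<xi>)" for \<xi>
    have f: "sq_int f" unfolding f_def by (intro sq_int_diff uh sq_int_kerproj[OF h])
    have forth: "f \<xi> \<bullet> b = 0" if "b \<in> EB M \<xi>" "lam M \<xi> b = 0" for \<xi> b
      using that by (simp add: f_def inner_diff_left kerproj_inner[OF h])
    have fAE: "AE \<xi> in lborel. f \<xi> = u0h \<xi>"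
      using kerproj_eq_0_AE[OF h u0 orth] by eventually_elim (simp add: f_def)
    have "l2sq f = l2sq u0h" unfolding l2sq_def nsq_def
      by (rule nn_integral_cong_AE) (use fAE in \<open>eventually_elim, simp\<close>)
    then have lf: "l2sq f = l2sq u0" using fourier_rel_norm[OF u0] by simp
    define J where "J m t = (\<integral>\<^sup>+x. ennreal (exp (- (1 / 2 ^ m * norm x)\<^sup>2) * (norm (u t x))\<^sup>2) \<partial>lborel)"
        for m :: nat and t
    have J: "J m t = (\<integral>\<^sup>+\<xi>. ennreal ((norm (gconv (1 / 2 ^ m) (U M f t) \<xi>))\<^sup>2) \<partial>lborel)" for m t
    proof -
      have "gconv (1 / 2 ^ m) (\<lambda>\<xi>. expM t (Mhom M \<xi>) (u0h \<xi>)) \<xi> = gconv (1 / 2 ^ m) (U M f t) \<xi>" for \<xi>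
        unfolding gconv_def
      proof (rule integral_cong_AE)
        show "AE \<eta> in lborel. gauss (1 / 2 ^ m) (\<xi> - \<eta>) *\<^sub>R expM t (Mhom M \<eta>) (u0h \<eta>) = gauss (1 / 2 ^ m)
            (\<xi> - \<eta>) *\<^sub>R U M f t \<eta>"
          using fAE by eventually_elim (simp add: U_def[OF h c0 lower f forth])
        show "(\<lambda>\<eta>. gauss (1 / 2 ^ m) (\<xi> - \<eta>) *\<^sub>R expM t (Mhom M \<eta>) (u0h \<eta>)) \<in> borel_measurable lborel"
          using sq_int_measurable[OF uh] by (intro borel_measurable_scaleR borel_measurable_expM[OF h]) auto
        show "(\<lambda>\<eta>. gauss (1 / 2 ^ m) (\<xi> - \<eta>) *\<^sub>R U M f t \<eta>) \<in> borel_measurable lborel"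
          by (intro borel_measurable_scaleR U_measurable[OF h c0 lower f forth]) auto
      qed
      then show ?thesis unfolding J_def
        by (subst nn_integral_exp_norm_fourier_rel[OF u[rule_format]]) (auto simp: gconv_def)
    qed
    show "(\<integral>\<^sup>+ t. (\<integral>\<^sup>+ x. ennreal ((norm (uZ t x))\<^sup>2) \<partial>lborel) \<partial>lborel) \<le> ennreal C * l2sq u0"
    proof -
      \<comment> \<open>The family \<open>u t\<close> carries no joint measurability in t and x. The
        Fourier-side formula for \<open>J\<close> supplies measurability in t, through the explicit
        evolution \<open>U\<close>.\<close>
      have mJ: "J m \<in> borel_measurable lborel" for m
      proof -
        note [measurable (raw)] = U_measurable[OF h c0 lower f forth]
        show ?thesis unfolding J gconv_def by measurable
      qed
      have IJ: "(\<integral>\<^sup>+t. J m t \<partial>lborel) \<le> ennreal (B * 2 ^ m) * l2sq u0" for m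
      proof -
        have e: "2 * pi * (Cg CARD('n) * (real DIM(complex^'k) / c0) / (1 / 2 ^ m)) = B * 2 ^ m"
          unfolding B_def by simp
        have "(\<integral>\<^sup>+t. J m t \<partial>lborel) \<le> ennreal (2 * pi * (Cg CARD('n) * (real DIM(complex^'k) / c0) / (1 /
            2 ^ m))) * l2sq f"
          unfolding J by (rule spacetime_le[OF h c0 lower f forth]) simp_all
        then show ?thesis unfolding e lf .
      qed
      \<comment> \<open>The comparison is made at each fixed t, so that monotonicity of the upper
        integral applies without measurability of \<open>uZ\<close> in time; all later exchanges
        concern \<open>J\<close> only.\<close>
      have "(\<integral>\<^sup>+ x. ennreal ((norm (uZ t x))\<^sup>2) \<partial>lborel) \<le> (\<Sum>m. ennreal (a m) * J m t)" for t
      proof -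
        have "(\<integral>\<^sup>+ x. ennreal ((norm (uZ t x))\<^sup>2) \<partial>lborel) \<le> (\<integral>\<^sup>+x. ennreal (wt (- s) x) * ennreal ((norm
            (u t x))\<^sup>2) \<partial>lborel)"
          by (rule l2sq_is_E_proj_le[OF s(1) ut uZ[rule_format]])
        also have "\<dots> \<le> (\<integral>\<^sup>+x. (\<Sum>m. ennreal (a m) * ennreal (exp (- (1 / 2 ^ m * norm x)\<^sup>2))) * ennreal
            ((norm (u t x))\<^sup>2) \<partial>lborel)"
          unfolding a_def by (intro nn_integral_mono mult_right_mono wt_le_suminf_gauss s) auto
        also have "\<dots> = (\<integral>\<^sup>+x. (\<Sum>m. ennreal (a m) * ennreal (exp (- (1 / 2 ^ m * norm x)\<^sup>2) * (norm (u t
            x))\<^sup>2)) \<partial>lborel)"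
          by (simp only: ennreal_suminf_multc[symmetric] mult.assoc ennreal_mult' exp_ge_zero)
        also have "\<dots> = (\<Sum>m. \<integral>\<^sup>+x. ennreal (a m) * ennreal (exp (- (1 / 2 ^ m * norm x)\<^sup>2) * (norm (u t
            x))\<^sup>2) \<partial>lborel)"
          by (rule nn_integral_suminf) measurable
        also have "\<dots> = (\<Sum>m. ennreal (a m) * J m t)"
          unfolding J_def by (intro suminf_cong nn_integral_cmult) measurable
        finally show ?thesis .
      qed
      then have "(\<integral>\<^sup>+ t. (\<integral>\<^sup>+ x. ennreal ((norm (uZ t x))\<^sup>2) \<partial>lborel) \<partial>lborel) \<le> (\<integral>\<^sup>+t. (\<Sum>m. ennreal (a
          m) * J m t) \<partial>lborel)"
        by (rule nn_integral_mono)
      also have "\<dots> = (\<Sum>m. ennreal (a m) * (\<integral>\<^sup>+t. J m t \<partial>lborel))"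
        using mJ by (subst nn_integral_suminf) (auto simp: nn_integral_cmult)
      also have "\<dots> \<le> (\<Sum>m. ennreal (a m * (B * 2 ^ m)) * l2sq u0)"
      proof (rule suminf_le[OF _ summableI summableI])
        fix m
        have "ennreal (a m) * (\<integral>\<^sup>+t. J m t \<partial>lborel) \<le> ennreal (a m) * (ennreal (B * 2 ^ m) * l2sq u0)"
          by (intro mult_left_mono IJ) auto
        then show "ennreal (a m) * (\<integral>\<^sup>+t. J m t \<partial>lborel) \<le> ennreal (a m * (B * 2 ^ m)) * l2sq u0"
          using a[of m] B by (simp add: ennreal_mult mult.assoc)
      qed
      also have "\<dots> = (\<Sum>m. ennreal (a m * (B * 2 ^ m))) * l2sq u0" by (rule ennreal_suminf_multc)
      also have "(\<Sum>m. ennreal (a m * (B * 2 ^ m))) = ennreal C"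
        unfolding C_def using a B by (intro suminf_ennreal2 sm) (auto intro: less_imp_le)
      finally show ?thesis .
    qed
  qed
qed

end
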